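(* The functors $\mathcal X\colon\mathsf{DMS}\to\mathsf{PGPS}$ and $\mathcal A\colon\mathsf{PGPS}\to\mathsf{DMS}$ of generalized Priestley duality for distributive meet-semilattices are the compositions $\mathcal X=\mathcal Y\circ\mathcal F$ and $\mathcal A=\mathcal K\circ\mathcal V^a$, where $\mathcal F\colon\mathsf{DMS}\to\mathsf{AlgFrm_{Sup}}$ and $\mathcal K\colon\mathsf{AlgFrm_{Sup}}\to\mathsf{DMS}$ are the filter and compact-element functors, and $\mathcal V^a\colon\mathsf{PGPS}\to\mathsf{AlgFrm_{Sup}}$ and $\mathcal Y\colon\mathsf{AlgFrm_{Sup}}\to\mathsf{PGPS}$ are the contravariant functors described in the context.
   Context: Semilattices. A meet-semilattice is a poset with all finite meets, including the empty one (so it has a top $1$). It is distributive if $a\wedge b\le c$ implies there are $a'\ge a$, $b'\ge b$ with $a'\wedge b'=c$. $\mathsf{DMS}$ is the category of distributive meet-semilattices and maps preserving all finite meets (including $1$). Algebraic frames. $\mathsf K(L)$ is the set of compact elements of a complete lattice $L$. An algebraic frame is a frame in which every element is a join of compact elements. $\mathsf{AlgFrm_{Sup}}$ is the category of algebraic frames and maps preserving arbitrary joins and compact elements. Functors $\mathcal F,\mathcal K$. $\mathcal F(M)$ is the set of filters of $M$ (nonempty upsets closed under $\wedge$, $M$ included) ordered by inclusion, and for $\alpha\colon M_1\to M_2$, $\mathcal F(\alpha)(G)={\uparrow}\alpha[G]$. $\mathcal K(L)$ is $\mathsf K(L)$ with the dual of the order of $L$, and $\mathcal K(\alpha)$ is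 the restriction of $\alpha$. Pointed generalized Priestley spaces. A Priestley space is a compact space $X$ with a partial order such that $x\not\le y$ implies there is a clopen upset containing $x$ and missing $y$. If $X$ is a Priestley space with a distinguished subset $X_0$, a clopen upset $U$ is admissible if the maximal points of $X\setminus U$ lie in $X_0$; $\mathcal A(X)$ is the set of admissible clopen upsets, and $\mathcal I_x=\{U\in\mathcal A(X)\mid x\notin U\}$. A pointed generalized Priestley space is a tuple $(X,\tau,\le,X_0,m)$ such that: $(X,\tau,\le)$ is a Priestley space; $m$ is the unique maximum of $X$; $X_0$ is a dense subset of $X\setminus\{m\}$; for each $x\ne m$ there is $y\in X_0$ with $x\le y$; $x\in X_0$ iff $\mathcal I_x$ is nonempty and directed under inclusion; $x\le y$ iff for all $U\in\mathcal A(X)$, $x\in U$ implies $y\in U$. For $R\subseteq X\times Y$ write $R[x]=\{y\mid x\mathrel Ry\}$, $\Box_RU=\{x\mid R[x]\subseteq U\}$. A generalized Priestley morphism $R\subseteq X\times Y$ satisfies: (i) if $x\not\mathrel Ry$ there is $U\in\mathcal A(Y)$ with $R[x]\subseteq U$, $y\notin U$; (ii) $U\in\mathcal A(Y)$ implies $\Box_RU\in\mathcal A(X)$. $\mathsf{PGPS}$ is the resulting category: identities are $\le$ and $x\mathrel{(S*R)}z$ iff for all $U\in\mathcal A(Z)$, $x\in\Box_R\Box_SU$ implies $z\in U$. Functors $\mathcal A,\mathcal X$. $\mathcal A$ sends $X$ to $\mathcal A(X)$ ordered by inclusion and $R\subseteq X\times Y$ to $\Box_R\colon\mathcal A(Y)\to\mathcal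 A(X)$. A proper filter $P$ of $M\in\mathsf{DMS}$ is prime if $F_1\cap F_2\subseteq P$ implies $F_1\subseteq P$ or $F_2\subseteq P$ for filters $F_1,F_2$; $\mathsf{Pr}(M)$ is the set of prime filters. The distributive envelope $\mathsf D(M)$ is the lattice of subsets of $\mathsf{Pr}(M)$ generated, under finite nonempty unions and intersections, by the sets $\{P\in\mathsf{Pr}(M)\mid a\in P\}$, $a\in M$; $M$ embeds in $\mathsf D(M)$ via $a\mapsto\{P\mid a\in P\}$ and is identified with its image. A filter of $M$ is optimal if it is $P\cap M$ for some (proper) prime filter $P$ of $\mathsf D(M)$; $\mathsf{Opt}(M)$ is the set of optimal filters. $\mathcal X(M)=(X_M,\tau,\subseteq,\mathsf{Pr}(M),M)$, where $X_M=\mathsf{Opt}(M)\cup\{M\}$ and $\tau$ has as subbasis the sets $\varphi(a)=\{x\in X_M\mid a\in x\}$ and their complements. For $\alpha\colon M_1\to M_2$, $\mathcal X(\alpha)\subseteq X_{M_2}\times X_{M_1}$ relates $x$ to $y$ iff $\alpha^{-1}(x)\subseteq y$. Functor $\mathcal V^a$. A closed upset $C$ of $X\in\mathsf{PGPS}$ is admissible if $X\setminus C={\downarrow}(X_0\setminus C)$. $\mathcal V^a(X)$ is the set of admissible closed upsets ordered by $\supseteq$; $\mathcal V^a(R)=\Box_R\colon\mathcal V^a(Y)\to\mathcal V^a(X)$ for $R\subseteq X\times Y$. Functor $\mathcal Y$. $a\ll b$ means: $b\le\bigvee S$ implies $a\le\bigvee T$ for some finite $T\subseteq S$. An element $p\ne1$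 is prime if $a\wedge b\le p$ implies $a\le p$ or $b\le p$; pseudoprime if for all $n\ge1$, $a_1\wedge\dots\wedge a_n\ll p$ implies some $a_i\le p$. $\mathsf P(L)$, $\mathsf{PP}(L)$ denote the sets of primes and pseudoprimes, $Y_L=\mathsf{PP}(L)\cup\{1\}$, and $\mathcal Y(L)=(Y_L,\lambda,\le,\mathsf P(L),1)$, where $\lambda$ is the restriction of the topology on $L$ with subbasis $\{{\uparrow}k\mid k\in\mathsf K(L)\}\cup\{L\setminus{\uparrow}l\mid l\in\mathsf K(L)\}$. For $\alpha\colon L_1\to L_2$ with right adjoint $r$, $\mathcal Y(\alpha)\subseteq Y_{L_2}\times Y_{L_1}$ relates $p$ to $q$ iff $r(p)\le q$. *)

theory Defs
  imports "HOL-Analysis.Analysis" "HOL-Algebra.Galois_Connection"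
begin

section \<open>Categories and functors\<close>

text \<open>Morphisms are not tagged with their domain and codomain, so composition and the action of a
  functor on morphisms take the objects involved as arguments: \<open>Comp C A B D g f\<close> is the
  composition of \<open>f : A \<rightarrow> B\<close> and \<open>g : B \<rightarrow> D\<close>, and \<open>AMap F A B f\<close> is the image of
  \<open>f : A \<rightarrow> B\<close> under \<open>F\<close>.\<close>

record ('o, 'm) category =
  Obj :: "'o set"
  Hom :: "'o \<Rightarrow> 'o \<Rightarrow> 'm set"
  Ident :: "'o \<Rightarrow> 'm"
  Comp :: "'o \<Rightarrow> 'o \<Rightarrow> 'o \<Rightarrow> 'm \<Rightarrow> 'm \<Rightarrow> 'm"

definition is_category :: "('o, 'm) category \<Rightarrow> bool" where
  "is_category C \<longleftrightarrow>
     (\<forall>A\<in>Obj C. Ident C A \<in> Hom C A A) \<and>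
     (\<forall>A\<in>Obj C. \<forall>B\<in>Obj C. \<forall>D\<in>Obj C. \<forall>f\<in>Hom C A B. \<forall>g\<in>Hom C B D.
        Comp C A B D g f \<in> Hom C A D) \<and>
     (\<forall>A\<in>Obj C. \<forall>B\<in>Obj C. \<forall>f\<in>Hom C A B.
        Comp C A A B f (Ident C A) = f \<and> Comp C A B B (Ident C B) f = f) \<and>
     (\<forall>A\<in>Obj C. \<forall>B\<in>Obj C. \<forall>D\<in>Obj C. \<forall>E\<in>Obj C.
        \<forall>f\<in>Hom C A B. \<forall>g\<in>Hom C B D. \<forall>h\<in>Hom C D E.
        Comp C A B E (Comp C B D E h g) f = Comp C A D E h (Comp C A B D g f))"

record ('o, 'm, 'p, 'n) functor_data =
  OMap :: "'o \<Rightarrow> 'p"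
  AMap :: "'o \<Rightarrow> 'o \<Rightarrow> 'm \<Rightarrow> 'n"

definition covariant_functor ::
  "('o, 'm) category \<Rightarrow> ('p, 'n) category \<Rightarrow> ('o, 'm, 'p, 'n) functor_data \<Rightarrow> bool" where
  "covariant_functor C D F \<longleftrightarrow>
     is_category C \<and> is_category D \<and>
     (\<forall>A\<in>Obj C. OMap F A \<in> Obj D) \<and>
     (\<forall>A\<in>Obj C. \<forall>B\<in>Obj C. \<forall>f\<in>Hom C A B. AMap F A B f \<in> Hom D (OMap F A) (OMap F B)) \<and>
     (\<forall>A\<in>Obj C. AMap F A A (Ident C A) = Ident D (OMap F A)) \<and>
     (\<forall>A\<in>Obj C. \<forall>B\<in>Obj C. \<forall>E\<in>Obj C. \<forall>f\<in>Hom C A B. \<forall>g\<in>Hom C B E.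
        AMap F A E (Comp C A B E g f) =
        Comp D (OMap F A) (OMap F B) (OMap F E) (AMap F B E g) (AMap F A B f))"

definition contravariant_functor ::
  "('o, 'm) category \<Rightarrow> ('p, 'n) category \<Rightarrow> ('o, 'm, 'p, 'n) functor_data \<Rightarrow> bool" where
  "contravariant_functor C D F \<longleftrightarrow>
     is_category C \<and> is_category D \<and>
     (\<forall>A\<in>Obj C. OMap F A \<in> Obj D) \<and>
     (\<forall>A\<in>Obj C. \<forall>B\<in>Obj C. \<forall>f\<in>Hom C A B. AMap F A B f \<in> Hom D (OMap F B) (OMap F A)) \<and>
     (\<forall>A\<in>Obj C. AMap F A A (Ident C A) = Ident D (OMap F A)) \<and>
     (\<forall>A\<in>Obj C. \<forall>B\<in>Obj C. \<forall>E\<in>Obj C. \<forall>f\<in>Hom C A B. \<forall>g\<in>Hom C B E.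
        AMap F A E (Comp C A B E g f) =
        Comp D (OMap F E) (OMap F B) (OMap F A) (AMap F A B f) (AMap F B E g))"

text \<open>The composite \<open>G \<circ> F\<close> for covariant \<open>F\<close> and for contravariant \<open>F\<close>; the variance of \<open>F\<close>
  determines the domain and codomain of the morphism to which \<open>G\<close> is applied. \<open>G\<close> may have
  either variance.\<close>

definition after_covariant ::
  "('p, 'n, 'q, 'k) functor_data \<Rightarrow> ('o, 'm, 'p, 'n) functor_data \<Rightarrow> ('o, 'm, 'q, 'k) functor_data"
  where
  "after_covariant G F =
     \<lparr>OMap = (\<lambda>A. OMap G (OMap F A)),
      AMap = (\<lambda>A B f. AMap G (OMap F A) (OMap F B) (AMap F A B f))\<rparr>"

definition after_contravariant ::
  "('p, 'n, 'q, 'k) functor_data \<Rightarrow> ('o, 'm, 'p, 'n) functor_data \<Rightarrow> ('o, 'm, 'q, 'k) functor_data"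
  where
  "after_contravariant G F =
     \<lparr>OMap = (\<lambda>A. OMap G (OMap F A)),
      AMap = (\<lambda>A B f. AMap G (OMap F B) (OMap F A) (AMap F A B f))\<rparr>"

text \<open>Equality of functors with domain \<open>C\<close>; values at arguments that are not objects or morphisms
  of \<open>C\<close> are irrelevant.\<close>

definition functors_equal ::
  "('o, 'm) category \<Rightarrow> ('o, 'm, 'p, 'n) functor_data \<Rightarrow> ('o, 'm, 'p, 'n) functor_data \<Rightarrow> bool"
  where
  "functors_equal C F G \<longleftrightarrow>
     (\<forall>A\<in>Obj C. OMap F A = OMap G A) \<and>
     (\<forall>A\<in>Obj C. \<forall>B\<in>Obj C. \<forall>f\<in>Hom C A B. AMap F A B f = AMap G A B f)"


section \<open>Distributive meet-semilattices\<close>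

text \<open>Posets are the \<open>gorder\<close> structures of HOL-Algebra. Maps between them are extensional
  (\<open>undefined\<close> outside the carrier), so that equality of morphisms is equality of functions.\<close>

definition meet_semilattice :: "'a gorder \<Rightarrow> bool" where
  "meet_semilattice M \<longleftrightarrow> partial_order M \<and>
     (\<forall>A. finite A \<and> A \<subseteq> carrier M \<longrightarrow> (\<exists>i. greatest M i (Lower M A)))"

definition distributive_meet_semilattice :: "'a gorder \<Rightarrow> bool" where
  "distributive_meet_semilattice M \<longleftrightarrow> meet_semilattice M \<and>
     (\<forall>a\<in>carrier M. \<forall>b\<in>carrier M. \<forall>c\<in>carrier M. a \<sqinter>\<^bsub>M\<^esub> b \<sqsubseteq>\<^bsub>M\<^esub> c \<longrightarrow>
        (\<exists>a'\<in>carrier M. \<exists>b'\<in>carrier M. a \<sqsubseteq>\<^bsub>M\<^esub> a' \<and> b \<sqsubseteq>\<^bsub>M\<^esub> b' \<and> a' \<sqinter>\<^bsub>M\<^esub> b' = c))"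

definition finite_meet_hom :: "'a gorder \<Rightarrow> 'b gorder \<Rightarrow> ('a \<Rightarrow> 'b) set" where
  "finite_meet_hom M N = {f \<in> carrier M \<rightarrow>\<^sub>E carrier N.
     \<forall>A. finite A \<and> A \<subseteq> carrier M \<longrightarrow> f (\<Sqinter>\<^bsub>M\<^esub>A) = \<Sqinter>\<^bsub>N\<^esub>(f ` A)}"

definition DMS :: "('a gorder, 'a \<Rightarrow> 'a) category" where
  "DMS = \<lparr>Obj = {M. distributive_meet_semilattice M},
          Hom = finite_meet_hom,
          Ident = (\<lambda>M. restrict (\<lambda>x. x) (carrier M)),
          Comp = (\<lambda>M N K g f. compose (carrier M) g f)\<rparr>"


section \<open>Algebraic frames\<close>

definition way_below :: "'a gorder \<Rightarrow> 'a \<Rightarrow> 'a \<Rightarrow> bool" where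
  "way_below L a b \<longleftrightarrow>
     (\<forall>S. S \<subseteq> carrier L \<and> b \<sqsubseteq>\<^bsub>L\<^esub> \<Squnion>\<^bsub>L\<^esub>S \<longrightarrow> (\<exists>T. finite T \<and> T \<subseteq> S \<and> a \<sqsubseteq>\<^bsub>L\<^esub> \<Squnion>\<^bsub>L\<^esub>T))"

definition compact_elements :: "'a gorder \<Rightarrow> 'a set" where
  "compact_elements L = {k \<in> carrier L. way_below L k k}"

definition frame :: "'a gorder \<Rightarrow> bool" where
  "frame L \<longleftrightarrow> complete_lattice L \<and>
     (\<forall>a\<in>carrier L. \<forall>S. S \<subseteq> carrier L \<longrightarrow> a \<sqinter>\<^bsub>L\<^esub> (\<Squnion>\<^bsub>L\<^esub>S) = \<Squnion>\<^bsub>L\<^esub>((\<lambda>s. a \<sqinter>\<^bsub>L\<^esub> s) ` S))"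

definition algebraic_frame :: "'a gorder \<Rightarrow> bool" where
  "algebraic_frame L \<longleftrightarrow> frame L \<and>
     (\<forall>a\<in>carrier L. \<exists>S. S \<subseteq> compact_elements L \<and> a = \<Squnion>\<^bsub>L\<^esub>S)"

definition join_compact_hom :: "'a gorder \<Rightarrow> 'b gorder \<Rightarrow> ('a \<Rightarrow> 'b) set" where
  "join_compact_hom L M = {f \<in> carrier L \<rightarrow>\<^sub>E carrier M.
     (\<forall>S. S \<subseteq> carrier L \<longrightarrow> f (\<Squnion>\<^bsub>L\<^esub>S) = \<Squnion>\<^bsub>M\<^esub>(f ` S)) \<and>
     f ` compact_elements L \<subseteq> compact_elements M}"

definition AlgFrmSup :: "('a gorder, 'a \<Rightarrow> 'a) category" where
  "AlgFrmSup = \<lparr>Obj = {L. algebraic_frame L},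
                Hom = join_compact_hom,
                Ident = (\<lambda>L. restrict (\<lambda>x. x) (carrier L)),
                Comp = (\<lambda>L M N g f. compose (carrier L) g f)\<rparr>"


section \<open>The functors \<open>\<F>\<close> and \<open>\<K>\<close>\<close>

definition filters :: "'a gorder \<Rightarrow> 'a set set" where
  "filters M = {F. F \<subseteq> carrier M \<and> F \<noteq> {} \<and>
     (\<forall>x\<in>F. \<forall>y\<in>carrier M. x \<sqsubseteq>\<^bsub>M\<^esub> y \<longrightarrow> y \<in> F) \<and>
     (\<forall>x\<in>F. \<forall>y\<in>F. x \<sqinter>\<^bsub>M\<^esub> y \<in> F)}"

definition filter_frame :: "'a gorder \<Rightarrow> 'a set gorder" where
  "filter_frame M = \<lparr>carrier = filters M, eq = (=), le = (\<subseteq>)\<rparr>"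

definition filter_map :: "'a gorder \<Rightarrow> 'b gorder \<Rightarrow> ('a \<Rightarrow> 'b) \<Rightarrow> 'a set \<Rightarrow> 'b set" where
  "filter_map M N \<alpha> = restrict (\<lambda>G. {y \<in> carrier N. \<exists>x\<in>G. \<alpha> x \<sqsubseteq>\<^bsub>N\<^esub> y}) (filters M)"

definition functor_F :: "('a gorder, 'a \<Rightarrow> 'a, 'a set gorder, 'a set \<Rightarrow> 'a set) functor_data" where
  "functor_F = \<lparr>OMap = filter_frame, AMap = filter_map\<rparr>"

definition compact_dual :: "'a gorder \<Rightarrow> 'a gorder" where
  "compact_dual L = (inv_gorder L)\<lparr>carrier := compact_elements L\<rparr>"

definition functor_K :: "('a gorder, 'a \<Rightarrow> 'a, 'a gorder, 'a \<Rightarrow> 'a) functor_data" where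
  "functor_K = \<lparr>OMap = compact_dual, AMap = (\<lambda>L M \<alpha>. restrict \<alpha> (compact_elements L))\<rparr>"


section \<open>Pointed generalized Priestley spaces\<close>

record 'a priestley = "'a gorder" +
  topol :: "'a topology"
  dense_part :: "'a set"
  max_point :: 'a

definition upset :: "'a priestley \<Rightarrow> 'a set \<Rightarrow> bool" where
  "upset X U \<longleftrightarrow> U \<subseteq> carrier X \<and> (\<forall>x\<in>U. \<forall>y\<in>carrier X. x \<sqsubseteq>\<^bsub>X\<^esub> y \<longrightarrow> y \<in> U)"

definition clopen_upset :: "'a priestley \<Rightarrow> 'a set \<Rightarrow> bool" where
  "clopen_upset X U \<longleftrightarrow> openin (topol X) U \<and> closedin (topol X) U \<and> upset X U"

definition priestley_space :: "'a priestley \<Rightarrow> bool" where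
  "priestley_space X \<longleftrightarrow> topspace (topol X) = carrier X \<and> compact_space (topol X) \<and>
     partial_order X \<and>
     (\<forall>x\<in>carrier X. \<forall>y\<in>carrier X. \<not> x \<sqsubseteq>\<^bsub>X\<^esub> y \<longrightarrow> (\<exists>U. clopen_upset X U \<and> x \<in> U \<and> y \<notin> U))"

definition maximal_points :: "'a priestley \<Rightarrow> 'a set \<Rightarrow> 'a set" where
  "maximal_points X S = {x \<in> S. \<forall>y\<in>S. x \<sqsubseteq>\<^bsub>X\<^esub> y \<longrightarrow> y = x}"

definition admissible_clopens :: "'a priestley \<Rightarrow> 'a set set" where
  "admissible_clopens X =
     {U. clopen_upset X U \<and> maximal_points X (carrier X - U) \<subseteq> dense_part X}"

definition avoiding :: "'a priestley \<Rightarrow> 'a \<Rightarrow> 'a set set" where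
  "avoiding X x = {U \<in> admissible_clopens X. x \<notin> U}"

definition pointed_generalized_priestley_space :: "'a priestley \<Rightarrow> bool" where
  "pointed_generalized_priestley_space X \<longleftrightarrow>
     priestley_space X \<and>
     greatest X (max_point X) (carrier X) \<and>
     dense_part X \<subseteq> carrier X - {max_point X} \<and>
     subtopology (topol X) (carrier X - {max_point X}) closure_of dense_part X
       = carrier X - {max_point X} \<and>
     (\<forall>x\<in>carrier X - {max_point X}. \<exists>y\<in>dense_part X. x \<sqsubseteq>\<^bsub>X\<^esub> y) \<and>
     (\<forall>x\<in>carrier X. x \<in> dense_part X \<longleftrightarrow>
        avoiding X x \<noteq> {} \<and>
        (\<forall>U\<in>avoiding X x. \<forall>V\<in>avoiding X x. \<exists>W\<in>avoiding X x. U \<subseteq> W \<and> V \<subseteq> W)) \<and>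
     (\<forall>x\<in>carrier X. \<forall>y\<in>carrier X.
        x \<sqsubseteq>\<^bsub>X\<^esub> y \<longleftrightarrow> (\<forall>U\<in>admissible_clopens X. x \<in> U \<longrightarrow> y \<in> U))"

definition box :: "'a priestley \<Rightarrow> ('a \<times> 'b) set \<Rightarrow> 'b set \<Rightarrow> 'a set" where
  "box X R U = {x \<in> carrier X. R `` {x} \<subseteq> U}"

definition priestley_morphisms :: "'a priestley \<Rightarrow> 'b priestley \<Rightarrow> ('a \<times> 'b) set set" where
  "priestley_morphisms X Y = {R. R \<subseteq> carrier X \<times> carrier Y \<and>
     (\<forall>x\<in>carrier X. \<forall>y\<in>carrier Y. (x, y) \<notin> R \<longrightarrow>
        (\<exists>U\<in>admissible_clopens Y. R `` {x} \<subseteq> U \<and> y \<notin> U)) \<and>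
     (\<forall>U\<in>admissible_clopens Y. box X R U \<in> admissible_clopens X)}"

definition priestley_comp ::
  "'a priestley \<Rightarrow> 'b priestley \<Rightarrow> 'c priestley \<Rightarrow> ('b \<times> 'c) set \<Rightarrow> ('a \<times> 'b) set \<Rightarrow> ('a \<times> 'c) set"
  where
  "priestley_comp X Y Z S R = {(x, z) \<in> carrier X \<times> carrier Z.
     \<forall>U\<in>admissible_clopens Z. x \<in> box X R (box Y S U) \<longrightarrow> z \<in> U}"

definition PGPS :: "('a priestley, ('a \<times> 'a) set) category" where
  "PGPS = \<lparr>Obj = {X. pointed_generalized_priestley_space X},
           Hom = priestley_morphisms,
           Ident = (\<lambda>X. {(x, y) \<in> carrier X \<times> carrier X. x \<sqsubseteq>\<^bsub>X\<^esub> y}),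
           Comp = priestley_comp\<rparr>"


section \<open>The functors \<open>\<A>\<close> and \<open>\<X>\<close>\<close>

definition admissible_clopen_order :: "'a priestley \<Rightarrow> 'a set gorder" where
  "admissible_clopen_order X = \<lparr>carrier = admissible_clopens X, eq = (=), le = (\<subseteq>)\<rparr>"

definition functor_A ::
  "('a priestley, ('a \<times> 'a) set, 'a set gorder, 'a set \<Rightarrow> 'a set) functor_data" where
  "functor_A = \<lparr>OMap = admissible_clopen_order,
                AMap = (\<lambda>X Y R. restrict (box X R) (admissible_clopens Y))\<rparr>"

definition prime_filters :: "'a gorder \<Rightarrow> 'a set set" where
  "prime_filters M = {P \<in> filters M. P \<noteq> carrier M \<and>
     (\<forall>F\<in>filters M. \<forall>G\<in>filters M. F \<inter> G \<subseteq> P \<longrightarrow> F \<subseteq> P \<or> G \<subseteq> P)}"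

definition prime_hat :: "'a gorder \<Rightarrow> 'a \<Rightarrow> 'a set set" where
  "prime_hat M a = {P \<in> prime_filters M. a \<in> P}"

inductive_set envelope_sets :: "'a gorder \<Rightarrow> 'a set set set" for M :: "'a gorder" where
  hat: "a \<in> carrier M \<Longrightarrow> prime_hat M a \<in> envelope_sets M"
| union: "U \<in> envelope_sets M \<Longrightarrow> V \<in> envelope_sets M \<Longrightarrow> U \<union> V \<in> envelope_sets M"
| inter: "U \<in> envelope_sets M \<Longrightarrow> V \<in> envelope_sets M \<Longrightarrow> U \<inter> V \<in> envelope_sets M"

definition distributive_envelope :: "'a gorder \<Rightarrow> 'a set set gorder" where
  "distributive_envelope M = \<lparr>carrier = envelope_sets M, eq = (=), le = (\<subseteq>)\<rparr>"

text \<open>The set below is \<open>P \<inter> M\<close>, with \<open>M\<close> identified with its image in the envelope.\<close>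

definition optimal_filters :: "'a gorder \<Rightarrow> 'a set set" where
  "optimal_filters M =
     {{a \<in> carrier M. prime_hat M a \<in> P} | P. P \<in> prime_filters (distributive_envelope M)}"

definition dual_points :: "'a gorder \<Rightarrow> 'a set set" where
  "dual_points M = optimal_filters M \<union> {carrier M}"

definition dual_basic :: "'a gorder \<Rightarrow> 'a \<Rightarrow> 'a set set" where
  "dual_basic M a = {x \<in> dual_points M. a \<in> x}"

definition dual_space :: "'a gorder \<Rightarrow> 'a set priestley" where
  "dual_space M = \<lparr>carrier = dual_points M, eq = (=), le = (\<subseteq>),
     topol = topology_generated_by
       (dual_basic M ` carrier M \<union> (\<lambda>a. dual_points M - dual_basic M a) ` carrier M),
     dense_part = prime_filters M, max_point = carrier M\<rparr>"

definition dual_relation ::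
  "'a gorder \<Rightarrow> 'b gorder \<Rightarrow> ('a \<Rightarrow> 'b) \<Rightarrow> ('b set \<times> 'a set) set" where
  "dual_relation M N \<alpha> =
     {(x, y) \<in> dual_points N \<times> dual_points M. {a \<in> carrier M. \<alpha> a \<in> x} \<subseteq> y}"

definition functor_X ::
  "('a gorder, 'a \<Rightarrow> 'a, 'a set priestley, ('a set \<times> 'a set) set) functor_data" where
  "functor_X = \<lparr>OMap = dual_space, AMap = dual_relation\<rparr>"


section \<open>The functors \<open>\<V>\<^sup>a\<close> and \<open>\<Y>\<close>\<close>

definition admissible_closed_upsets :: "'a priestley \<Rightarrow> 'a set set" where
  "admissible_closed_upsets X = {C. closedin (topol X) C \<and> upset X C \<and>
     carrier X - C = {x \<in> carrier X. \<exists>y\<in>dense_part X - C. x \<sqsubseteq>\<^bsub>X\<^esub> y}}"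

definition closed_upset_frame :: "'a priestley \<Rightarrow> 'a set gorder" where
  "closed_upset_frame X = \<lparr>carrier = admissible_closed_upsets X, eq = (=), le = (\<supseteq>)\<rparr>"

definition functor_Va ::
  "('a priestley, ('a \<times> 'a) set, 'a set gorder, 'a set \<Rightarrow> 'a set) functor_data" where
  "functor_Va = \<lparr>OMap = closed_upset_frame,
                 AMap = (\<lambda>X Y R. restrict (box X R) (admissible_closed_upsets Y))\<rparr>"

definition prime_elements :: "'a gorder \<Rightarrow> 'a set" where
  "prime_elements L = {p \<in> carrier L. p \<noteq> \<top>\<^bsub>L\<^esub> \<and>
     (\<forall>a\<in>carrier L. \<forall>b\<in>carrier L. a \<sqinter>\<^bsub>L\<^esub> b \<sqsubseteq>\<^bsub>L\<^esub> p \<longrightarrow> a \<sqsubseteq>\<^bsub>L\<^esub> p \<or> b \<sqsubseteq>\<^bsub>L\<^esub> p)}"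

definition pseudoprime_elements :: "'a gorder \<Rightarrow> 'a set" where
  "pseudoprime_elements L = {p \<in> carrier L. p \<noteq> \<top>\<^bsub>L\<^esub> \<and>
     (\<forall>A. finite A \<and> A \<noteq> {} \<and> A \<subseteq> carrier L \<and> way_below L (\<Sqinter>\<^bsub>L\<^esub>A) p \<longrightarrow>
        (\<exists>a\<in>A. a \<sqsubseteq>\<^bsub>L\<^esub> p))}"

definition pp_points :: "'a gorder \<Rightarrow> 'a set" where
  "pp_points L = pseudoprime_elements L \<union> {\<top>\<^bsub>L\<^esub>}"

definition up :: "'a gorder \<Rightarrow> 'a \<Rightarrow> 'a set" where
  "up L k = {x \<in> carrier L. k \<sqsubseteq>\<^bsub>L\<^esub> x}"

definition lambda_topology :: "'a gorder \<Rightarrow> 'a topology" where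
  "lambda_topology L = topology_generated_by
     (up L ` compact_elements L \<union> (\<lambda>l. carrier L - up L l) ` compact_elements L)"

definition pp_space :: "'a gorder \<Rightarrow> 'a priestley" where
  "pp_space L = \<lparr>carrier = pp_points L, eq = (=), le = le L,
     topol = subtopology (lambda_topology L) (pp_points L),
     dense_part = prime_elements L, max_point = \<top>\<^bsub>L\<^esub>\<rparr>"

definition right_adjoint :: "'a gorder \<Rightarrow> 'b gorder \<Rightarrow> ('a \<Rightarrow> 'b) \<Rightarrow> 'b \<Rightarrow> 'a" where
  "right_adjoint L M \<alpha> = (THE r. r \<in> carrier M \<rightarrow>\<^sub>E carrier L \<and>
     galois_connection \<lparr>orderA = L, orderB = M, lower = \<alpha>, upper = r\<rparr>)"

definition pp_relation :: "'a gorder \<Rightarrow> 'b gorder \<Rightarrow> ('a \<Rightarrow> 'b) \<Rightarrow> ('b \<times> 'a) set" where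
  "pp_relation L M \<alpha> =
     {(p, q) \<in> pp_points M \<times> pp_points L. right_adjoint L M \<alpha> p \<sqsubseteq>\<^bsub>L\<^esub> q}"

definition functor_Y :: "('a gorder, 'a \<Rightarrow> 'a, 'a priestley, ('a \<times> 'a) set) functor_data" where
  "functor_Y = \<lparr>OMap = pp_space, AMap = pp_relation\<rparr>"

end

theory Submission
  imports Defs
begin

text \<open>The frame of filters of a distributive meet-semilattice \<open>M\<close> has the principal filters as its
  compact elements, so \<open>M\<close> can be read off from it, and order-theoretic notions for filters of \<open>M\<close> become
  notions for elements of an algebraic frame. On the side of spaces, the admissible clopen upsets are
  the compact elements of the frame of admissible closed upsets. These two observations are the reason
  why both functors of the duality factor through algebraic frames.

  For \<open>\<A> = \<K> \<circ> \<V>\<^sup>a\<close> the key is a separation property (\<open>admissible_separation\<close>): a point \<open>x\<close> of the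
  dense part that lies above no point of a closed set \<open>C\<close> can be separated from \<open>C\<close> by an admissible
  clopen upset, because the admissible clopen upsets avoiding \<open>x\<close> are directed and \<open>C\<close> is compact. It
  follows that admissible closed upsets are exactly the intersections of admissible clopen ones, that
  they are determined by their points in the dense part, and that on the dense part the frame
  operations are unions and intersections; this gives the frame law, and compactness of the space
  identifies the compact elements (\<open>compact_closed_upsets\<close>).

  For \<open>\<X> = \<Y> \<circ> \<F>\<close> one shows that \<open>\<Y>(L)\<close> is a pointed generalized Priestley space for every algebraic
  frame \<open>L\<close>, and transfers this to \<open>\<X>(M)\<close> along the equality. Everything rests on the existence of
  primes (\<open>prime_above\<close>). Pseudoprimality amounts to clopen conditions on compact elements
  (\<open>pp_points_iff\<close>), so \<open>\<Y>(L)\<close> is closed in the compact space \<open>L\<close>; its admissible clopen upsets are the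
  traces of the sets \<open>up L k\<close> with \<open>k\<close> compact (\<open>admissible_is_pp_up\<close>), and the remaining axioms follow
  from this description. A morphism of spaces is determined by its boxes of admissible clopen upsets,
  and for \<open>\<Y>(\<alpha>)\<close> these are given by \<open>\<alpha>\<close> itself (\<open>box_pp_up\<close>), so functoriality reduces to that of maps
  of frames.

  The equality \<open>\<X> = \<Y> \<circ> \<F>\<close> on objects says that the optimal filters of \<open>M\<close> are the pseudoprime elements
  of \<open>\<F>(M)\<close>. A finite meet of principal filters is contained in the principal filter of \<open>b\<close> if and only
  if, in the distributive envelope, \<open>b\<close> is covered by the corresponding generators
  (\<open>meet_principal_subset_iff\<close>); so a filter is pseudoprime if and only if the filter it generates in
  the envelope is disjoint from the ideal generated by its complement, and these two are then separated
  by a prime filter of the envelope. On morphisms the equality holds because the right adjoint of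
  \<open>\<F>(\<alpha>)\<close> takes preimages under \<open>\<alpha>\<close>. Functoriality of \<open>\<X>\<close> and \<open>\<A>\<close> is inherited from the composites.\<close>

section \<open>Categories of structured maps and composition of functors\<close>

text \<open>Both concrete categories are instances. The unit laws hold as equations between functions because
  the maps are extensional.\<close>

lemma is_category_extensional_maps:
  fixes H :: "'a gorder \<Rightarrow> 'a gorder \<Rightarrow> ('a \<Rightarrow> 'a) set"
  assumes maps: "\<And>A B. A \<in> Obs \<Longrightarrow> B \<in> Obs \<Longrightarrow> H A B \<subseteq> carrier A \<rightarrow>\<^sub>E carrier B"
    and ident: "\<And>A. A \<in> Obs \<Longrightarrow> restrict (\<lambda>x. x) (carrier A) \<in> H A A"
    and comp: "\<And>A B D f g. A \<in> Obs \<Longrightarrow> B \<in> Obs \<Longrightarrow> D \<in> Obs \<Longrightarrow> f \<in> H A B \<Longrightarrow> g \<in> H B D \<Longrightarrow>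
      compose (carrier A) g f \<in> H A D"
  shows "is_category \<lparr>Obj = Obs, Hom = H, Ident = (\<lambda>A. restrict (\<lambda>x. x) (carrier A)),
    Comp = (\<lambda>A B D g f. compose (carrier A) g f)\<rparr>"
  unfolding is_category_def
proof (simp, intro conjI ballI)
  show "restrict (\<lambda>x. x) (carrier A) \<in> H A A" if "A \<in> Obs" for A
    using ident that .
  show "compose (carrier A) g f \<in> H A D"
    if "A \<in> Obs" "B \<in> Obs" "D \<in> Obs" "f \<in> H A B" "g \<in> H B D" for A B D f g
    using comp that .
  show "compose (carrier A) f (restrict (\<lambda>x. x) (carrier A)) = f"
    if "A \<in> Obs" "B \<in> Obs" "f \<in> H A B" for A B f
  proof -
    have "f \<in> carrier A \<rightarrow>\<^sub>E carrier B" using maps that by blast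
    then show ?thesis by (force simp: compose_def restrict_def PiE_def extensional_def)
  qed
  show "compose (carrier A) (restrict (\<lambda>x. x) (carrier B)) f = f"
    if "A \<in> Obs" "B \<in> Obs" "f \<in> H A B" for A B f
  proof -
    have "f \<in> carrier A \<rightarrow>\<^sub>E carrier B" using maps that by blast
    then show ?thesis by (force simp: compose_def restrict_def PiE_def extensional_def)
  qed
  show "compose (carrier A) (compose (carrier B) h g) f =
      compose (carrier A) h (compose (carrier A) g f)"
    if "A \<in> Obs" "B \<in> Obs" "D \<in> Obs" "E \<in> Obs" "f \<in> H A B" "g \<in> H B D" "h \<in> H D E" for A B D E f g h
  proof -
    have "f x \<in> carrier B" if "x \<in> carrier A" for x
      using maps[of A B] \<open>A \<in> Obs\<close> \<open>B \<in> Obs\<close> \<open>f \<in> H A B\<close> that by auto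
    then show ?thesis by (auto simp: compose_def restrict_def)
  qed
qed

lemma covariant_then_contravariant:
  assumes F: "covariant_functor C D F" and G: "contravariant_functor D E G"
  shows "contravariant_functor C E (after_covariant G F)"
  using assms
  unfolding covariant_functor_def contravariant_functor_def after_covariant_def by simp

lemma contravariant_then_covariant:
  assumes F: "contravariant_functor C D F" and G: "covariant_functor D E G"
  shows "contravariant_functor C E (after_contravariant G F)"
  using assms
  unfolding covariant_functor_def contravariant_functor_def after_contravariant_def by simp

text \<open>Equality of functors constrains their values on objects and morphisms of the domain category only.
  Functoriality transfers because that category is closed under identities and composition.\<close>

lemma contravariant_functor_cong:
  assumes eq: "functors_equal C F G" and G: "contravariant_functor C D G"
  shows "contravariant_functor C D F"
proof -
  have C: "is_category C" using G by (simp add: contravariant_functor_def)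
  have id: "Ident C A \<in> Hom C A A" if "A \<in> Obj C" for A
    using C that unfolding is_category_def by blast
  have comp: "Comp C A B E g f \<in> Hom C A E"
    if "A \<in> Obj C" "B \<in> Obj C" "E \<in> Obj C" "f \<in> Hom C A B" "g \<in> Hom C B E" for A B E f g
    using C that unfolding is_category_def by blast
  have Obs: "OMap F A = OMap G A" if "A \<in> Obj C" for A
    using eq that unfolding functors_equal_def by blast
  have M: "AMap F A B f = AMap G A B f" if "A \<in> Obj C" "B \<in> Obj C" "f \<in> Hom C A B" for A B f
    using eq that unfolding functors_equal_def by blast
  show ?thesis
    using G id comp Obs M unfolding contravariant_functor_def by simp
qed

section \<open>Order-theoretic preliminaries\<close>

(* As introduction rules, these facts apply to every goal of the form x \<sqsubseteq> y or x = y and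
   send the classical reasoner into a loop. *)
declare (in weak_partial_order) le_cong_l [rule del] le_cong_r [rule del]
declare (in partial_order) le_antisym [rule del]

lemma (in partial_order) sup_eqI: "least L x (Upper L A) \<Longrightarrow> \<Squnion>A = x"
  unfolding sup_def by (rule some_equality) (auto intro: least_unique)

lemma (in partial_order) inf_eqI: "greatest L x (Lower L A) \<Longrightarrow> \<Sqinter>A = x"
  unfolding inf_def by (rule some_equality) (auto intro: greatest_unique)

lemma (in partial_order) top_eqI: "greatest L x (carrier L) \<Longrightarrow> \<top> = x"
  unfolding top_def by (rule some_equality) (auto intro: greatest_unique)

lemma partial_order_subset: "partial_order \<lparr>carrier = A, eq = (=), le = (\<subseteq>)\<rparr>"
  by unfold_locales auto

lemma partial_order_supset: "partial_order \<lparr>carrier = A, eq = (=), le = (\<supseteq>)\<rparr>"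
  by unfold_locales auto

text \<open>The action of a filter functor on morphisms is left adjoint to taking preimages of filters, and
  preservation of joins is deduced from this.\<close>

lemma lower_preserves_sup:
  assumes A: "complete_lattice A" and B: "complete_lattice B"
    and gc: "galois_connection \<lparr>orderA = A, orderB = B, lower = f, upper = g\<rparr>"
    and S: "S \<subseteq> carrier A"
  shows "f (\<Squnion>\<^bsub>A\<^esub>S) = \<Squnion>\<^bsub>B\<^esub>(f ` S)"
proof -
  interpret A: complete_lattice A by (rule A)
  interpret B: complete_lattice B by (rule B)
  interpret G: galois_connection "\<lparr>orderA = A, orderB = B, lower = f, upper = g\<rparr>" by (rule gc)
  have fc: "f x \<in> carrier B" if "x \<in> carrier A" for x using G.lower_closed that by simp
  have gc: "g x \<in> carrier A" if "x \<in> carrier B" for x using G.upper_closed that by simp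
  have adj: "f x \<sqsubseteq>\<^bsub>B\<^esub> y \<longleftrightarrow> x \<sqsubseteq>\<^bsub>A\<^esub> g y" if "x \<in> carrier A" "y \<in> carrier B" for x y
    using G.galois_property that by simp
  have sc: "\<Squnion>\<^bsub>A\<^esub>S \<in> carrier A" using S by simp
  have "least B (f (\<Squnion>\<^bsub>A\<^esub>S)) (Upper B (f ` S))"
  proof (rule least_UpperI)
    show "f ` S \<subseteq> carrier B" "f (\<Squnion>\<^bsub>A\<^esub>S) \<in> carrier B" using S fc sc by auto
    show "x \<sqsubseteq>\<^bsub>B\<^esub> f (\<Squnion>\<^bsub>A\<^esub>S)" if "x \<in> f ` S" for x
    proof -
      obtain s where s: "s \<in> S" "x = f s" using \<open>x \<in> f ` S\<close> by blast
      have "s \<sqsubseteq>\<^bsub>A\<^esub> g (f (\<Squnion>\<^bsub>A\<^esub>S))"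
      proof (rule A.le_trans)
        show "s \<sqsubseteq>\<^bsub>A\<^esub> \<Squnion>\<^bsub>A\<^esub>S" using A.sup_upper[OF S s(1)] .
        show "\<Squnion>\<^bsub>A\<^esub>S \<sqsubseteq>\<^bsub>A\<^esub> g (f (\<Squnion>\<^bsub>A\<^esub>S))"
          using adj[OF sc fc[OF sc]] B.le_refl[OF fc[OF sc]] by simp
      qed (use S s sc gc fc in auto)
      then show ?thesis using adj[of s "f (\<Squnion>\<^bsub>A\<^esub>S)"] S s sc fc by auto
    qed
    show "f (\<Squnion>\<^bsub>A\<^esub>S) \<sqsubseteq>\<^bsub>B\<^esub> y" if y: "y \<in> Upper B (f ` S)" for y
    proof -
      have yc: "y \<in> carrier B" using y by (simp add: Upper_def)
      have "s \<sqsubseteq>\<^bsub>A\<^esub> g y" if "s \<in> S" for s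
      proof -
        have "f s \<sqsubseteq>\<^bsub>B\<^esub> y" using y that S fc by (auto simp: Upper_def)
        then show ?thesis using adj[of s y] that S yc by auto
      qed
      then have "\<Squnion>\<^bsub>A\<^esub>S \<sqsubseteq>\<^bsub>A\<^esub> g y" using A.sup_least[OF S gc[OF yc]] by simp
      then show ?thesis using adj[OF sc yc] by simp
    qed
  qed
  then show ?thesis using B.sup_eqI by simp
qed

text \<open>Only nonempty chains need bounds in \<open>A\<close>, since \<open>a\<close> bounds the empty one in the set of members of
  \<open>A\<close> above \<open>a\<close>, to which Zorn's lemma is applied.\<close>

lemma (in partial_order) maximal_above:
  assumes A: "A \<subseteq> carrier L" and a: "a \<in> A"
    and ub: "\<And>C. C \<subseteq> A \<Longrightarrow> C \<noteq> {} \<Longrightarrow> (\<And>x y. x \<in> C \<Longrightarrow> y \<in> C \<Longrightarrow> x \<sqsubseteq> y \<or> y \<sqsubseteq> x) \<Longrightarrow>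
      \<exists>u\<in>A. \<forall>x\<in>C. x \<sqsubseteq> u"
  shows "\<exists>m\<in>A. a \<sqsubseteq> m \<and> (\<forall>x\<in>A. m \<sqsubseteq> x \<longrightarrow> x = m)"
proof -
  let ?B = "{x \<in> A. a \<sqsubseteq> x}"
  have tr: "x \<sqsubseteq> z" if "x \<in> A" "y \<in> A" "z \<in> A" "x \<sqsubseteq> y" "y \<sqsubseteq> z" for x y z
    using le_trans[OF that(4,5)] that A by auto
  have as: "x = y" if "x \<in> A" "y \<in> A" "x \<sqsubseteq> y" "y \<sqsubseteq> x" for x y
    using le_antisym[OF that(3,4)] that A by auto
  have rf: "x \<sqsubseteq> x" if "x \<in> A" for x using that A by auto
  have "\<exists>m\<in>?B. \<forall>x\<in>?B. m \<sqsubseteq> x \<longrightarrow> x = m"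
  proof (rule predicate_Zorn)
    show "partial_order_on ?B (relation_of (\<sqsubseteq>) ?B)"
    proof (rule partial_order_on_relation_ofI)
      show "x \<sqsubseteq> x" if "x \<in> ?B" for x using rf that by simp
      show "x \<sqsubseteq> z" if "x \<in> ?B" "y \<in> ?B" "z \<in> ?B" "x \<sqsubseteq> y" "y \<sqsubseteq> z" for x y z
        using tr[of x y z] that by simp
      show "x = y" if "x \<in> ?B" "y \<in> ?B" "x \<sqsubseteq> y" "y \<sqsubseteq> x" for x y using as[of x y] that by simp
    qed
    fix C assume C: "C \<in> Chains (relation_of (\<sqsubseteq>) ?B)"
    then have sub: "C \<subseteq> ?B" unfolding Chains_def relation_of_def by blast
    show "\<exists>u\<in>?B. \<forall>x\<in>C. x \<sqsubseteq> u"
    proof (cases "C = {}")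
      case True
      then show ?thesis using a rf by blast
    next
      case False
      have "x \<sqsubseteq> y \<or> y \<sqsubseteq> x" if "x \<in> C" "y \<in> C" for x y
        using C that unfolding Chains_def relation_of_def by blast
      then obtain u where u: "u \<in> A" "\<forall>x\<in>C. x \<sqsubseteq> u"
        using ub[of C] sub False by blast
      then show ?thesis using False sub tr[OF a] by blast
    qed
  qed
  then show ?thesis using tr[OF a] by blast
qed

section \<open>Distributive meet-semilattices and their filters\<close>

locale dms = lower_semilattice M + weak_partial_order_top M for M :: "'a gorder" (structure) +
  assumes distributive: "\<lbrakk>a \<in> carrier M; b \<in> carrier M; c \<in> carrier M; a \<sqinter> b \<sqsubseteq> c\<rbrakk> \<Longrightarrow>
    \<exists>a'\<in>carrier M. \<exists>b'\<in>carrier M. a \<sqsubseteq> a' \<and> b \<sqsubseteq> b' \<and> a' \<sqinter> b' = c"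
begin

lemma finite_meet: "finite A \<Longrightarrow> A \<subseteq> carrier M \<Longrightarrow> greatest M (\<Sqinter>A) (Lower M A)"
proof (cases "A = {}")
  case True
  have "greatest M \<top> (Lower M {})" using top_greatest by simp
  then show ?thesis using True inf_eqI by metis
qed (rule finite_inf_greatest)

lemma finite_meet_closed: "finite A \<Longrightarrow> A \<subseteq> carrier M \<Longrightarrow> \<Sqinter>A \<in> carrier M"
  using finite_meet greatest_closed by blast

lemma finite_meet_lower: "finite A \<Longrightarrow> A \<subseteq> carrier M \<Longrightarrow> a \<in> A \<Longrightarrow> \<Sqinter>A \<sqsubseteq> a"
  using finite_meet greatest_Lower_below by meson

lemma finite_meet_greatest:
  "finite A \<Longrightarrow> A \<subseteq> carrier M \<Longrightarrow> x \<in> carrier M \<Longrightarrow> (\<And>a. a \<in> A \<Longrightarrow> x \<sqsubseteq> a) \<Longrightarrow> x \<sqsubseteq> \<Sqinter>A"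
  using finite_meet greatest_le[of M "\<Sqinter>A" "Lower M A"] Lower_memI by metis

lemma empty_meet: "\<Sqinter>{} = \<top>"
  using inf_eqI top_greatest by simp

lemma insert_meet:
  assumes "finite A" "A \<subseteq> carrier M" "a \<in> carrier M"
  shows "\<Sqinter>(insert a A) = a \<sqinter> \<Sqinter>A"
proof (rule le_antisym)
  have c: "\<Sqinter>A \<in> carrier M" "\<Sqinter>(insert a A) \<in> carrier M" using assms finite_meet_closed by auto
  show "\<Sqinter>(insert a A) \<sqsubseteq> a \<sqinter> \<Sqinter>A"
  proof (rule meet_le)
    show "\<Sqinter>(insert a A) \<sqsubseteq> a" by (rule finite_meet_lower) (use assms in auto)
    show "\<Sqinter>(insert a A) \<sqsubseteq> \<Sqinter>A"
    proof (rule finite_meet_greatest)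
      show "\<Sqinter>(insert a A) \<sqsubseteq> x" if "x \<in> A" for x
        by (rule finite_meet_lower) (use assms that in auto)
    qed (use assms c in auto)
  qed (use assms c in auto)
  have m: "a \<sqinter> \<Sqinter>A \<in> carrier M" using assms c by simp
  show "a \<sqinter> \<Sqinter>A \<sqsubseteq> \<Sqinter>(insert a A)"
  proof (rule finite_meet_greatest)
    fix x assume x: "x \<in> insert a A"
    show "a \<sqinter> \<Sqinter>A \<sqsubseteq> x"
    proof (cases "x = a")
      case False
      then have "\<Sqinter>A \<sqsubseteq> x" using x assms finite_meet_lower by blast
      then show ?thesis using x by (intro le_trans[OF meet_right]) (use assms c m in auto)
    qed (use assms c meet_left in auto)
  qed (use assms m in auto)
  show "\<Sqinter>(insert a A) \<in> carrier M" "a \<sqinter> \<Sqinter>A \<in> carrier M" using c m by auto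
qed

lemma le_eq_meet: "x \<in> carrier M \<Longrightarrow> y \<in> carrier M \<Longrightarrow> x \<sqsubseteq> y \<Longrightarrow> \<Sqinter>{x, y} = x"
  by (rule inf_eqI) (auto intro: greatest_LowerI)

end

lemma dms_iff: "distributive_meet_semilattice M \<longleftrightarrow> dms M"
proof
  assume D: "distributive_meet_semilattice M"
  then have po: "partial_order M"
    and inf: "\<And>A. finite A \<Longrightarrow> A \<subseteq> carrier M \<Longrightarrow> \<exists>i. greatest M i (Lower M A)"
    by (auto simp: distributive_meet_semilattice_def meet_semilattice_def)
  interpret partial_order M by (rule po)
  show "dms M"
  proof unfold_locales
    show "\<exists>s. greatest M s (Lower M {x, y})" if "x \<in> carrier M" "y \<in> carrier M" for x y
      using inf[of "{x, y}"] that by simp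
    show "\<exists>x. greatest M x (carrier M)" using inf[of "{}"] by simp
  qed (use D in \<open>auto simp: distributive_meet_semilattice_def\<close>)
next
  assume "dms M"
  then interpret dms M .
  show "distributive_meet_semilattice M"
    unfolding distributive_meet_semilattice_def meet_semilattice_def
    using partial_order_axioms finite_meet distributive by metis
qed

lemma DMS_is_category: "is_category DMS"
  unfolding DMS_def
proof (rule is_category_extensional_maps)
  fix A :: "'a gorder" assume "A \<in> {M. distributive_meet_semilattice M}"
  then interpret dms A by (simp add: dms_iff)
  show "restrict (\<lambda>x. x) (carrier A) \<in> finite_meet_hom A A"
  proof -
    have "restrict (\<lambda>x. x) (carrier A) ` B = B" if "B \<subseteq> carrier A" for B
      using that by (auto simp: image_def)
    then show ?thesis by (auto simp: finite_meet_hom_def finite_meet_closed)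
  qed
next
  fix A B D :: "'a gorder" and f g
  assume "A \<in> {M. distributive_meet_semilattice M}"
  then interpret A: dms A by (simp add: dms_iff)
  assume f: "f \<in> finite_meet_hom A B" and g: "g \<in> finite_meet_hom B D"
  have "compose (carrier A) g f (\<Sqinter>\<^bsub>A\<^esub>S) = \<Sqinter>\<^bsub>D\<^esub>(compose (carrier A) g f ` S)"
    if S: "finite S" "S \<subseteq> carrier A" for S
  proof -
    have "f ` S \<subseteq> carrier B" "finite (f ` S)" using S f by (auto simp: finite_meet_hom_def)
    moreover have "compose (carrier A) g f ` S = g ` (f ` S)"
      using S by (auto simp: compose_def image_def)
    ultimately show ?thesis
      using S f g by (simp add: finite_meet_hom_def compose_def A.finite_meet_closed)
  qed
  then show "compose (carrier A) g f \<in> finite_meet_hom A D"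
    using f g by (auto simp: finite_meet_hom_def compose_def PiE_def Pi_def)
qed (auto simp: finite_meet_hom_def)

context dms begin

abbreviation frame_of_filters (\<open>\<FF>\<close>) where
  "\<FF> \<equiv> filter_frame M"

abbreviation envelope (\<open>\<DD>\<close>) where
  "\<DD> \<equiv> distributive_envelope M"

lemma filter_closed: "F \<in> filters M \<Longrightarrow> F \<subseteq> carrier M"
  by (simp add: filters_def)

lemma filter_up: "F \<in> filters M \<Longrightarrow> x \<in> F \<Longrightarrow> y \<in> carrier M \<Longrightarrow> x \<sqsubseteq> y \<Longrightarrow> y \<in> F"
  by (simp add: filters_def)

lemma filter_meet: "F \<in> filters M \<Longrightarrow> x \<in> F \<Longrightarrow> y \<in> F \<Longrightarrow> x \<sqinter> y \<in> F"
  by (simp add: filters_def)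

lemma filter_top: "F \<in> filters M \<Longrightarrow> \<top> \<in> F"
proof -
  assume F: "F \<in> filters M"
  then obtain x where "x \<in> F" by (auto simp: filters_def)
  then show ?thesis using filter_up[OF F] filter_closed[OF F] by blast
qed

lemma filterI:
  assumes "F \<subseteq> carrier M" "\<top> \<in> F"
    and "\<And>x y. x \<in> F \<Longrightarrow> y \<in> carrier M \<Longrightarrow> x \<sqsubseteq> y \<Longrightarrow> y \<in> F"
    and "\<And>x y. x \<in> F \<Longrightarrow> y \<in> F \<Longrightarrow> x \<sqinter> y \<in> F"
  shows "F \<in> filters M"
  using assms unfolding filters_def by blast

lemma filter_finite_meet:
  assumes F: "F \<in> filters M" and "finite A" "A \<subseteq> F"
  shows "\<Sqinter>A \<in> F"
  using assms(2,3)
proof (induction A)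
  case empty
  then show ?case using empty_meet filter_top F by simp
next
  case (insert a A)
  then have "A \<subseteq> carrier M" "a \<in> carrier M" using filter_closed[OF F] by auto
  then show ?case using insert insert_meet filter_meet[OF F] by auto
qed

lemma carrier_filter: "carrier M \<in> filters M"
  by (rule filterI) auto

lemma principal_filter: "a \<in> carrier M \<Longrightarrow> up M a \<in> filters M"
  by (rule filterI) (auto simp: up_def intro: le_trans meet_le)

lemma principal_filter_subset_iff: "F \<in> filters M \<Longrightarrow> a \<in> carrier M \<Longrightarrow> up M a \<subseteq> F \<longleftrightarrow> a \<in> F"
  by (auto simp: up_def dest: filter_up)

lemma inter_filter: "F \<in> filters M \<Longrightarrow> G \<in> filters M \<Longrightarrow> F \<inter> G \<in> filters M"
  by (rule filterI) (auto simp: filter_top filter_meet dest: filter_closed filter_up)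

definition generated_filter :: "'a set \<Rightarrow> 'a set" where
  "generated_filter B = {y \<in> carrier M. \<exists>A. finite A \<and> A \<subseteq> B \<and> \<Sqinter>A \<sqsubseteq> y}"

lemma generated_filter:
  assumes B: "B \<subseteq> carrier M"
  shows "generated_filter B \<in> filters M"
proof (rule filterI)
  show "\<top> \<in> generated_filter B"
    by (auto simp: generated_filter_def empty_meet intro!: exI[of _ "{}"])
  show "y \<in> generated_filter B"
    if x: "x \<in> generated_filter B" and y: "y \<in> carrier M" "x \<sqsubseteq> y" for x y
  proof -
    obtain A where A: "finite A" "A \<subseteq> B" "\<Sqinter>A \<sqsubseteq> x" "x \<in> carrier M"
      using x by (auto simp: generated_filter_def)
    have "\<Sqinter>A \<sqsubseteq> y" using le_trans[OF A(3) y(2)] A finite_meet_closed[of A] B y by blast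
    then show ?thesis using A y by (auto simp: generated_filter_def)
  qed
  show "x \<sqinter> y \<in> generated_filter B"
    if x: "x \<in> generated_filter B" and y: "y \<in> generated_filter B" for x y
  proof -
    obtain A where A: "finite A" "A \<subseteq> B" "\<Sqinter>A \<sqsubseteq> x" "x \<in> carrier M"
      using x by (auto simp: generated_filter_def)
    obtain A' where A': "finite A'" "A' \<subseteq> B" "\<Sqinter>A' \<sqsubseteq> y" "y \<in> carrier M"
      using y by (auto simp: generated_filter_def)
    let ?m = "\<Sqinter>(A \<union> A')"
    have c: "?m \<in> carrier M" "\<Sqinter>A \<in> carrier M" "\<Sqinter>A' \<in> carrier M"
      using A A' B by (auto intro!: finite_meet_closed)
    have "?m \<sqsubseteq> \<Sqinter>A"
    proof (rule finite_meet_greatest)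
      show "?m \<sqsubseteq> a" if "a \<in> A" for a by (rule finite_meet_lower) (use A A' B that in auto)
    qed (use A A' B c in auto)
    then have 1: "?m \<sqsubseteq> x" using A c le_trans by blast
    have "?m \<sqsubseteq> \<Sqinter>A'"
    proof (rule finite_meet_greatest)
      show "?m \<sqsubseteq> a" if "a \<in> A'" for a by (rule finite_meet_lower) (use A A' B that in auto)
    qed (use A A' B c in auto)
    then have 2: "?m \<sqsubseteq> y" using A' c le_trans by blast
    have "?m \<sqsubseteq> x \<sqinter> y" using 1 2 A A' c by (intro meet_le) auto
    then show ?thesis using A A' unfolding generated_filter_def
      by (auto intro!: exI[of _ "A \<union> A'"])
  qed
qed (auto simp: generated_filter_def)

lemma generated_filter_contains: "B \<subseteq> carrier M \<Longrightarrow> B \<subseteq> generated_filter B"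
proof
  fix b assume "B \<subseteq> carrier M" "b \<in> B"
  then show "b \<in> generated_filter B"
    unfolding generated_filter_def by (auto intro!: exI[of _ "{b}"] intro: finite_meet_lower)
qed

lemma generated_filter_least: "F \<in> filters M \<Longrightarrow> B \<subseteq> F \<Longrightarrow> generated_filter B \<subseteq> F"
proof
  fix y assume F: "F \<in> filters M" "B \<subseteq> F" and "y \<in> generated_filter B"
  then obtain A where "finite A" "A \<subseteq> B" "\<Sqinter>A \<sqsubseteq> y" "y \<in> carrier M"
    by (auto simp: generated_filter_def)
  then show "y \<in> F" using filter_finite_meet[OF F(1)] filter_up[OF F(1)] F(2) by blast
qed

lemma filter_frame_simps [simp]:
  "carrier (\<FF>) = filters M" "le (\<FF>) = (\<subseteq>)" "eq (\<FF>) = (=)"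
  by (simp_all add: filter_frame_def)

lemma filter_frame_partial_order: "partial_order (\<FF>)"
  unfolding filter_frame_def by (rule partial_order_subset)

lemma Union_filters_closed: "\<S> \<subseteq> filters M \<Longrightarrow> \<Union>\<S> \<subseteq> carrier M"
  using filter_closed by blast

lemma generated_filter_is_sup:
  "\<S> \<subseteq> filters M \<Longrightarrow>
    least (\<FF>) (generated_filter (\<Union>\<S>)) (Upper (\<FF>) \<S>)"
proof (rule least_UpperI)
  assume S: "\<S> \<subseteq> filters M"
  note SC = Union_filters_closed[OF S]
  show "\<S> \<subseteq> carrier (\<FF>)" "generated_filter (\<Union>\<S>) \<in> carrier (\<FF>)"
    using S generated_filter[OF SC] by auto
  show "x \<sqsubseteq>\<^bsub>\<FF>\<^esub> generated_filter (\<Union>\<S>)" if "x \<in> \<S>" for x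
    using that generated_filter_contains[OF SC] by auto
  show "generated_filter (\<Union>\<S>) \<sqsubseteq>\<^bsub>\<FF>\<^esub> y" if "y \<in> Upper (\<FF>) \<S>" for y
    using that generated_filter_least[of y "\<Union>\<S>"] S by (auto simp: Upper_def)
qed

lemma filter_sup: "\<S> \<subseteq> filters M \<Longrightarrow> \<Squnion>\<^bsub>\<FF>\<^esub>\<S> = generated_filter (\<Union>\<S>)"
  by (rule partial_order.sup_eqI[OF filter_frame_partial_order generated_filter_is_sup])

lemma filter_frame_complete: "complete_lattice (\<FF>)"
proof (rule partial_order.complete_latticeI[OF filter_frame_partial_order])
  show "\<exists>s. least (\<FF>) s (Upper (\<FF>) \<S>)"
    if "\<S> \<subseteq> carrier (\<FF>)" for \<S>
    using generated_filter_is_sup that by auto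
  show "\<exists>i. greatest (\<FF>) i (Lower (\<FF>) \<S>)"
    if S: "\<S> \<subseteq> carrier (\<FF>)" for \<S>
  proof -
    let ?I = "carrier M \<inter> \<Inter>\<S>"
    have "?I \<in> filters M"
      using S by (intro filterI) (auto simp: filter_top filter_meet dest: filter_up)
    then have "greatest (\<FF>) ?I (Lower (\<FF>) \<S>)"
      using S by (auto simp: greatest_def Lower_def dest: filter_closed)
    then show ?thesis ..
  qed
qed

lemma filter_meet_eq:
  assumes "F \<in> filters M" "G \<in> filters M"
  shows "F \<sqinter>\<^bsub>\<FF>\<^esub> G = F \<inter> G"
  unfolding meet_def
  by (rule partial_order.inf_eqI[OF filter_frame_partial_order])
    (use assms inter_filter in \<open>auto simp: greatest_def Lower_def\<close>)

lemma filter_frame_top: "\<top>\<^bsub>\<FF>\<^esub> = carrier M"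
  by (rule partial_order.top_eqI[OF filter_frame_partial_order])
    (auto simp: greatest_def carrier_filter dest: filter_closed)

text \<open>This is where distributivity of the semilattice enters: a finite meet below \<open>y\<close> can be
  rewritten as a finite meet equal to \<open>y\<close>, whose factors then lie in every filter containing \<open>y\<close>.\<close>

lemma filter_inter_generated:
  assumes F: "F \<in> filters M" and S: "\<S> \<subseteq> filters M"
    and "finite A" "A \<subseteq> \<Union>\<S>" "y \<in> F" "\<Sqinter>A \<sqsubseteq> y"
  shows "y \<in> generated_filter (\<Union>G\<in>\<S>. F \<inter> G)"
  using assms(3-6)
proof (induction A arbitrary: y)
  case empty
  have yc: "y \<in> carrier M" using filter_closed[OF F] empty by blast
  have "y = \<top>" using empty yc by (intro le_antisym) (auto simp: empty_meet)
  have "(\<Union>G\<in>\<S>. F \<inter> G) \<subseteq> carrier M" using filter_closed[OF F] by blast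
  then show ?case using filter_top[OF generated_filter] \<open>y = \<top>\<close> by simp
next
  case (insert a A)
  let ?B = "\<Union>G\<in>\<S>. F \<inter> G"
  have Bc: "?B \<subseteq> carrier M" using filter_closed[OF F] by blast
  have c: "a \<in> carrier M" "A \<subseteq> carrier M" "y \<in> carrier M"
    using insert.prems S filter_closed F by blast+
  have "a \<sqinter> \<Sqinter>A \<sqsubseteq> y" using insert c insert_meet by simp
  then obtain a' b' where ab: "a' \<in> carrier M" "b' \<in> carrier M" "a \<sqsubseteq> a'" "\<Sqinter>A \<sqsubseteq> b'" "a' \<sqinter> b' = y"
    using distributive[OF c(1) finite_meet_closed[OF insert.hyps(1) c(2)] c(3)] by metis
  have "y \<sqsubseteq> a'" "y \<sqsubseteq> b'" using ab(5) meet_left[OF ab(1,2)] meet_right[OF ab(1,2)] by auto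
  then have F': "a' \<in> F" "b' \<in> F" using filter_up[OF F insert.prems(2)] ab by auto
  obtain G where "G \<in> \<S>" "a \<in> G" using insert.prems by blast
  then have "a' \<in> ?B" using filter_up[of G a a'] S ab F' by auto
  then have "a' \<in> generated_filter ?B" using generated_filter_contains[OF Bc] by auto
  moreover have "b' \<in> generated_filter ?B" using insert.IH[of b'] insert.prems(1) F' ab by auto
  ultimately show ?case using filter_meet[OF generated_filter[OF Bc], of a' b'] ab by simp
qed

lemma filter_frame_frame: "frame (\<FF>)"
  unfolding frame_def
proof (intro conjI ballI allI impI filter_frame_complete)
  fix F \<S> assume "F \<in> carrier (\<FF>)" "\<S> \<subseteq> carrier (\<FF>)"
  then have F: "F \<in> filters M" and S: "\<S> \<subseteq> filters M" by auto
  note SC = Union_filters_closed[OF S]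
  have im: "(\<lambda>G. F \<sqinter>\<^bsub>\<FF>\<^esub> G) ` \<S> = (\<lambda>G. F \<inter> G) ` \<S>"
    using F S filter_meet_eq by (intro image_cong) auto
  have sub: "(\<lambda>G. F \<inter> G) ` \<S> \<subseteq> filters M" using F S inter_filter by blast
  have "F \<inter> generated_filter (\<Union>\<S>) = generated_filter (\<Union>G\<in>\<S>. F \<inter> G)"
  proof
    show "F \<inter> generated_filter (\<Union>\<S>) \<subseteq> generated_filter (\<Union>G\<in>\<S>. F \<inter> G)"
      using filter_inter_generated[OF F S] by (auto simp: generated_filter_def[of "\<Union>\<S>"])
    have "(\<Union>G\<in>\<S>. F \<inter> G) \<subseteq> F \<inter> generated_filter (\<Union>\<S>)"
      using generated_filter_contains[OF SC] by auto
    then show "generated_filter (\<Union>G\<in>\<S>. F \<inter> G) \<subseteq> F \<inter> generated_filter (\<Union>\<S>)"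
      using generated_filter_least inter_filter F generated_filter[OF SC] by blast
  qed
  then show "F \<sqinter>\<^bsub>\<FF>\<^esub> (\<Squnion>\<^bsub>\<FF>\<^esub>\<S>)
      = \<Squnion>\<^bsub>\<FF>\<^esub>((\<lambda>G. F \<sqinter>\<^bsub>\<FF>\<^esub> G) ` \<S>)"
    using filter_sup S im sub filter_meet_eq[OF F generated_filter[OF SC]] by simp
qed

text \<open>Membership of \<open>a\<close> in a generated filter involves only finitely many generators.\<close>

lemma principal_filter_compact:
  assumes a: "a \<in> carrier M"
  shows "up M a \<in> compact_elements (\<FF>)"
proof -
  have "\<exists>\<T>. finite \<T> \<and> \<T> \<subseteq> \<S> \<and> up M a \<subseteq> \<Squnion>\<^bsub>\<FF>\<^esub>\<T>"
    if S: "\<S> \<subseteq> filters M" and le: "up M a \<subseteq> \<Squnion>\<^bsub>\<FF>\<^esub>\<S>" for \<S>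
  proof -
    have "a \<in> generated_filter (\<Union>\<S>)" using le a filter_sup[OF S] by (auto simp: up_def)
    then obtain A where A: "finite A" "A \<subseteq> \<Union>\<S>" "\<Sqinter>A \<sqsubseteq> a" by (auto simp: generated_filter_def)
    obtain \<T> where T: "finite \<T>" "\<T> \<subseteq> \<S>" "A \<subseteq> \<Union>\<T>"
      using finite_subset_Union[OF A(1,2)] by metis
    have "a \<in> generated_filter (\<Union>\<T>)" using A T a by (auto simp: generated_filter_def)
    then have "up M a \<subseteq> generated_filter (\<Union>\<T>)"
      using principal_filter_subset_iff a generated_filter T S Union_filters_closed by (metis subset_trans)
    then show ?thesis using T S filter_sup by (metis subset_trans)
  qed
  then show ?thesis
    unfolding compact_elements_def way_below_def using principal_filter[OF a] by auto
qed

lemma filter_sup_of_principal: "F \<in> filters M \<Longrightarrow> \<Squnion>\<^bsub>\<FF>\<^esub>(up M ` F) = F"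
proof -
  assume F: "F \<in> filters M"
  have sub: "up M ` F \<subseteq> filters M" using principal_filter filter_closed[OF F] by blast
  have "generated_filter (\<Union>(up M ` F)) \<subseteq> F"
    by (rule generated_filter_least[OF F]) (use principal_filter_subset_iff F filter_closed in blast)
  moreover have "F \<subseteq> \<Union>(up M ` F)"
  proof
    fix x assume "x \<in> F"
    then have "x \<in> up M x" using filter_closed[OF F] by (auto simp: up_def)
    then show "x \<in> \<Union>(up M ` F)" using \<open>x \<in> F\<close> by blast
  qed
  then have "F \<subseteq> generated_filter (\<Union>(up M ` F))"
    using generated_filter_contains[OF Union_filters_closed[OF sub]] by blast
  ultimately show ?thesis using filter_sup[OF sub] by simp
qed

text \<open>A compact filter is the join of finitely many of the principal filters below it, and the finite
  meet of their generators generates it.\<close>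

lemma compact_filters: "compact_elements (\<FF>) = up M ` carrier M"
proof
  show "up M ` carrier M \<subseteq> compact_elements (\<FF>)" using principal_filter_compact by blast
  show "compact_elements (\<FF>) \<subseteq> up M ` carrier M"
  proof
    fix F assume F': "F \<in> compact_elements (\<FF>)"
    then have F: "F \<in> filters M" by (simp add: compact_elements_def)
    have sub: "up M ` F \<subseteq> filters M" using principal_filter filter_closed[OF F] by blast
    have "F \<subseteq> \<Squnion>\<^bsub>\<FF>\<^esub>(up M ` F)" using filter_sup_of_principal[OF F] by simp
    then obtain \<T> where T: "finite \<T>" "\<T> \<subseteq> up M ` F" "F \<subseteq> \<Squnion>\<^bsub>\<FF>\<^esub>\<T>"
      using F' sub unfolding compact_elements_def way_below_def by auto
    obtain A where A: "finite A" "A \<subseteq> F" "\<T> = up M ` A"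
      using finite_subset_image[OF T(1,2)] by auto
    have Ac: "A \<subseteq> carrier M" using A filter_closed[OF F] by blast
    have mc: "\<Sqinter>A \<in> carrier M" using finite_meet_closed A Ac by blast
    have "\<Union>\<T> \<subseteq> up M (\<Sqinter>A)"
    proof
      fix x assume "x \<in> \<Union>\<T>"
      then obtain a where a: "a \<in> A" "a \<sqsubseteq> x" "x \<in> carrier M" using A by (auto simp: up_def)
      then have "\<Sqinter>A \<sqsubseteq> x"
        using le_trans[OF finite_meet_lower[OF A(1) Ac a(1)] a(2)] mc Ac by blast
      then show "x \<in> up M (\<Sqinter>A)" using a by (simp add: up_def)
    qed
    then have "F \<subseteq> up M (\<Sqinter>A)"
      using T filter_sup generated_filter_least[OF principal_filter[OF mc]] sub by (metis subset_trans)
    moreover have "up M (\<Sqinter>A) \<subseteq> F"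
      using principal_filter_subset_iff[OF F mc] filter_finite_meet[OF F] A by blast
    ultimately show "F \<in> up M ` carrier M" using mc by blast
  qed
qed

lemma filter_frame_algebraic: "algebraic_frame (\<FF>)"
  unfolding algebraic_frame_def
proof (intro conjI ballI filter_frame_frame)
  fix F assume "F \<in> carrier (\<FF>)"
  then have "F \<in> filters M" by simp
  then show "\<exists>S\<subseteq>compact_elements (\<FF>). F = \<Squnion>\<^bsub>\<FF>\<^esub>S"
    using filter_sup_of_principal[of F] compact_filters filter_closed[of F]
    by (intro exI[of _ "up M ` F"]) auto
qed

end

section \<open>Algebraic frames\<close>

locale alg_frame = complete_lattice L for L :: "'a gorder" (structure) +
  assumes frame_distrib: "\<lbrakk>a \<in> carrier L; S \<subseteq> carrier L\<rbrakk> \<Longrightarrow> a \<sqinter> (\<Squnion>S) = \<Squnion>((\<lambda>s. a \<sqinter> s) ` S)"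
    and algebraic: "a \<in> carrier L \<Longrightarrow> \<exists>S. S \<subseteq> compact_elements L \<and> a = \<Squnion>S"

lemma alg_frame_iff: "algebraic_frame L \<longleftrightarrow> alg_frame L"
  unfolding algebraic_frame_def frame_def alg_frame_def alg_frame_axioms_def by auto

lemma AlgFrmSup_is_category: "is_category AlgFrmSup"
  unfolding AlgFrmSup_def
proof (rule is_category_extensional_maps)
  fix A :: "'a gorder" assume "A \<in> {L. algebraic_frame L}"
  then interpret alg_frame A by (simp add: alg_frame_iff)
  show "restrict (\<lambda>x. x) (carrier A) \<in> join_compact_hom A A"
  proof -
    have "restrict (\<lambda>x. x) (carrier A) ` B = B" if "B \<subseteq> carrier A" for B
      using that by (auto simp: image_def)
    moreover have "compact_elements A \<subseteq> carrier A" by (auto simp: compact_elements_def)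
    ultimately show ?thesis by (auto simp: join_compact_hom_def)
  qed
next
  fix A B D :: "'a gorder" and f g
  assume "A \<in> {L. algebraic_frame L}"
  then interpret A: alg_frame A by (simp add: alg_frame_iff)
  assume f: "f \<in> join_compact_hom A B" and g: "g \<in> join_compact_hom B D"
  have im: "compose (carrier A) g f ` S = g ` (f ` S)" if "S \<subseteq> carrier A" for S
    using that by (auto simp: compose_def image_def)
  have "compose (carrier A) g f (\<Squnion>\<^bsub>A\<^esub>S) = \<Squnion>\<^bsub>D\<^esub>(compose (carrier A) g f ` S)"
    if S: "S \<subseteq> carrier A" for S
  proof -
    have "f ` S \<subseteq> carrier B" using S f by (auto simp: join_compact_hom_def)
    then show ?thesis
      using S f g im[OF S] by (simp add: join_compact_hom_def compose_def)
  qed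
  moreover have "compose (carrier A) g f ` compact_elements A \<subseteq> compact_elements D"
  proof -
    have "compact_elements A \<subseteq> carrier A" by (auto simp: compact_elements_def)
    then have "compose (carrier A) g f ` compact_elements A = g ` (f ` compact_elements A)"
      by (rule im)
    moreover have "f ` compact_elements A \<subseteq> compact_elements B" "g ` compact_elements B \<subseteq> compact_elements D"
      using f g by (auto simp: join_compact_hom_def)
    ultimately show ?thesis by auto
  qed
  ultimately show "compose (carrier A) g f \<in> join_compact_hom A D"
    using f g by (auto simp: join_compact_hom_def compose_def PiE_def Pi_def)
qed (auto simp: join_compact_hom_def)

section \<open>The filter functor\<close>

locale dms_hom = M: dms M + N: dms N for M :: "'a gorder" and N :: "'b gorder" +
  fixes \<alpha> :: "'a \<Rightarrow> 'b"
  assumes hom: "\<alpha> \<in> finite_meet_hom M N"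
begin

lemma closed: "x \<in> carrier M \<Longrightarrow> \<alpha> x \<in> carrier N"
  using hom by (auto simp: finite_meet_hom_def)

lemma preserves_finite_meet: "finite A \<Longrightarrow> A \<subseteq> carrier M \<Longrightarrow> \<alpha> (\<Sqinter>\<^bsub>M\<^esub>A) = \<Sqinter>\<^bsub>N\<^esub>(\<alpha> ` A)"
  using hom by (auto simp: finite_meet_hom_def)

lemma preserves_top: "\<alpha> \<top>\<^bsub>M\<^esub> = \<top>\<^bsub>N\<^esub>"
  using preserves_finite_meet[of "{}"] M.empty_meet N.empty_meet by simp

lemma preserves_meet: "x \<in> carrier M \<Longrightarrow> y \<in> carrier M \<Longrightarrow> \<alpha> (x \<sqinter>\<^bsub>M\<^esub> y) = \<alpha> x \<sqinter>\<^bsub>N\<^esub> \<alpha> y"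
  using preserves_finite_meet[of "{x, y}"] by (simp add: meet_def)

lemma monotone: "x \<in> carrier M \<Longrightarrow> y \<in> carrier M \<Longrightarrow> x \<sqsubseteq>\<^bsub>M\<^esub> y \<Longrightarrow> \<alpha> x \<sqsubseteq>\<^bsub>N\<^esub> \<alpha> y"
  using preserves_meet[of x y] M.le_eq_meet[of x y] N.meet_right[of "\<alpha> x" "\<alpha> y"] closed
  by (simp add: meet_def)

lemma filter_map_filter:
  assumes G: "G \<in> filters M"
  shows "filter_map M N \<alpha> G \<in> filters N"
proof -
  let ?F = "{y \<in> carrier N. \<exists>x\<in>G. \<alpha> x \<sqsubseteq>\<^bsub>N\<^esub> y}"
  have Gc: "G \<subseteq> carrier M" using G M.filter_closed by blast
  have "?F \<in> filters N"
  proof (rule N.filterI)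
    show "\<top>\<^bsub>N\<^esub> \<in> ?F"
      using M.filter_top[OF G] closed[OF M.top_closed] by blast
    show "y \<in> ?F"
      if x: "x \<in> ?F" and y: "y \<in> carrier N" "x \<sqsubseteq>\<^bsub>N\<^esub> y" for x y
    proof -
      obtain u where u: "u \<in> G" "\<alpha> u \<sqsubseteq>\<^bsub>N\<^esub> x" "x \<in> carrier N" using x by blast
      have "\<alpha> u \<sqsubseteq>\<^bsub>N\<^esub> y" using N.le_trans[OF u(2) y(2)] u y closed Gc by auto
      then show ?thesis using u y by blast
    qed
    show "x \<sqinter>\<^bsub>N\<^esub> y \<in> ?F"
      if xy: "x \<in> ?F" "y \<in> ?F"
      for x y
    proof -
      obtain u v where uv: "u \<in> G" "v \<in> G" "\<alpha> u \<sqsubseteq>\<^bsub>N\<^esub> x" "\<alpha> v \<sqsubseteq>\<^bsub>N\<^esub> y" using xy by blast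
      have c: "u \<in> carrier M" "v \<in> carrier M" "x \<in> carrier N" "y \<in> carrier N" using uv Gc xy by auto
      have "\<alpha> (u \<sqinter>\<^bsub>M\<^esub> v) \<sqsubseteq>\<^bsub>N\<^esub> x"
        using N.le_trans[OF N.meet_left uv(3)] preserves_meet c closed by simp
      moreover have "\<alpha> (u \<sqinter>\<^bsub>M\<^esub> v) \<sqsubseteq>\<^bsub>N\<^esub> y"
        using N.le_trans[OF N.meet_right uv(4)] preserves_meet c closed by simp
      ultimately have "\<alpha> (u \<sqinter>\<^bsub>M\<^esub> v) \<sqsubseteq>\<^bsub>N\<^esub> x \<sqinter>\<^bsub>N\<^esub> y"
        using N.meet_le c closed M.meet_closed by simp
      then show ?thesis using M.filter_meet[OF G uv(1,2)] c by auto
    qed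
  qed auto
  then show ?thesis using G by (simp add: filter_map_def)
qed

lemma preimage_filter:
  assumes H: "H \<in> filters N"
  shows "{a \<in> carrier M. \<alpha> a \<in> H} \<in> filters M"
  by (rule M.filterI)
    (use H N.filter_top N.filter_meet N.filter_up preserves_top preserves_meet monotone closed in auto)

text \<open>The right adjoint is the preimage map. The same adjunction identifies the relations assigned to
  \<open>\<alpha>\<close> by the two constructions of the dual space.\<close>

lemma filter_map_galois:
  "galois_connection \<lparr>orderA = filter_frame M, orderB = filter_frame N, lower = filter_map M N \<alpha>,
     upper = restrict (\<lambda>H. {a \<in> carrier M. \<alpha> a \<in> H}) (filters N)\<rparr>"
proof -
  have "filter_map M N \<alpha> G \<subseteq> H \<longleftrightarrow> G \<subseteq> {a \<in> carrier M. \<alpha> a \<in> H}"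
    if G: "G \<in> filters M" and H: "H \<in> filters N" for G H
  proof -
    have "filter_map M N \<alpha> G \<subseteq> H \<longleftrightarrow> (\<forall>x\<in>G. \<alpha> x \<in> H)"
    proof
      assume sub: "filter_map M N \<alpha> G \<subseteq> H"
      have "\<alpha> x \<in> filter_map M N \<alpha> G" if "x \<in> G" for x
      proof -
        have "\<alpha> x \<in> carrier N" using that closed M.filter_closed[OF G] by blast
        then have "\<alpha> x \<sqsubseteq>\<^bsub>N\<^esub> \<alpha> x" by simp
        then show ?thesis using \<open>\<alpha> x \<in> carrier N\<close> that G unfolding filter_map_def by auto
      qed
      then show "\<forall>x\<in>G. \<alpha> x \<in> H" using sub by blast
    next
      assume "\<forall>x\<in>G. \<alpha> x \<in> H"
      then show "filter_map M N \<alpha> G \<subseteq> H" using G N.filter_up[OF H] by (auto simp: filter_map_def)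
    qed
    then show ?thesis using M.filter_closed[OF G] by auto
  qed
  then show ?thesis
    using filter_map_filter preimage_filter
    by (simp add: galois_connection_def connection_def galois_connection_axioms_def
        M.filter_frame_partial_order N.filter_frame_partial_order)
qed

lemma filter_map_hom: "filter_map M N \<alpha> \<in> join_compact_hom (filter_frame M) (filter_frame N)"
proof -
  have "filter_map M N \<alpha> (\<Squnion>\<^bsub>filter_frame M\<^esub>S) = \<Squnion>\<^bsub>filter_frame N\<^esub>(filter_map M N \<alpha> ` S)"
    if "S \<subseteq> carrier (filter_frame M)" for S
    using lower_preserves_sup[OF M.filter_frame_complete N.filter_frame_complete filter_map_galois that] .
  moreover
  have "filter_map M N \<alpha> (up M a) = up N (\<alpha> a)" if a: "a \<in> carrier M" for a
  proof -
    have "(\<exists>x\<in>up M a. \<alpha> x \<sqsubseteq>\<^bsub>N\<^esub> y) \<longleftrightarrow> \<alpha> a \<sqsubseteq>\<^bsub>N\<^esub> y" if y: "y \<in> carrier N" for y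
    proof
      assume "\<exists>x\<in>up M a. \<alpha> x \<sqsubseteq>\<^bsub>N\<^esub> y"
      then obtain x where "x \<in> carrier M" "a \<sqsubseteq>\<^bsub>M\<^esub> x" "\<alpha> x \<sqsubseteq>\<^bsub>N\<^esub> y" by (auto simp: up_def)
      then show "\<alpha> a \<sqsubseteq>\<^bsub>N\<^esub> y"
        using N.le_trans[OF monotone[OF a, of x]] closed y a by simp
    qed (use a in \<open>auto simp: up_def\<close>)
    then show ?thesis using M.principal_filter[OF a] by (auto simp: filter_map_def up_def)
  qed
  then have "filter_map M N \<alpha> ` compact_elements (filter_frame M) \<subseteq> compact_elements (filter_frame N)"
    using closed by (auto simp: M.compact_filters N.compact_filters)
  moreover have "filter_map M N \<alpha> \<in> filters M \<rightarrow>\<^sub>E filters N"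
    using filter_map_filter by (auto simp: filter_map_def)
  ultimately show ?thesis by (simp add: join_compact_hom_def)
qed

end

lemma filter_functor: "covariant_functor DMS AlgFrmSup functor_F"
  unfolding covariant_functor_def
proof (intro conjI ballI DMS_is_category AlgFrmSup_is_category)
  fix M :: "'a gorder" assume "M \<in> Obj DMS"
  then interpret M: dms M by (simp add: DMS_def dms_iff)
  show "OMap functor_F M \<in> Obj AlgFrmSup"
    by (simp add: functor_F_def AlgFrmSup_def M.filter_frame_algebraic)
  have "filter_map M M (restrict (\<lambda>x. x) (carrier M)) G = G" if G: "G \<in> filters M" for G
  proof -
    have "{y \<in> carrier M. \<exists>x\<in>G. restrict (\<lambda>x. x) (carrier M) x \<sqsubseteq>\<^bsub>M\<^esub> y} = G"
    proof
      show "{y \<in> carrier M. \<exists>x\<in>G. restrict (\<lambda>x. x) (carrier M) x \<sqsubseteq>\<^bsub>M\<^esub> y} \<subseteq> G"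
        using M.filter_up[OF G] M.filter_closed[OF G] by auto
      show "G \<subseteq> {y \<in> carrier M. \<exists>x\<in>G. restrict (\<lambda>x. x) (carrier M) x \<sqsubseteq>\<^bsub>M\<^esub> y}"
        using M.filter_closed[OF G] by (auto intro!: bexI)
    qed
    then show ?thesis using G by (simp add: filter_map_def)
  qed
  then have "filter_map M M (restrict (\<lambda>x. x) (carrier M)) = restrict (\<lambda>x. x) (filters M)"
    by (intro extensionalityI[of _ "filters M"]) (auto simp: filter_map_def)
  then show "AMap functor_F M M (Ident DMS M) = Ident AlgFrmSup (OMap functor_F M)"
    by (simp add: functor_F_def DMS_def AlgFrmSup_def)
next
  fix M N :: "'a gorder" and f
  assume "M \<in> Obj DMS" "N \<in> Obj DMS" "f \<in> Hom DMS M N"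
  then interpret dms_hom M N f by (simp add: DMS_def dms_iff dms_hom_def dms_hom_axioms_def)
  show "AMap functor_F M N f \<in> Hom AlgFrmSup (OMap functor_F M) (OMap functor_F N)"
    using filter_map_hom by (simp add: functor_F_def AlgFrmSup_def)
next
  fix M N K :: "'a gorder" and f g
  assume "M \<in> Obj DMS" "N \<in> Obj DMS" "K \<in> Obj DMS" "f \<in> Hom DMS M N" "g \<in> Hom DMS N K"
  then interpret f: dms_hom M N f + g: dms_hom N K g
    by (simp_all add: DMS_def dms_iff dms_hom_def dms_hom_axioms_def)
  have "filter_map M K (compose (carrier M) g f) G = filter_map N K g (filter_map M N f G)"
    if G: "G \<in> filters M" for G
  proof -
    have Gc: "x \<in> carrier M" if "x \<in> G" for x using that f.M.filter_closed[OF G] by blast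
    have eq: "(\<exists>x\<in>G. g (f x) \<sqsubseteq>\<^bsub>K\<^esub> y) \<longleftrightarrow> (\<exists>z\<in>carrier N. (\<exists>x\<in>G. f x \<sqsubseteq>\<^bsub>N\<^esub> z) \<and> g z \<sqsubseteq>\<^bsub>K\<^esub> y)"
      if y: "y \<in> carrier K" for y
    proof
      assume "\<exists>x\<in>G. g (f x) \<sqsubseteq>\<^bsub>K\<^esub> y"
      then obtain x where x: "x \<in> G" "g (f x) \<sqsubseteq>\<^bsub>K\<^esub> y" by blast
      then show "\<exists>z\<in>carrier N. (\<exists>x\<in>G. f x \<sqsubseteq>\<^bsub>N\<^esub> z) \<and> g z \<sqsubseteq>\<^bsub>K\<^esub> y"
        using Gc[of x] f.closed[of x] by (intro bexI[of _ "f x"]) auto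
    next
      assume "\<exists>z\<in>carrier N. (\<exists>x\<in>G. f x \<sqsubseteq>\<^bsub>N\<^esub> z) \<and> g z \<sqsubseteq>\<^bsub>K\<^esub> y"
      then obtain x z where x: "x \<in> G" "z \<in> carrier N" "f x \<sqsubseteq>\<^bsub>N\<^esub> z" "g z \<sqsubseteq>\<^bsub>K\<^esub> y" by blast
      have "g (f x) \<sqsubseteq>\<^bsub>K\<^esub> y"
        using g.N.le_trans[OF g.monotone[OF _ _ x(3)] x(4)] x Gc f.closed g.closed y by simp
      then show "\<exists>x\<in>G. g (f x) \<sqsubseteq>\<^bsub>K\<^esub> y" using x by blast
    qed
    have "filter_map M K (compose (carrier M) g f) G = {y \<in> carrier K. \<exists>x\<in>G. g (f x) \<sqsubseteq>\<^bsub>K\<^esub> y}"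
      using G Gc by (auto simp: filter_map_def compose_def)
    also have "\<dots> = {y \<in> carrier K. \<exists>z\<in>carrier N. (\<exists>x\<in>G. f x \<sqsubseteq>\<^bsub>N\<^esub> z) \<and> g z \<sqsubseteq>\<^bsub>K\<^esub> y}"
      by (intro Collect_cong conj_cong refl eq)
    also have "\<dots> = filter_map N K g (filter_map M N f G)"
      using G f.filter_map_filter[OF G] by (auto simp: filter_map_def)
    finally show ?thesis .
  qed
  moreover have "filter_map M K (compose (carrier M) g f) \<in> extensional (filters M)"
    by (simp add: filter_map_def)
  ultimately have "filter_map M K (compose (carrier M) g f) =
      compose (filters M) (filter_map N K g) (filter_map M N f)"
    by (intro extensionalityI[of _ "filters M"]) (auto simp: compose_eq)
  then show "AMap functor_F M K (Comp DMS M N K g f) =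
      Comp AlgFrmSup (OMap functor_F M) (OMap functor_F N) (OMap functor_F K)
        (AMap functor_F N K g) (AMap functor_F M N f)"
    by (simp add: functor_F_def DMS_def AlgFrmSup_def)
qed

section \<open>Compact elements\<close>

context alg_frame begin

abbreviation compacts (\<open>\<KK>\<close>) where
  "\<KK> \<equiv> compact_elements L"

abbreviation primes (\<open>\<PP>\<close>) where
  "\<PP> \<equiv> prime_elements L"

abbreviation dual_of_frame (\<open>\<YY>\<close>) where
  "\<YY> \<equiv> pp_space L"

lemma compact_closed: "k \<in> \<KK> \<Longrightarrow> k \<in> carrier L"
  by (simp add: compact_elements_def)

lemma compact_subset: "S \<subseteq> \<KK> \<Longrightarrow> S \<subseteq> carrier L"
  using compact_closed by blast

lemma compact_finite_sup:
  "k \<in> \<KK> \<Longrightarrow> S \<subseteq> carrier L \<Longrightarrow> k \<sqsubseteq> \<Squnion>S \<Longrightarrow> \<exists>T. finite T \<and> T \<subseteq> S \<and> k \<sqsubseteq> \<Squnion>T"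
  by (simp add: compact_elements_def way_below_def)

lemma sup_mono: "S \<subseteq> T \<Longrightarrow> T \<subseteq> carrier L \<Longrightarrow> \<Squnion>S \<sqsubseteq> \<Squnion>T"
  by (rule sup_least) (auto intro: sup_upper)

lemma finite_sup_compact:
  assumes "finite A" "A \<subseteq> \<KK>"
  shows "\<Squnion>A \<in> \<KK>"
proof -
  have Ac: "A \<subseteq> carrier L" using compact_subset assms by blast
  have "\<exists>T. finite T \<and> T \<subseteq> S \<and> \<Squnion>A \<sqsubseteq> \<Squnion>T" if S: "S \<subseteq> carrier L" "\<Squnion>A \<sqsubseteq> \<Squnion>S" for S
  proof -
    have "\<exists>T. finite T \<and> T \<subseteq> S \<and> a \<sqsubseteq> \<Squnion>T" if "a \<in> A" for a
    proof (rule compact_finite_sup)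
      show "a \<sqsubseteq> \<Squnion>S" by (rule le_trans[OF sup_upper[OF Ac that] S(2)]) (use that Ac S in auto)
    qed (use that assms S in auto)
    then obtain T where T: "\<And>a. a \<in> A \<Longrightarrow> finite (T a) \<and> T a \<subseteq> S \<and> a \<sqsubseteq> \<Squnion>(T a)" by metis
    have Uc: "\<Union>(T ` A) \<subseteq> carrier L" using T S by blast
    have "a \<sqsubseteq> \<Squnion>(\<Union>(T ` A))" if "a \<in> A" for a
    proof (rule le_trans)
      show "a \<sqsubseteq> \<Squnion>(T a)" using T that by blast
      show "\<Squnion>(T a) \<sqsubseteq> \<Squnion>(\<Union>(T ` A))" by (rule sup_mono[OF _ Uc]) (use that in blast)
      show "\<Squnion>(T a) \<in> carrier L" by (rule sup_closed) (use T[OF that] S in blast)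
    qed (use that Ac Uc in auto)
    then have "\<Squnion>A \<sqsubseteq> \<Squnion>(\<Union>(T ` A))" by (intro sup_least) (use Ac Uc in auto)
    then show ?thesis using T assms by (intro exI[of _ "\<Union>(T ` A)"]) auto
  qed
  then show ?thesis using Ac by (simp add: compact_elements_def way_below_def)
qed

lemma le_iff_compacts:
  assumes "x \<in> carrier L" "y \<in> carrier L"
  shows "x \<sqsubseteq> y \<longleftrightarrow> (\<forall>k\<in>\<KK>. k \<sqsubseteq> x \<longrightarrow> k \<sqsubseteq> y)"
proof
  show "\<forall>k\<in>\<KK>. k \<sqsubseteq> x \<longrightarrow> k \<sqsubseteq> y" if "x \<sqsubseteq> y"
    using le_trans[OF _ that] assms compact_closed by auto
  assume *: "\<forall>k\<in>\<KK>. k \<sqsubseteq> x \<longrightarrow> k \<sqsubseteq> y"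
  obtain S where S: "S \<subseteq> \<KK>" "x = \<Squnion>S" using algebraic assms by blast
  have Sc: "S \<subseteq> carrier L" using S compact_subset by blast
  have "\<Squnion>S \<sqsubseteq> y"
    by (rule sup_least[OF Sc assms(2)]) (use S * sup_upper[OF Sc] in auto)
  then show "x \<sqsubseteq> y" using S by simp
qed

lemma compact_witness:
  "x \<in> carrier L \<Longrightarrow> y \<in> carrier L \<Longrightarrow> \<not> x \<sqsubseteq> y \<Longrightarrow> \<exists>k\<in>\<KK>. k \<sqsubseteq> x \<and> \<not> k \<sqsubseteq> y"
  using le_iff_compacts[of x y] by auto

lemma sup_compacts_below:
  assumes a: "a \<in> carrier L"
  shows "\<Squnion>{k \<in> \<KK>. k \<sqsubseteq> a} = a"
proof (rule le_antisym)
  let ?S = "{k \<in> \<KK>. k \<sqsubseteq> a}"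
  have Sc: "?S \<subseteq> carrier L" using compact_closed by blast
  show "\<Squnion>?S \<sqsubseteq> a" by (rule sup_least[OF Sc a]) auto
  show "a \<sqsubseteq> \<Squnion>?S" using sup_upper[OF Sc] Sc a by (subst le_iff_compacts) auto
  show "\<Squnion>?S \<in> carrier L" using Sc by simp
qed (rule a)

text \<open>Algebraicity provides interpolation: the compact elements below \<open>b\<close> have join \<open>b\<close>, so finitely
  many of them have a join above \<open>a\<close>, and this join is again compact.\<close>

lemma way_below_iff:
  assumes a: "a \<in> carrier L" and b: "b \<in> carrier L"
  shows "way_below L a b \<longleftrightarrow> (\<exists>k\<in>\<KK>. a \<sqsubseteq> k \<and> k \<sqsubseteq> b)"
proof
  assume "way_below L a b"
  moreover have "{k \<in> \<KK>. k \<sqsubseteq> b} \<subseteq> carrier L" using compact_closed by blast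
  moreover have "b \<sqsubseteq> \<Squnion>{k \<in> \<KK>. k \<sqsubseteq> b}" using sup_compacts_below b by simp
  ultimately obtain T where T: "finite T" "T \<subseteq> {k \<in> \<KK>. k \<sqsubseteq> b}" "a \<sqsubseteq> \<Squnion>T"
    unfolding way_below_def by meson
  have "\<Squnion>T \<in> \<KK>" using finite_sup_compact T by blast
  moreover have "\<Squnion>T \<sqsubseteq> b" using T compact_closed by (intro sup_least) (use b in auto)
  ultimately show "\<exists>k\<in>\<KK>. a \<sqsubseteq> k \<and> k \<sqsubseteq> b" using T by blast
next
  assume "\<exists>k\<in>\<KK>. a \<sqsubseteq> k \<and> k \<sqsubseteq> b"
  then obtain k where k: "k \<in> \<KK>" "a \<sqsubseteq> k" "k \<sqsubseteq> b" by blast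
  show "way_below L a b"
    unfolding way_below_def
  proof (intro allI impI)
    fix S assume "S \<subseteq> carrier L \<and> b \<sqsubseteq> \<Squnion>S"
    then have S: "S \<subseteq> carrier L" "b \<sqsubseteq> \<Squnion>S" by auto
    have "k \<sqsubseteq> \<Squnion>S" using le_trans[OF k(3) S(2)] compact_closed k b S by simp
    then obtain T where T: "finite T" "T \<subseteq> S" "k \<sqsubseteq> \<Squnion>T"
      using compact_finite_sup[OF k(1) S(1)] by metis
    then have Tc: "T \<subseteq> carrier L" using S by blast
    have "a \<sqsubseteq> \<Squnion>T" using le_trans[OF k(2) T(3) a compact_closed[OF k(1)] sup_closed[OF Tc]] .
    then show "\<exists>T. finite T \<and> T \<subseteq> S \<and> a \<sqsubseteq> \<Squnion>T" using T by blast
  qed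
qed

lemma meet_join_distrib:
  assumes "a \<in> carrier L" "b \<in> carrier L" "c \<in> carrier L"
  shows "a \<sqinter> (b \<squnion> c) = (a \<sqinter> b) \<squnion> (a \<sqinter> c)"
  using frame_distrib[of a "{b, c}"] assms by (simp add: join_def)

lemma compact_join_closed:
  "k \<in> \<KK> \<Longrightarrow> l \<in> \<KK> \<Longrightarrow> k \<squnion> l \<in> \<KK>"
  unfolding join_def by (rule finite_sup_compact) auto

lemma compact_dual_simps [simp]:
  "carrier (compact_dual L) = \<KK>" "eq (compact_dual L) = (=)"
  "le (compact_dual L) x y \<longleftrightarrow> y \<sqsubseteq> x"
  using eq_is_equal by (simp_all add: compact_dual_def)

lemma compact_dual_partial_order: "partial_order (compact_dual L)"
proof unfold_locales
  fix x y z assume "x \<sqsubseteq>\<^bsub>compact_dual L\<^esub> y" "y \<sqsubseteq>\<^bsub>compact_dual L\<^esub> z" "x \<in> carrier (compact_dual L)"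
    "y \<in> carrier (compact_dual L)" "z \<in> carrier (compact_dual L)"
  then show "x \<sqsubseteq>\<^bsub>compact_dual L\<^esub> z" using le_trans[of z y x] compact_closed by simp
next
  fix x y assume "x \<sqsubseteq>\<^bsub>compact_dual L\<^esub> y" "y \<sqsubseteq>\<^bsub>compact_dual L\<^esub> x" "x \<in> carrier (compact_dual L)"
    "y \<in> carrier (compact_dual L)"
  then show "x .=\<^bsub>compact_dual L\<^esub> y" using le_antisym[of x y] compact_closed by simp
qed (auto dest: compact_closed)

lemma compact_dual_finite_meet:
  assumes "finite A" "A \<subseteq> \<KK>"
  shows "greatest (compact_dual L) (\<Squnion>A) (Lower (compact_dual L) A)"
proof (rule greatest_LowerI)
  have Ac: "A \<subseteq> carrier L" using assms compact_subset by blast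
  show "\<Squnion>A \<sqsubseteq>\<^bsub>compact_dual L\<^esub> x" if "x \<in> A" for x using sup_upper[OF Ac that] by simp
  show "y \<sqsubseteq>\<^bsub>compact_dual L\<^esub> \<Squnion>A" if "y \<in> Lower (compact_dual L) A" for y
    using that sup_least[OF Ac, of y] assms compact_closed by (auto simp: Lower_def)
qed (use assms finite_sup_compact in auto)

lemma compact_dual_inf:
  "finite A \<Longrightarrow> A \<subseteq> \<KK> \<Longrightarrow> \<Sqinter>\<^bsub>compact_dual L\<^esub>A = \<Squnion>A"
  by (rule partial_order.inf_eqI[OF compact_dual_partial_order compact_dual_finite_meet])

text \<open>If the compact element \<open>c\<close> lies below \<open>a \<squnion> b\<close>, the frame law splits it into \<open>c \<sqinter> a\<close> and
  \<open>c \<sqinter> b\<close>; these need not be compact, but by compactness finitely many compact elements below them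
  already have join \<open>c\<close>.\<close>

lemma compact_split:
  assumes a: "a \<in> carrier L" and b: "b \<in> carrier L" and c: "c \<in> \<KK>" and le: "c \<sqsubseteq> a \<squnion> b"
  shows "\<exists>a'\<in>\<KK>. \<exists>b'\<in>\<KK>. a' \<sqsubseteq> a \<and> b' \<sqsubseteq> b \<and> a' \<squnion> b' = c"
proof -
  note cc = compact_closed[OF c]
  let ?A = "{k \<in> \<KK>. k \<sqsubseteq> c \<sqinter> a}" and ?B = "{k \<in> \<KK>. k \<sqsubseteq> c \<sqinter> b}"
  have sub: "?A \<union> ?B \<subseteq> carrier L" using compact_closed by blast
  have "c \<sqsubseteq> c \<sqinter> (a \<squnion> b)" by (rule meet_le) (use le cc a b in auto)
  also have "c \<sqinter> (a \<squnion> b) = (c \<sqinter> a) \<squnion> (c \<sqinter> b)" using meet_join_distrib cc a b by simp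
  also have "\<dots> = \<Squnion>?A \<squnion> \<Squnion>?B" using sup_compacts_below a b cc by simp
  also have "\<dots> \<sqsubseteq> \<Squnion>(?A \<union> ?B)" by (rule join_le) (use sub in \<open>auto intro: sup_mono\<close>)
  finally have "c \<sqsubseteq> \<Squnion>(?A \<union> ?B)" using cc a b sub by simp
  then obtain T where T: "finite T" "T \<subseteq> ?A \<union> ?B" "c \<sqsubseteq> \<Squnion>T"
    using compact_finite_sup[OF c sub] by blast
  let ?a = "\<Squnion>(T \<inter> ?A)" and ?b = "\<Squnion>(T \<inter> ?B)"
  have K: "?a \<in> \<KK>" "?b \<in> \<KK>"
    using T by (auto intro!: finite_sup_compact)
  have le: "?a \<sqsubseteq> c \<sqinter> a" "?b \<sqsubseteq> c \<sqinter> b"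
    using a b cc compact_closed by (auto intro!: sup_least)
  have leab: "?a \<sqsubseteq> a" "?b \<sqsubseteq> b" "?a \<sqsubseteq> c" "?b \<sqsubseteq> c"
    using le_trans[OF le(1) meet_right] le_trans[OF le(2) meet_right]
      le_trans[OF le(1) meet_left] le_trans[OF le(2) meet_left] K compact_closed a b cc by auto
  have Tc: "T \<subseteq> carrier L" using T(2) sub by blast
  have "x \<sqsubseteq> ?a \<squnion> ?b" if "x \<in> T" for x
  proof -
    have "x \<in> T \<inter> ?A \<or> x \<in> T \<inter> ?B" using T that by blast
    then show ?thesis
    proof
      assume "x \<in> T \<inter> ?A"
      then have "x \<sqsubseteq> ?a" using sup_upper[of "T \<inter> ?A" x] Tc by blast
      then show ?thesis
        using le_trans[OF _ join_left[of ?a ?b]] that Tc K compact_closed by auto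
    next
      assume "x \<in> T \<inter> ?B"
      then have "x \<sqsubseteq> ?b" using sup_upper[of "T \<inter> ?B" x] Tc by blast
      then show ?thesis
        using le_trans[OF _ join_right[of ?a ?b]] that Tc K compact_closed by auto
    qed
  qed
  then have "\<Squnion>T \<sqsubseteq> ?a \<squnion> ?b" using Tc K compact_closed by (intro sup_least) auto
  then have "c \<sqsubseteq> ?a \<squnion> ?b" using le_trans[OF T(3)] Tc K compact_closed cc by simp
  moreover have "?a \<squnion> ?b \<sqsubseteq> c" by (rule join_le) (use leab K compact_closed cc in auto)
  ultimately have "?a \<squnion> ?b = c" using K compact_closed cc by (intro le_antisym) auto
  then show ?thesis using K leab by blast
qed

lemma compact_dual_dms: "distributive_meet_semilattice (compact_dual L)"
  unfolding distributive_meet_semilattice_def meet_semilattice_def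
proof (intro conjI ballI impI allI compact_dual_partial_order)
  show "\<exists>i. greatest (compact_dual L) i (Lower (compact_dual L) A)"
    if "finite A \<and> A \<subseteq> carrier (compact_dual L)" for A
    using compact_dual_finite_meet that by auto
  fix a b c assume abc: "a \<in> carrier (compact_dual L)" "b \<in> carrier (compact_dual L)"
    "c \<in> carrier (compact_dual L)" and le: "a \<sqinter>\<^bsub>compact_dual L\<^esub> b \<sqsubseteq>\<^bsub>compact_dual L\<^esub> c"
  have m: "x \<sqinter>\<^bsub>compact_dual L\<^esub> y = x \<squnion> y" if "x \<in> \<KK>" "y \<in> \<KK>" for x y
    using compact_dual_inf[of "{x, y}"] that by (simp add: meet_def join_def)
  obtain a' b' where "a' \<in> \<KK>" "b' \<in> \<KK>" "a' \<sqsubseteq> a" "b' \<sqsubseteq> b" "a' \<squnion> b' = c"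
    using compact_split[of a b c] abc le m compact_closed by auto
  then show "\<exists>a'\<in>carrier (compact_dual L). \<exists>b'\<in>carrier (compact_dual L).
      a \<sqsubseteq>\<^bsub>compact_dual L\<^esub> a' \<and> b \<sqsubseteq>\<^bsub>compact_dual L\<^esub> b' \<and> a' \<sqinter>\<^bsub>compact_dual L\<^esub> b' = c"
    using m by (intro bexI[of _ a'] bexI[of _ b']) auto
qed

end

locale frame_hom = L: alg_frame L + M: alg_frame M for L :: "'a gorder" and M :: "'b gorder" +
  fixes \<alpha> :: "'a \<Rightarrow> 'b"
  assumes hom: "\<alpha> \<in> join_compact_hom L M"
begin

lemma closed: "x \<in> carrier L \<Longrightarrow> \<alpha> x \<in> carrier M"
  using hom by (auto simp: join_compact_hom_def)

lemma preserves_sup: "S \<subseteq> carrier L \<Longrightarrow> \<alpha> (\<Squnion>\<^bsub>L\<^esub>S) = \<Squnion>\<^bsub>M\<^esub>(\<alpha> ` S)"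
  using hom by (auto simp: join_compact_hom_def)

lemma preserves_compact: "k \<in> compact_elements L \<Longrightarrow> \<alpha> k \<in> compact_elements M"
  using hom by (auto simp: join_compact_hom_def)

lemma compact_restriction: "restrict \<alpha> (compact_elements L) \<in> finite_meet_hom (compact_dual L) (compact_dual M)"
proof -
  have "restrict \<alpha> (compact_elements L) (\<Sqinter>\<^bsub>compact_dual L\<^esub>A) =
      \<Sqinter>\<^bsub>compact_dual M\<^esub>(restrict \<alpha> (compact_elements L) ` A)"
    if A: "finite A" "A \<subseteq> compact_elements L" for A
  proof -
    have "restrict \<alpha> (compact_elements L) ` A = \<alpha> ` A" using A by (auto simp: image_def)
    moreover have "\<alpha> ` A \<subseteq> compact_elements M" using A preserves_compact by blast
    ultimately show ?thesis
      using A L.compact_dual_inf M.compact_dual_inf[of "\<alpha> ` A"] L.finite_sup_compact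
        preserves_sup[of A] L.compact_subset by simp
  qed
  then show ?thesis using preserves_compact by (auto simp: finite_meet_hom_def)
qed

end

lemma compact_functor: "covariant_functor AlgFrmSup DMS functor_K"
  unfolding covariant_functor_def
proof (intro conjI ballI DMS_is_category AlgFrmSup_is_category)
  fix L :: "'a gorder" assume "L \<in> Obj AlgFrmSup"
  then interpret alg_frame L by (simp add: AlgFrmSup_def alg_frame_iff)
  show "OMap functor_K L \<in> Obj DMS" by (simp add: functor_K_def DMS_def compact_dual_dms)
  show "AMap functor_K L L (Ident AlgFrmSup L) = Ident DMS (OMap functor_K L)"
    using compact_closed by (auto simp: functor_K_def DMS_def AlgFrmSup_def restrict_def)
next
  fix L M :: "'a gorder" and f
  assume "L \<in> Obj AlgFrmSup" "M \<in> Obj AlgFrmSup" "f \<in> Hom AlgFrmSup L M"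
  then interpret frame_hom L M f by (simp add: AlgFrmSup_def alg_frame_iff frame_hom_def frame_hom_axioms_def)
  show "AMap functor_K L M f \<in> Hom DMS (OMap functor_K L) (OMap functor_K M)"
    using compact_restriction by (simp add: functor_K_def DMS_def)
next
  fix L M N :: "'a gorder" and f g
  assume "L \<in> Obj AlgFrmSup" "M \<in> Obj AlgFrmSup" "N \<in> Obj AlgFrmSup"
    "f \<in> Hom AlgFrmSup L M" "g \<in> Hom AlgFrmSup M N"
  then interpret f: frame_hom L M f + g: frame_hom M N g
    by (simp_all add: AlgFrmSup_def alg_frame_iff frame_hom_def frame_hom_axioms_def)
  have "restrict (compose (carrier L) g f) (compact_elements L) =
      compose (compact_elements L) (restrict g (compact_elements M)) (restrict f (compact_elements L))"
    using f.preserves_compact f.L.compact_closed by (auto simp: compose_def restrict_def)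
  then show "AMap functor_K L N (Comp AlgFrmSup L M N g f) =
      Comp DMS (OMap functor_K L) (OMap functor_K M) (OMap functor_K N)
        (AMap functor_K M N g) (AMap functor_K L M f)"
    by (simp add: functor_K_def DMS_def AlgFrmSup_def)
qed

section \<open>The category of pointed generalized Priestley spaces\<close>

definition order_relation :: "'a priestley \<Rightarrow> ('a \<times> 'a) set" where
  "order_relation X = {(x, y) \<in> carrier X \<times> carrier X. x \<sqsubseteq>\<^bsub>X\<^esub> y}"

lemma admissible_clopen_upset: "U \<in> admissible_clopens X \<Longrightarrow> upset X U"
  by (simp add: admissible_clopens_def clopen_upset_def)

lemma box_order_relation:
  assumes X: "partial_order X" and U: "upset X U"
  shows "box X (order_relation X) U = U"
proof -
  interpret partial_order X by (rule X)
  show ?thesis using U by (auto simp: box_def order_relation_def upset_def)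
qed

lemma morphism_subset: "R \<in> priestley_morphisms X Y \<Longrightarrow> R \<subseteq> carrier X \<times> carrier Y"
  by (simp add: priestley_morphisms_def)

lemma box_admissible:
  "R \<in> priestley_morphisms X Y \<Longrightarrow> U \<in> admissible_clopens Y \<Longrightarrow> box X R U \<in> admissible_clopens X"
  by (simp add: priestley_morphisms_def)

lemma morphism_iff_box:
  assumes R: "R \<in> priestley_morphisms X Y"
  shows "R = {(x, y) \<in> carrier X \<times> carrier Y. \<forall>U\<in>admissible_clopens Y. x \<in> box X R U \<longrightarrow> y \<in> U}"
proof
  show "R \<subseteq> {(x, y) \<in> carrier X \<times> carrier Y. \<forall>U\<in>admissible_clopens Y. x \<in> box X R U \<longrightarrow> y \<in> U}"
    using morphism_subset[OF R] by (auto simp: box_def)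
  show "{(x, y) \<in> carrier X \<times> carrier Y. \<forall>U\<in>admissible_clopens Y. x \<in> box X R U \<longrightarrow> y \<in> U} \<subseteq> R"
  proof
    fix p
    assume p: "p \<in> {(x, y) \<in> carrier X \<times> carrier Y. \<forall>U\<in>admissible_clopens Y. x \<in> box X R U \<longrightarrow> y \<in> U}"
    obtain x y where xy: "p = (x, y)" by fastforce
    show "p \<in> R"
    proof (rule ccontr)
      assume "p \<notin> R"
      then obtain U where U: "U \<in> admissible_clopens Y" "R `` {x} \<subseteq> U" "y \<notin> U"
        using R p xy unfolding priestley_morphisms_def by blast
      then have "x \<in> box X R U" using p xy by (simp add: box_def)
      then show False using p xy U by simp
    qed
  qed
qed

text \<open>Since \<open>priestley_comp\<close> consists of all pairs that no admissible clopen upset excludes, it contains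
  the relational composite of \<open>R\<close> and \<open>S\<close>; conversely the pairs added do not change the boxes of
  admissible clopen upsets.\<close>

lemma box_comp:
  assumes "R \<subseteq> carrier X \<times> carrier Y" "S \<subseteq> carrier Y \<times> carrier Z" "U \<in> admissible_clopens Z"
  shows "box X (priestley_comp X Y Z S R) U = box X R (box Y S U)"
proof
  show "box X R (box Y S U) \<subseteq> box X (priestley_comp X Y Z S R) U"
    using assms by (auto simp: box_def priestley_comp_def)
  show "box X (priestley_comp X Y Z S R) U \<subseteq> box X R (box Y S U)"
  proof
    fix x assume x: "x \<in> box X (priestley_comp X Y Z S R) U"
    have "z \<in> U" if "(x, y) \<in> R" "(y, z) \<in> S" for y z
    proof -
      have "(x, z) \<in> priestley_comp X Y Z S R"
        using assms that by (auto simp: priestley_comp_def box_def)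
      then show ?thesis using x by (auto simp: box_def)
    qed
    then show "x \<in> box X R (box Y S U)" using x assms(1) by (auto simp: box_def)
  qed
qed

lemma comp_morphism:
  assumes R: "R \<in> priestley_morphisms X Y" and S: "S \<in> priestley_morphisms Y Z"
  shows "priestley_comp X Y Z S R \<in> priestley_morphisms X Z"
proof -
  note b = box_comp[OF morphism_subset[OF R] morphism_subset[OF S]]
  have "box X (priestley_comp X Y Z S R) U \<in> admissible_clopens X" if "U \<in> admissible_clopens Z" for U
    using b that box_admissible R S by metis
  moreover have "\<exists>U\<in>admissible_clopens Z. priestley_comp X Y Z S R `` {x} \<subseteq> U \<and> z \<notin> U"
    if xz: "x \<in> carrier X" "z \<in> carrier Z" "(x, z) \<notin> priestley_comp X Y Z S R" for x z
  proof -
    obtain U where U: "U \<in> admissible_clopens Z" "x \<in> box X R (box Y S U)" "z \<notin> U"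
      using xz by (auto simp: priestley_comp_def)
    then have "x \<in> box X (priestley_comp X Y Z S R) U" using b by blast
    then show ?thesis using U by (auto simp: box_def)
  qed
  ultimately show ?thesis
    unfolding priestley_morphisms_def by (auto simp: priestley_comp_def)
qed

text \<open>A morphism is recovered from its boxes, so two morphisms with the same boxes of admissible
  clopen upsets coincide.\<close>

lemma morphism_eqI:
  assumes R: "R \<in> priestley_morphisms X Y" and S: "S \<in> priestley_morphisms X Y"
    and eq: "\<And>U. U \<in> admissible_clopens Y \<Longrightarrow> box X R U = box X S U"
  shows "R = S"
  using morphism_iff_box[OF R] morphism_iff_box[OF S] eq by auto

locale priestley_poset = partial_order X for X :: "'a priestley" (structure) +
  assumes priestley: "priestley_space X"

lemma priestley_poset_iff: "priestley_space X \<longleftrightarrow> priestley_poset X"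
  by (auto simp: priestley_poset_def priestley_poset_axioms_def priestley_space_def)

locale pgps = priestley_poset X for X :: "'a priestley" (structure) +
  assumes pgps: "pointed_generalized_priestley_space X"

lemma pgps_iff: "pointed_generalized_priestley_space X \<longleftrightarrow> pgps X"
  by (auto simp: pgps_def pgps_axioms_def pointed_generalized_priestley_space_def
      priestley_poset_iff[symmetric])

context priestley_poset begin

lemma topspace_eq: "topspace (topol X) = carrier X"
  using priestley by (simp add: priestley_space_def)

lemma compact: "compact_space (topol X)"
  using priestley by (simp add: priestley_space_def)

lemma separation:
  "x \<in> carrier X \<Longrightarrow> y \<in> carrier X \<Longrightarrow> \<not> x \<sqsubseteq> y \<Longrightarrow> \<exists>U. clopen_upset X U \<and> x \<in> U \<and> y \<notin> U"
  using priestley by (simp add: priestley_space_def)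

end

context pgps begin

abbreviation admissible (\<open>\<AA>\<close>) where
  "\<AA> \<equiv> admissible_clopens X"

abbreviation admissible_closed (\<open>\<VV>\<close>) where
  "\<VV> \<equiv> admissible_closed_upsets X"

abbreviation frame_of_closed (\<open>\<CC>\<close>) where
  "\<CC> \<equiv> closed_upset_frame X"

lemma dense_part_subset: "dense_part X \<subseteq> carrier X - {max_point X}"
  using pgps by (simp add: pointed_generalized_priestley_space_def)

lemma dense_part_iff:
  "x \<in> carrier X \<Longrightarrow> x \<in> dense_part X \<longleftrightarrow> avoiding X x \<noteq> {} \<and>
     (\<forall>U\<in>avoiding X x. \<forall>V\<in>avoiding X x. \<exists>W\<in>avoiding X x. U \<subseteq> W \<and> V \<subseteq> W)"
  using pgps unfolding pointed_generalized_priestley_space_def by simp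

lemma le_iff_admissible:
  "x \<in> carrier X \<Longrightarrow> y \<in> carrier X \<Longrightarrow> x \<sqsubseteq> y \<longleftrightarrow> (\<forall>U\<in>\<AA>. x \<in> U \<longrightarrow> y \<in> U)"
  using pgps unfolding pointed_generalized_priestley_space_def by simp

lemma order_relation_morphism: "order_relation X \<in> priestley_morphisms X X"
proof -
  have b: "box X (order_relation X) U = U" if "U \<in> \<AA>" for U
    using box_order_relation[OF partial_order_axioms] admissible_clopen_upset that by blast
  have "\<exists>U\<in>\<AA>. order_relation X `` {x} \<subseteq> U \<and> y \<notin> U"
    if xy: "x \<in> carrier X" "y \<in> carrier X" "(x, y) \<notin> order_relation X" for x y
  proof -
    have "\<not> x \<sqsubseteq> y" using xy by (simp add: order_relation_def)
    then obtain U where U: "U \<in> \<AA>" "x \<in> U" "y \<notin> U"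
      using le_iff_admissible xy by blast
    then have "order_relation X `` {x} \<subseteq> U"
      using admissible_clopen_upset[OF U(1)] by (auto simp: upset_def order_relation_def)
    then show ?thesis using U by blast
  qed
  then show ?thesis using b by (auto simp: priestley_morphisms_def order_relation_def)
qed

end

lemma PGPS_simps:
  "Obj PGPS = {X. pointed_generalized_priestley_space X}" "Hom PGPS = priestley_morphisms"
  "Ident PGPS = order_relation" "Comp PGPS = priestley_comp"
  by (simp_all add: PGPS_def order_relation_def fun_eq_iff)

lemma PGPS_is_category: "is_category PGPS"
proof -
  let ?P = "{X :: 'a priestley. pointed_generalized_priestley_space X}"
  have id: "order_relation X \<in> priestley_morphisms X X" if "X \<in> ?P" for X
    using that pgps.order_relation_morphism pgps_iff by blast
  have po: "partial_order X" if "X \<in> ?P" for X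
    using that by (simp add: pgps_iff pgps_def priestley_poset_def)
  have box_id: "box X (order_relation X) U = U" if "X \<in> ?P" "U \<in> admissible_clopens X" for X U
    using box_order_relation po admissible_clopen_upset that by blast
  have "priestley_comp X X Y R (order_relation X) = R"
    if "X \<in> ?P" "Y \<in> ?P" and R: "R \<in> priestley_morphisms X Y" for X Y R
  proof (rule morphism_eqI[OF comp_morphism[OF id R] R])
    fix U assume "U \<in> admissible_clopens Y"
    then show "box X (priestley_comp X X Y R (order_relation X)) U = box X R U"
      using box_comp[OF morphism_subset[OF id] morphism_subset[OF R]] box_id box_admissible[OF R] that
      by simp
  qed (use that in simp)
  moreover have "priestley_comp X Y Y (order_relation Y) R = R"
    if "X \<in> ?P" "Y \<in> ?P" and R: "R \<in> priestley_morphisms X Y" for X Y R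
  proof (rule morphism_eqI[OF comp_morphism[OF R id] R])
    fix U assume "U \<in> admissible_clopens Y"
    then show "box X (priestley_comp X Y Y (order_relation Y) R) U = box X R U"
      using box_comp[OF morphism_subset[OF R] morphism_subset[OF id]] box_id that by simp
  qed (use that in simp)
  moreover have "priestley_comp X Y W (priestley_comp Y Z W T S) R =
      priestley_comp X Z W T (priestley_comp X Y Z S R)"
    if R: "R \<in> priestley_morphisms X Y" and S: "S \<in> priestley_morphisms Y Z"
      and T: "T \<in> priestley_morphisms Z W" for X Y Z W :: "'a priestley" and R S T
  proof (rule morphism_eqI[OF comp_morphism[OF R comp_morphism[OF S T]]
        comp_morphism[OF comp_morphism[OF R S] T]])
    fix U assume U: "U \<in> admissible_clopens W"
    note sub = morphism_subset[OF R] morphism_subset[OF S] morphism_subset[OF T]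
      morphism_subset[OF comp_morphism[OF R S]] morphism_subset[OF comp_morphism[OF S T]]
    show "box X (priestley_comp X Y W (priestley_comp Y Z W T S) R) U =
        box X (priestley_comp X Z W T (priestley_comp X Y Z S R)) U"
      using box_comp[OF sub(1,5) U] box_comp[OF sub(2,3) U] box_comp[OF sub(4,3) U]
        box_comp[OF sub(1,2) box_admissible[OF T U]] by simp
  qed
  ultimately show ?thesis
    unfolding is_category_def PGPS_simps
    by (intro conjI ballI) (auto intro: id comp_morphism)
qed

section \<open>Admissible closed upsets\<close>

text \<open>Compactness in dual form, applied to the complement of \<open>W\<close>, which is compact.\<close>

lemma compact_space_closed_family:
  assumes T: "compact_space T" and W: "openin T W" and F: "\<And>U. U \<in> \<U> \<Longrightarrow> closedin T U"
    and sub: "topspace T \<inter> \<Inter>\<U> \<subseteq> W"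
  shows "\<exists>\<F>. finite \<F> \<and> \<F> \<subseteq> \<U> \<and> topspace T \<inter> \<Inter>\<F> \<subseteq> W"
proof -
  have "compactin T (topspace T - W)" using T W closedin_compact_space by blast
  moreover have "openin T V" if "V \<in> (\<lambda>U. topspace T - U) ` \<U>" for V using that F by auto
  moreover have "topspace T - W \<subseteq> \<Union>((\<lambda>U. topspace T - U) ` \<U>)" using sub by blast
  ultimately obtain \<V> where V: "finite \<V>" "\<V> \<subseteq> (\<lambda>U. topspace T - U) ` \<U>" "topspace T - W \<subseteq> \<Union>\<V>"
    unfolding compactin_def by meson
  obtain \<F> where "finite \<F>" "\<F> \<subseteq> \<U>" "\<V> = (\<lambda>U. topspace T - U) ` \<F>"
    using finite_subset_image[OF V(1,2)] by auto
  moreover from this have "topspace T \<inter> \<Inter>\<F> \<subseteq> W" using V(3) by auto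
  ultimately show ?thesis by blast
qed

lemma finite_directed_bound:
  assumes "finite F" "F \<subseteq> A" "A \<noteq> {}"
    and dir: "\<And>x y. x \<in> A \<Longrightarrow> y \<in> A \<Longrightarrow> \<exists>z\<in>A. r x z \<and> r y z"
    and trans: "\<And>x y z. x \<in> A \<Longrightarrow> y \<in> A \<Longrightarrow> z \<in> A \<Longrightarrow> r x y \<Longrightarrow> r y z \<Longrightarrow> r x z"
  shows "\<exists>z\<in>A. \<forall>x\<in>F. r x z"
  using assms(1,2)
proof (induction F)
  case empty
  then show ?case using assms(3) by blast
next
  case (insert a F)
  then obtain z where z: "z \<in> A" "\<forall>x\<in>F. r x z" by blast
  obtain w where w: "w \<in> A" "r a w" "r z w" using dir[of a z] z insert by blast
  then have "\<forall>x\<in>insert a F. r x w" using trans z insert by blast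
  then show ?case using w by blast
qed

context priestley_poset begin

lemma clopen_upsetD:
  assumes "clopen_upset X U"
  shows "openin (topol X) U" "closedin (topol X) U" "U \<subseteq> carrier X"
    and "\<And>x y. x \<in> U \<Longrightarrow> y \<in> carrier X \<Longrightarrow> x \<sqsubseteq> y \<Longrightarrow> y \<in> U"
  using assms by (auto simp: clopen_upset_def upset_def)

text \<open>For Zorn's lemma, let \<open>D\<close> be a chain in \<open>C\<close>. Finitely many clopen upsets that meet \<open>D\<close> have a
  common point in \<open>D\<close>, so by compactness all of them have a common point in \<open>C\<close>. By Priestley
  separation this point is an upper bound of \<open>D\<close>.\<close>

lemma maximal_point_above:
  assumes C: "closedin (topol X) C" and x: "x \<in> C"
  shows "\<exists>m\<in>maximal_points X C. x \<sqsubseteq> m"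
proof -
  have Cc: "C \<subseteq> carrier X" using C closedin_subset topspace_eq by fastforce
  have "\<exists>m\<in>C. x \<sqsubseteq> m \<and> (\<forall>y\<in>C. m \<sqsubseteq> y \<longrightarrow> y = m)"
  proof (rule maximal_above[OF Cc x])
    fix D assume D: "D \<subseteq> C" "D \<noteq> {}" and chain: "\<And>x y. x \<in> D \<Longrightarrow> y \<in> D \<Longrightarrow> x \<sqsubseteq> y \<or> y \<sqsubseteq> x"
    define \<U> where "\<U> = {U. clopen_upset X U \<and> U \<inter> D \<noteq> {}}"
    have Dc: "D \<subseteq> carrier X" using D Cc by blast
    have "\<exists>u\<in>C. \<forall>U\<in>\<U>. u \<in> U"
    proof (rule ccontr)
      assume "\<not> ?thesis"
      then have "topspace (topol X) \<inter> \<Inter>\<U> \<subseteq> carrier X - C" using topspace_eq by blast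
      moreover have "openin (topol X) (carrier X - C)" using C topspace_eq by (metis openin_diff openin_topspace)
      moreover have "closedin (topol X) U" if "U \<in> \<U>" for U
        using that by (simp add: \<U>_def clopen_upset_def)
      ultimately obtain \<F> where F: "finite \<F>" "\<F> \<subseteq> \<U>" "topspace (topol X) \<inter> \<Inter>\<F> \<subseteq> carrier X - C"
        using compact_space_closed_family[OF compact] by metis
      have "\<exists>d\<in>D. d \<in> U" if "U \<in> \<F>" for U using that F(2) by (auto simp: \<U>_def)
      then obtain d where d: "\<And>U. U \<in> \<F> \<Longrightarrow> d U \<in> D \<and> d U \<in> U" by metis
      have "\<exists>z\<in>D. \<forall>x\<in>d ` \<F>. x \<sqsubseteq> z"
      proof (rule finite_directed_bound)
        show "\<exists>z\<in>D. x \<sqsubseteq> z \<and> y \<sqsubseteq> z" if "x \<in> D" "y \<in> D" for x y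
          using chain[OF that] that Dc by (metis le_refl subsetD)
        show "x \<sqsubseteq> z" if "x \<in> D" "y \<in> D" "z \<in> D" "x \<sqsubseteq> y" "y \<sqsubseteq> z" for x y z
          using le_trans[OF that(4,5)] that Dc by auto
      qed (use F d D in auto)
      then obtain z where z: "z \<in> D" "\<And>U. U \<in> \<F> \<Longrightarrow> d U \<sqsubseteq> z" by blast
      have "z \<in> U" if U: "U \<in> \<F>" for U
      proof -
        have "clopen_upset X U" using U F(2) by (auto simp: \<U>_def)
        then show ?thesis using clopen_upsetD(4)[of U "d U" z] d[OF U] z(2)[OF U] z(1) Dc by auto
      qed
      then show False using F(3) z(1) D Cc topspace_eq by blast
    qed
    then obtain u where u: "u \<in> C" "\<And>U. U \<in> \<U> \<Longrightarrow> u \<in> U" by blast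
    have "d \<sqsubseteq> u" if "d \<in> D" for d
    proof (rule ccontr)
      assume "\<not> d \<sqsubseteq> u"
      moreover have "d \<in> carrier X" "u \<in> carrier X" using that Dc u Cc by auto
      ultimately obtain U where "clopen_upset X U" "d \<in> U" "u \<notin> U"
        using separation by metis
      then show False using u(2)[of U] that by (auto simp: \<U>_def)
    qed
    then show "\<exists>u\<in>C. \<forall>x\<in>D. x \<sqsubseteq> u" using u by blast
  qed
  then show ?thesis by (auto simp: maximal_points_def)
qed

end

context pgps begin

text \<open>The admissible clopen upsets avoiding a point of the dense part are directed, so a finite
  cover of a closed set by such upsets can be replaced by a single one.\<close>

lemma admissible_separation:
  assumes C: "closedin (topol X) C" and x: "x \<in> dense_part X" and nle: "\<And>c. c \<in> C \<Longrightarrow> \<not> c \<sqsubseteq> x"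
  shows "\<exists>W\<in>\<AA>. C \<subseteq> W \<and> x \<notin> W"
proof -
  have xc: "x \<in> carrier X" using x dense_part_subset by blast
  have Cc: "C \<subseteq> carrier X" using C closedin_subset topspace_eq by fastforce
  have ne: "avoiding X x \<noteq> {}"
    and dir: "\<And>U V. U \<in> avoiding X x \<Longrightarrow> V \<in> avoiding X x \<Longrightarrow> \<exists>W\<in>avoiding X x. U \<subseteq> W \<and> V \<subseteq> W"
    using dense_part_iff[OF xc] x by blast+
  have "C \<subseteq> \<Union>(avoiding X x)"
  proof
    fix c assume c: "c \<in> C"
    then obtain U where "U \<in> \<AA>" "c \<in> U" "x \<notin> U"
      using le_iff_admissible[of c x] nle[OF c] xc Cc by auto
    then show "c \<in> \<Union>(avoiding X x)" by (auto simp: avoiding_def)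
  qed
  moreover have "compactin (topol X) C" using closedin_compact_space[OF compact C] .
  moreover have "openin (topol X) U" if "U \<in> avoiding X x" for U
    using that by (simp add: avoiding_def admissible_clopens_def clopen_upset_def)
  ultimately obtain \<F> where F: "finite \<F>" "\<F> \<subseteq> avoiding X x" "C \<subseteq> \<Union>\<F>"
    unfolding compactin_def by meson
  have "\<exists>W\<in>avoiding X x. \<forall>U\<in>\<F>. U \<subseteq> W"
    by (rule finite_directed_bound[OF F(1,2) ne dir]) auto
  then obtain W where "W \<in> avoiding X x" "\<forall>U\<in>\<F>. U \<subseteq> W" by blast
  then have "W \<in> \<AA>" "x \<notin> W" "C \<subseteq> W" using F(3) by (auto simp: avoiding_def)
  then show ?thesis by metis
qed

lemma closed_upsetD:
  assumes "C \<in> \<VV>"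
  shows "closedin (topol X) C" "upset X C" "C \<subseteq> carrier X"
    and "\<And>x. x \<in> carrier X \<Longrightarrow> x \<notin> C \<Longrightarrow> \<exists>y\<in>dense_part X. y \<notin> C \<and> x \<sqsubseteq> y"
    and "\<And>x y. x \<in> C \<Longrightarrow> y \<in> carrier X \<Longrightarrow> x \<sqsubseteq> y \<Longrightarrow> y \<in> C"
  using assms unfolding admissible_closed_upsets_def upset_def by blast+

lemma closed_upsetI:
  assumes "closedin (topol X) C" "upset X C"
    and "\<And>x. x \<in> carrier X \<Longrightarrow> x \<notin> C \<Longrightarrow> \<exists>y\<in>dense_part X. y \<notin> C \<and> x \<sqsubseteq> y"
  shows "C \<in> \<VV>"
  using assms dense_part_subset unfolding admissible_closed_upsets_def upset_def by blast

text \<open>For a clopen upset, the condition on the maximal points of the complement and the condition that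
  the complement is generated by the dense part are equivalent, because every point of the closed
  complement lies below a maximal one.\<close>

lemma admissible_clopens_eq:
  "\<AA> = {U \<in> \<VV>. openin (topol X) U}"
proof
  show "\<AA> \<subseteq> {U \<in> \<VV>. openin (topol X) U}"
  proof
    fix U assume U: "U \<in> \<AA>"
    then have o: "openin (topol X) U" and c: "closedin (topol X) U" and up: "upset X U"
      and m: "maximal_points X (carrier X - U) \<subseteq> dense_part X"
      by (auto simp: admissible_clopens_def clopen_upset_def)
    have cl: "closedin (topol X) (carrier X - U)" using o topspace_eq by (metis closedin_diff closedin_topspace)
    have "\<exists>y\<in>dense_part X. y \<notin> U \<and> x \<sqsubseteq> y" if "x \<in> carrier X" "x \<notin> U" for x
    proof -
      obtain y where "y \<in> maximal_points X (carrier X - U)" "x \<sqsubseteq> y"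
        using maximal_point_above[OF cl, of x] \<open>x \<in> carrier X\<close> \<open>x \<notin> U\<close> by blast
      then show ?thesis using m by (auto simp: maximal_points_def)
    qed
    then show "U \<in> {U \<in> \<VV>. openin (topol X) U}"
      using closed_upsetI[OF c up] o by blast
  qed
  show "{U \<in> \<VV>. openin (topol X) U} \<subseteq> \<AA>"
  proof
    fix U assume "U \<in> {U \<in> \<VV>. openin (topol X) U}"
    then have U: "U \<in> \<VV>" and o: "openin (topol X) U" by auto
    have "x \<in> dense_part X" if x: "x \<in> maximal_points X (carrier X - U)" for x
    proof -
      obtain y where "y \<in> dense_part X" "y \<notin> U" "x \<sqsubseteq> y"
        using closed_upsetD(4)[OF U, of x] x by (auto simp: maximal_points_def)
      then show ?thesis using x dense_part_subset by (auto simp: maximal_points_def)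
    qed
    then show "U \<in> \<AA>"
      using U o closed_upsetD(1,2) by (auto simp: admissible_clopens_def clopen_upset_def)
  qed
qed

lemma admissible_clopen_closed: "U \<in> \<AA> \<Longrightarrow> U \<in> \<VV>"
  using admissible_clopens_eq by blast

lemma inter_admissible:
  assumes S: "\<S> \<subseteq> \<VV>"
  shows "carrier X \<inter> \<Inter>\<S> \<in> \<VV>"
proof (rule closed_upsetI)
  have "closedin (topol X) (\<Inter>(insert (carrier X) \<S>))"
    by (rule closedin_Inter) (use S closed_upsetD(1) topspace_eq in \<open>auto simp: closedin_def\<close>)
  then show "closedin (topol X) (carrier X \<inter> \<Inter>\<S>)" by simp
  show "upset X (carrier X \<inter> \<Inter>\<S>)"
    unfolding upset_def using S closed_upsetD(5) by blast
  show "\<exists>y\<in>dense_part X. y \<notin> carrier X \<inter> \<Inter>\<S> \<and> x \<sqsubseteq> y"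
    if "x \<in> carrier X" "x \<notin> carrier X \<inter> \<Inter>\<S>" for x
    using that S closed_upsetD(4) by blast
qed

lemma finite_inter_admissible_clopens:
  assumes "finite \<F>" "\<F> \<subseteq> \<AA>"
  shows "carrier X \<inter> \<Inter>\<F> \<in> \<AA>"
proof -
  have "carrier X \<inter> \<Inter>\<F> \<in> \<VV>"
    using inter_admissible[of \<F>] assms admissible_clopens_eq by blast
  moreover have "openin (topol X) (\<Inter>(insert (carrier X) \<F>))"
    by (rule openin_Inter) (use assms admissible_clopens_eq topspace_eq openin_topspace[of "topol X"] in auto)
  ultimately show ?thesis using admissible_clopens_eq by simp
qed

text \<open>Together with closure under intersections, this makes the admissible closed upsets precisely the
  intersections of admissible clopen upsets.\<close>

lemma closed_upset_separation:
  assumes C: "C \<in> \<VV>" and x: "x \<in> carrier X" "x \<notin> C"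
  shows "\<exists>U\<in>\<AA>. C \<subseteq> U \<and> x \<notin> U"
proof -
  obtain y where y: "y \<in> dense_part X" "y \<notin> C" "x \<sqsubseteq> y" using closed_upsetD(4)[OF C x] by blast
  have yc: "y \<in> carrier X" using y dense_part_subset by blast
  have "\<exists>U\<in>\<AA>. C \<subseteq> U \<and> y \<notin> U"
    by (rule admissible_separation[OF closed_upsetD(1)[OF C] y(1)])
      (use closed_upsetD(5)[OF C _ yc] y in blast)
  then obtain U where U: "U \<in> \<AA>" "C \<subseteq> U" "y \<notin> U" by blast
  then have "x \<notin> U" using admissible_clopen_upset[OF U(1)] y yc by (auto simp: upset_def)
  then show ?thesis using U by blast
qed

lemma closed_upset_eq_inter:
  assumes "C \<in> \<VV>"
  shows "carrier X \<inter> \<Inter>{U \<in> \<AA>. C \<subseteq> U} = C"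
  using closed_upset_separation[OF assms] closed_upsetD(3)[OF assms] by blast

text \<open>A point of \<open>C\<close> outside \<open>D\<close> lies below a point of the dense part outside \<open>D\<close>, which is in \<open>C\<close>
  because \<open>C\<close> is an upset. Hence inclusions, and equations, can be tested on the dense part.\<close>

lemma subset_iff_dense:
  assumes C: "C \<in> \<VV>" and D: "D \<in> \<VV>"
  shows "C \<subseteq> D \<longleftrightarrow> C \<inter> dense_part X \<subseteq> D"
proof
  assume *: "C \<inter> dense_part X \<subseteq> D"
  show "C \<subseteq> D"
  proof (rule ccontr)
    assume "\<not> C \<subseteq> D"
    then obtain x where x: "x \<in> C" "x \<notin> D" by blast
    then have xc: "x \<in> carrier X" using closed_upsetD(3)[OF C] by blast
    obtain y where y: "y \<in> dense_part X" "y \<notin> D" "x \<sqsubseteq> y" using closed_upsetD(4)[OF D xc x(2)] by blast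
    have "y \<in> C" using closed_upsetD(5)[OF C x(1) _ y(3)] y dense_part_subset by blast
    then show False using * y by blast
  qed
qed blast

lemma closed_upset_frame_simps [simp]:
  "carrier (\<CC>) = \<VV>"
  "le (\<CC>) = (\<supseteq>)" "eq (\<CC>) = (=)"
  by (simp_all add: closed_upset_frame_def)

lemma closed_upset_frame_partial_order: "partial_order (\<CC>)"
  unfolding closed_upset_frame_def by (rule partial_order_supset)

lemma inter_is_sup:
  "\<S> \<subseteq> \<VV> \<Longrightarrow>
    least (\<CC>) (carrier X \<inter> \<Inter>\<S>) (Upper (\<CC>) \<S>)"
  by (rule least_UpperI)
    (use inter_admissible closed_upsetD(3) in \<open>auto simp: Upper_def\<close>)

lemma closed_upset_sup:
  "\<S> \<subseteq> \<VV> \<Longrightarrow> \<Squnion>\<^bsub>\<CC>\<^esub>\<S> = carrier X \<inter> \<Inter>\<S>"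
  by (rule partial_order.sup_eqI[OF closed_upset_frame_partial_order inter_is_sup])

text \<open>The meet of \<open>C\<close> and \<open>D\<close> in the frame of admissible closed upsets, which is ordered by reverse
  inclusion, is the hull of \<open>C \<union> D\<close>.\<close>

definition admissible_hull :: "'a set \<Rightarrow> 'a set" where
  "admissible_hull S = carrier X \<inter> \<Inter>{E \<in> \<VV>. S \<subseteq> E}"

lemma admissible_hull: "admissible_hull S \<in> \<VV>"
  unfolding admissible_hull_def by (rule inter_admissible) auto

lemma admissible_hull_is_inf:
  "\<S> \<subseteq> \<VV> \<Longrightarrow>
    greatest (\<CC>) (admissible_hull (\<Union>\<S>)) (Lower (\<CC>) \<S>)"
proof (rule greatest_LowerI)
  assume S: "\<S> \<subseteq> \<VV>"
  show "admissible_hull (\<Union>\<S>) \<sqsubseteq>\<^bsub>\<CC>\<^esub> D" if "D \<in> \<S>" for D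
    using that S closed_upsetD(3) unfolding admissible_hull_def by auto
  show "E \<sqsubseteq>\<^bsub>\<CC>\<^esub> admissible_hull (\<Union>\<S>)" if "E \<in> Lower (\<CC>) \<S>" for E
    using that S unfolding admissible_hull_def Lower_def by auto
qed (simp_all add: admissible_hull)

lemma closed_upset_frame_complete: "complete_lattice (\<CC>)"
  by (rule partial_order.complete_latticeI[OF closed_upset_frame_partial_order])
    (use inter_is_sup admissible_hull_is_inf in auto)

lemma closed_upset_meet:
  "C \<in> \<VV> \<Longrightarrow> D \<in> \<VV> \<Longrightarrow>
    C \<sqinter>\<^bsub>\<CC>\<^esub> D = admissible_hull (C \<union> D)"
  unfolding meet_def
  using partial_order.inf_eqI[OF closed_upset_frame_partial_order admissible_hull_is_inf[of "{C, D}"]]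
  by simp

text \<open>The union of two admissible closed upsets need not be admissible, but passing to its hull adds
  no point of the dense part.\<close>

lemma hull_union_dense:
  assumes C: "C \<in> \<VV>" and D: "D \<in> \<VV>"
    and x: "x \<in> dense_part X"
  shows "x \<in> admissible_hull (C \<union> D) \<longleftrightarrow> x \<in> C \<or> x \<in> D"
proof
  have xc: "x \<in> carrier X" using x dense_part_subset by blast
  then show "x \<in> C \<or> x \<in> D \<Longrightarrow> x \<in> admissible_hull (C \<union> D)" by (auto simp: admissible_hull_def)
  show "x \<in> C \<or> x \<in> D" if h: "x \<in> admissible_hull (C \<union> D)"
  proof (rule ccontr)
    assume n: "\<not> (x \<in> C \<or> x \<in> D)"
    have "\<exists>W\<in>\<AA>. C \<union> D \<subseteq> W \<and> x \<notin> W"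
    proof (rule admissible_separation[OF _ x])
      show "closedin (topol X) (C \<union> D)" using closed_upsetD(1)[OF C] closed_upsetD(1)[OF D] by blast
      show "\<not> c \<sqsubseteq> x" if "c \<in> C \<union> D" for c
        using that n closed_upsetD(5)[OF C _ xc] closed_upsetD(5)[OF D _ xc] by blast
    qed
    then show False using h admissible_clopen_closed by (auto simp: admissible_hull_def)
  qed
qed

text \<open>On the dense part, finite meets are unions and joins are intersections, so the frame law reduces to
  the distributivity of unions over intersections of sets.\<close>

lemma closed_upset_frame_frame: "frame (\<CC>)"
  unfolding frame_def
proof (intro conjI ballI allI impI closed_upset_frame_complete)
  fix C \<S> assume "C \<in> carrier (\<CC>)" "\<S> \<subseteq> carrier (\<CC>)"
  then have C: "C \<in> \<VV>" and S: "\<S> \<subseteq> \<VV>" by auto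
  have im: "(\<lambda>D. C \<sqinter>\<^bsub>\<CC>\<^esub> D) ` \<S> = (\<lambda>D. admissible_hull (C \<union> D)) ` \<S>"
    using C S closed_upset_meet by (intro image_cong) auto
  have sub: "(\<lambda>D. admissible_hull (C \<union> D)) ` \<S> \<subseteq> \<VV>"
    using admissible_hull by blast
  let ?l = "admissible_hull (C \<union> (carrier X \<inter> \<Inter>\<S>))"
  let ?r = "carrier X \<inter> (\<Inter>D\<in>\<S>. admissible_hull (C \<union> D))"
  have I: "carrier X \<inter> \<Inter>\<S> \<in> \<VV>" using inter_admissible S .
  have r: "?r \<in> \<VV>" using inter_admissible[OF sub] by simp
  have "x \<in> ?l \<longleftrightarrow> x \<in> ?r" if x: "x \<in> dense_part X" for x
  proof -
    have "x \<in> carrier X" using x dense_part_subset by blast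
    then show ?thesis using hull_union_dense[OF C I x] hull_union_dense[OF C _ x] S by auto
  qed
  then have "?l = ?r"
    using subset_iff_dense[OF admissible_hull r] subset_iff_dense[OF r admissible_hull] by blast
  then show "C \<sqinter>\<^bsub>\<CC>\<^esub> (\<Squnion>\<^bsub>\<CC>\<^esub>\<S>)
      = \<Squnion>\<^bsub>\<CC>\<^esub>((\<lambda>D. C \<sqinter>\<^bsub>\<CC>\<^esub> D) ` \<S>)"
    using closed_upset_sup S sub im closed_upset_meet[OF C I] by simp
qed

text \<open>Joins are intersections, so admissible clopen upsets are compact by topological compactness. A
  compact element is a finite intersection of admissible clopen upsets because it is the intersection
  of all those containing it.\<close>

lemma compact_closed_upsets: "compact_elements (\<CC>) = \<AA>"
proof
  show "\<AA> \<subseteq> compact_elements (\<CC>)"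
  proof
    fix U assume U: "U \<in> \<AA>"
    have "\<exists>\<T>. finite \<T> \<and> \<T> \<subseteq> \<S> \<and> \<Squnion>\<^bsub>\<CC>\<^esub>\<T> \<subseteq> U"
      if S: "\<S> \<subseteq> \<VV>" "\<Squnion>\<^bsub>\<CC>\<^esub>\<S> \<subseteq> U" for \<S>
    proof -
      have "\<exists>\<T>. finite \<T> \<and> \<T> \<subseteq> \<S> \<and> topspace (topol X) \<inter> \<Inter>\<T> \<subseteq> U"
        by (rule compact_space_closed_family[OF compact])
          (use S U closed_upsetD(1) closed_upset_sup[OF S(1)] admissible_clopens_eq topspace_eq in auto)
      then show ?thesis using closed_upset_sup S(1) topspace_eq by (metis subset_trans)
    qed
    then show "U \<in> compact_elements (\<CC>)"
      using U admissible_clopen_closed by (simp add: compact_elements_def way_below_def)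
  qed
  show "compact_elements (\<CC>) \<subseteq> \<AA>"
  proof
    fix C assume "C \<in> compact_elements (\<CC>)"
    then have C: "C \<in> \<VV>"
      and comp: "\<And>\<S>. \<S> \<subseteq> \<VV> \<Longrightarrow> \<Squnion>\<^bsub>\<CC>\<^esub>\<S> \<subseteq> C \<Longrightarrow>
        \<exists>\<T>. finite \<T> \<and> \<T> \<subseteq> \<S> \<and> \<Squnion>\<^bsub>\<CC>\<^esub>\<T> \<subseteq> C"
      by (auto simp: compact_elements_def way_below_def)
    let ?S = "{U \<in> \<AA>. C \<subseteq> U}"
    have sub: "?S \<subseteq> \<VV>" using admissible_clopen_closed by blast
    obtain \<T> where T: "finite \<T>" "\<T> \<subseteq> ?S" "\<Squnion>\<^bsub>\<CC>\<^esub>\<T> \<subseteq> C"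
      using comp[OF sub] closed_upset_sup[OF sub] closed_upset_eq_inter[OF C] by auto
    have "\<Squnion>\<^bsub>\<CC>\<^esub>\<T> = carrier X \<inter> \<Inter>\<T>"
      by (rule closed_upset_sup) (use T sub in blast)
    then have "C = carrier X \<inter> \<Inter>\<T>" using T closed_upsetD(3)[OF C] by auto
    then show "C \<in> \<AA>" using finite_inter_admissible_clopens[of \<T>] T by auto
  qed
qed

lemma closed_upset_frame_algebraic: "algebraic_frame (\<CC>)"
  unfolding algebraic_frame_def
proof (intro conjI ballI closed_upset_frame_frame)
  fix C assume "C \<in> carrier (\<CC>)"
  then have C: "C \<in> \<VV>" by simp
  have sub: "{U \<in> \<AA>. C \<subseteq> U} \<subseteq> \<VV>"
    using admissible_clopen_closed by blast
  show "\<exists>S\<subseteq>compact_elements (\<CC>). C = \<Squnion>\<^bsub>\<CC>\<^esub>S"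
    using closed_upset_sup[OF sub] closed_upset_eq_inter[OF C] compact_closed_upsets
    by (intro exI[of _ "{U \<in> \<AA>. C \<subseteq> U}"]) auto
qed

end

text \<open>This reduces statements about boxes of admissible closed upsets to boxes of admissible clopen
  upsets, on which morphisms and their composites are controlled.\<close>

lemma (in pgps) box_closed_upset:
  assumes R: "R \<subseteq> carrier Y \<times> carrier X" and C: "C \<in> admissible_closed_upsets X"
  shows "box Y R C = carrier Y \<inter> \<Inter>(box Y R ` {U \<in> admissible_clopens X. C \<subseteq> U})"
proof
  show "box Y R C \<subseteq> carrier Y \<inter> \<Inter>(box Y R ` {U \<in> admissible_clopens X. C \<subseteq> U})"
    by (auto simp: box_def)
  show "carrier Y \<inter> \<Inter>(box Y R ` {U \<in> admissible_clopens X. C \<subseteq> U}) \<subseteq> box Y R C"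
  proof
    fix y assume y: "y \<in> carrier Y \<inter> \<Inter>(box Y R ` {U \<in> admissible_clopens X. C \<subseteq> U})"
    have "x \<in> C" if "(y, x) \<in> R" for x
    proof (rule ccontr)
      assume "x \<notin> C"
      moreover have "x \<in> carrier X" using that R by blast
      ultimately obtain U where "U \<in> admissible_clopens X" "C \<subseteq> U" "x \<notin> U"
        using closed_upset_separation[OF C, of x] by metis
      then show False using y that by (auto simp: box_def)
    qed
    then show "y \<in> box Y R C" using y by (auto simp: box_def)
  qed
qed

lemma box_hom:
  assumes X: "pgps X" and Y: "pgps Y" and R: "R \<in> priestley_morphisms X Y"
  shows "restrict (box X R) (admissible_closed_upsets Y) \<in>
    join_compact_hom (closed_upset_frame Y) (closed_upset_frame X)"
proof -
  let ?b = "restrict (box X R) (admissible_closed_upsets Y)"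
  interpret X: pgps X by (rule X)
  interpret Y: pgps Y by (rule Y)
  note sub = morphism_subset[OF R]
  have cl: "box X R C \<in> admissible_closed_upsets X" if "C \<in> admissible_closed_upsets Y" for C
    unfolding Y.box_closed_upset[OF sub that]
    by (rule X.inter_admissible) (use box_admissible[OF R] X.admissible_clopen_closed in blast)
  have "?b (\<Squnion>\<^bsub>closed_upset_frame Y\<^esub>\<S>) =
      \<Squnion>\<^bsub>closed_upset_frame X\<^esub>(?b ` \<S>)"
    if S: "\<S> \<subseteq> admissible_closed_upsets Y" for \<S>
  proof -
    have "?b ` \<S> = box X R ` \<S>"
      using S by (intro image_cong) auto
    moreover have "box X R ` \<S> \<subseteq> admissible_closed_upsets X" using S cl by blast
    moreover have "box X R (carrier Y \<inter> \<Inter>\<S>) = carrier X \<inter> \<Inter>(box X R ` \<S>)"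
      using sub by (auto simp: box_def)
    ultimately show ?thesis
      using Y.closed_upset_sup[OF S] X.closed_upset_sup Y.inter_admissible[OF S] by simp
  qed
  then show ?thesis
    using cl Y.admissible_clopen_closed box_admissible[OF R]
    by (auto simp: join_compact_hom_def X.compact_closed_upsets Y.compact_closed_upsets)
qed

lemma closed_upset_functor: "contravariant_functor PGPS AlgFrmSup functor_Va"
  unfolding contravariant_functor_def
proof (intro conjI ballI PGPS_is_category AlgFrmSup_is_category)
  fix X :: "'a priestley" assume "X \<in> Obj PGPS"
  then interpret pgps X by (simp add: PGPS_def pgps_iff)
  show "OMap functor_Va X \<in> Obj AlgFrmSup"
    by (simp add: functor_Va_def AlgFrmSup_def closed_upset_frame_algebraic)
  have "box X (order_relation X) C = C" if "C \<in> admissible_closed_upsets X" for C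
    using box_order_relation[OF partial_order_axioms] closed_upsetD(2) that by blast
  then have "restrict (box X (order_relation X)) (admissible_closed_upsets X) =
      restrict (\<lambda>x. x) (admissible_closed_upsets X)"
    by (intro restrict_ext) auto
  then show "AMap functor_Va X X (Ident PGPS X) = Ident AlgFrmSup (OMap functor_Va X)"
    by (simp add: functor_Va_def AlgFrmSup_def PGPS_simps)
next
  fix X Y :: "'a priestley" and R
  assume "X \<in> Obj PGPS" "Y \<in> Obj PGPS" "R \<in> Hom PGPS X Y"
  then show "AMap functor_Va X Y R \<in> Hom AlgFrmSup (OMap functor_Va Y) (OMap functor_Va X)"
    using box_hom[of X Y R] by (simp add: functor_Va_def AlgFrmSup_def PGPS_def pgps_iff)
next
  fix X Y Z :: "'a priestley" and R S
  assume "X \<in> Obj PGPS" "Y \<in> Obj PGPS" "Z \<in> Obj PGPS" "R \<in> Hom PGPS X Y" "S \<in> Hom PGPS Y Z"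
  then have X: "pgps X" and Y: "pgps Y" and Z: "pgps Z"
    and R: "R \<in> priestley_morphisms X Y" and S: "S \<in> priestley_morphisms Y Z"
    by (simp_all add: PGPS_def pgps_iff)
  interpret X: pgps X by (rule X)
  interpret Y: pgps Y by (rule Y)
  interpret Z: pgps Z by (rule Z)
  note sub = morphism_subset[OF R] morphism_subset[OF S] morphism_subset[OF comp_morphism[OF R S]]
  have "box X (priestley_comp X Y Z S R) C = box X R (box Y S C)"
    if C: "C \<in> admissible_closed_upsets Z" for C
  proof -
    let ?U = "{U \<in> admissible_clopens Z. C \<subseteq> U}"
    have "box X (priestley_comp X Y Z S R) C = carrier X \<inter> \<Inter>(box X (priestley_comp X Y Z S R) ` ?U)"
      using Z.box_closed_upset[OF sub(3) C] .
    also have "box X (priestley_comp X Y Z S R) ` ?U = (\<lambda>U. box X R (box Y S U)) ` ?U"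
      using box_comp[OF sub(1,2)] by (intro image_cong) auto
    also have "carrier X \<inter> \<Inter>((\<lambda>U. box X R (box Y S U)) ` ?U) = box X R (carrier Y \<inter> \<Inter>(box Y S ` ?U))"
      unfolding box_def[of X R] using sub(1) by blast
    also have "carrier Y \<inter> \<Inter>(box Y S ` ?U) = box Y S C"
      using Z.box_closed_upset[OF sub(2) C] by simp
    finally show ?thesis .
  qed
  moreover have "box Y S C \<in> admissible_closed_upsets Y" if "C \<in> admissible_closed_upsets Z" for C
    using box_hom[OF Y Z S] that by (auto simp: join_compact_hom_def)
  ultimately have "restrict (box X (priestley_comp X Y Z S R)) (admissible_closed_upsets Z) =
      compose (admissible_closed_upsets Z) (restrict (box X R) (admissible_closed_upsets Y))
        (restrict (box Y S) (admissible_closed_upsets Z))"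
    by (intro extensionalityI[of _ "admissible_closed_upsets Z"]) (auto simp: compose_eq)
  then show "AMap functor_Va X Z (Comp PGPS X Y Z S R) =
      Comp AlgFrmSup (OMap functor_Va Z) (OMap functor_Va Y) (OMap functor_Va X)
        (AMap functor_Va X Y R) (AMap functor_Va Y Z S)"
    by (simp add: functor_Va_def AlgFrmSup_def PGPS_def)
qed

lemma admissible_clopen_functor_eq: "functors_equal PGPS functor_A (after_contravariant functor_K functor_Va)"
  unfolding functors_equal_def
proof (intro conjI ballI)
  fix X :: "'a priestley" assume "X \<in> Obj PGPS"
  then interpret pgps X by (simp add: PGPS_def pgps_iff)
  show "OMap functor_A X = OMap (after_contravariant functor_K functor_Va) X"
    by (simp add: functor_A_def after_contravariant_def functor_K_def functor_Va_def
        compact_dual_def compact_closed_upsets admissible_clopen_order_def)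
next
  fix X Y :: "'a priestley" and R assume "Y \<in> Obj PGPS"
  then interpret pgps Y by (simp add: PGPS_def pgps_iff)
  have "restrict (restrict (box X R) (admissible_closed_upsets Y)) (admissible_clopens Y) =
      restrict (box X R) (admissible_clopens Y)"
    using admissible_clopen_closed by (intro restrict_ext) auto
  then show "AMap functor_A X Y R = AMap (after_contravariant functor_K functor_Va) X Y R"
    by (simp add: functor_A_def after_contravariant_def functor_K_def functor_Va_def
        compact_closed_upsets)
qed

section \<open>Primes and pseudoprimes of an algebraic frame\<close>

text \<open>The form of a generated topology to which Alexander's subbase theorem applies.\<close>

lemma topology_generated_by_eq_subbase:
  "topology_generated_by \<S> = topology (arbitrary union_of (finite intersection_of (\<lambda>x. x \<in> \<S>) relative_to \<Union>\<S>))"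
  (is "_ = ?T")
proof (rule topology_eq[THEN iffD2], intro allI iffI)
  fix U
  show "openin ?T U" if U: "openin (topology_generated_by \<S>) U"
  proof (rule generate_topology_on_coarsest)
    show "istopology (openin ?T)" by simp
    show "openin ?T S" if "S \<in> \<S>" for S
      using that unfolding openin_subbase
      by (intro arbitrary_union_of_inc relative_to_subset_inc finite_intersection_of_inc) auto
    show "generate_topology_on \<S> U" using U by (rule openin_topology_generated_by)
  qed
  show "openin (topology_generated_by \<S>) U" if "openin ?T U"
  proof (rule minimal_topology_subbase[OF _ _ that])
    show "openin (topology_generated_by \<S>) (\<Union>\<S>)"
      using openin_topspace[of "topology_generated_by \<S>"] by simp
  qed (rule topology_generated_by_Basis)
qed

text \<open>One dual space carries the topology generated by sets of points, the other a subspace topology;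
  this lemma compares them.\<close>

lemma subtopology_generated_by:
  "subtopology (topology_generated_by \<S>) Y = topology_generated_by ((\<lambda>S. S \<inter> Y) ` \<S>)"
proof (rule topology_eq[THEN iffD2], intro allI iffI)
  fix U
  show "openin (topology_generated_by ((\<lambda>S. S \<inter> Y) ` \<S>)) U"
    if U: "openin (subtopology (topology_generated_by \<S>) Y) U"
  proof -
    obtain V where V: "generate_topology_on \<S> V" "U = V \<inter> Y"
      using U unfolding openin_subtopology openin_topology_generated_by_iff by auto
    have "generate_topology_on ((\<lambda>S. S \<inter> Y) ` \<S>) (V \<inter> Y)"
      using V(1)
    proof induction
      case (Int a b)
      then have "generate_topology_on ((\<lambda>S. S \<inter> Y) ` \<S>) ((a \<inter> Y) \<inter> (b \<inter> Y))"
        using generate_topology_on.Int by blast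
      then show ?case by (simp add: Int_ac)
    next
      case (UN K)
      then have "generate_topology_on ((\<lambda>S. S \<inter> Y) ` \<S>) (\<Union>((\<lambda>S. S \<inter> Y) ` K))"
        by (intro generate_topology_on.UN) auto
      then show ?case by simp
    qed (auto intro: generate_topology_on.intros)
    then show ?thesis using V(2) by (simp add: openin_topology_generated_by_iff)
  qed
  show "openin (subtopology (topology_generated_by \<S>) Y) U"
    if "openin (topology_generated_by ((\<lambda>S. S \<inter> Y) ` \<S>)) U"
  proof (rule generate_topology_on_coarsest)
    show "istopology (openin (subtopology (topology_generated_by \<S>) Y))" by simp
    show "openin (subtopology (topology_generated_by \<S>) Y) S" if "S \<in> (\<lambda>S. S \<inter> Y) ` \<S>" for S
      using that by (auto simp: openin_subtopology intro: topology_generated_by_Basis)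
    show "generate_topology_on ((\<lambda>S. S \<inter> Y) ` \<S>) U"
      using that by (rule openin_topology_generated_by)
  qed
qed

context alg_frame begin

lemma primeD:
  assumes "p \<in> \<PP>"
  shows "p \<in> carrier L" "p \<noteq> \<top>"
    "\<And>a b. a \<in> carrier L \<Longrightarrow> b \<in> carrier L \<Longrightarrow> a \<sqinter> b \<sqsubseteq> p \<Longrightarrow> a \<sqsubseteq> p \<or> b \<sqsubseteq> p"
  using assms by (auto simp: prime_elements_def)

lemma not_top_le: "x \<in> carrier L \<Longrightarrow> x \<noteq> \<top> \<Longrightarrow> \<not> \<top> \<sqsubseteq> x"
  using le_antisym[of x \<top>] by auto

lemma inf_insert_eq: "a \<in> carrier L \<Longrightarrow> A \<subseteq> carrier L \<Longrightarrow> \<Sqinter>(insert a A) = a \<sqinter> \<Sqinter>A"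
  using weak_inf_insert by (simp add: eq_is_equal)

lemma inf_empty_eq: "\<Sqinter>{} = \<top>"
  using weak_inf_empty by (simp add: eq_is_equal)

lemma prime_finite_meet:
  assumes p: "p \<in> \<PP>" and "finite A" "A \<subseteq> carrier L" "\<Sqinter>A \<sqsubseteq> p"
  shows "\<exists>a\<in>A. a \<sqsubseteq> p"
  using assms(2-4)
proof (induction A)
  case empty
  then show ?case using not_top_le primeD[OF p] by (simp add: inf_empty_eq)
next
  case (insert a A)
  then have "a \<sqinter> \<Sqinter>A \<sqsubseteq> p" using inf_insert_eq by simp
  then have "a \<sqsubseteq> p \<or> \<Sqinter>A \<sqsubseteq> p" using primeD(3)[OF p] insert.prems by simp
  then show ?case using insert by auto
qed

text \<open>Primes are abundant: Zorn's lemma yields an element maximal among those above \<open>a\<close> and above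
  no member of the down-directed set \<open>I\<close> of compact elements; it is prime by distributivity. With
  \<open>I\<close> a singleton this gives enough primes; in the frame of filters of the distributive envelope, with
  \<open>I\<close> the principal filters generated by the members of an ideal, it is the prime filter theorem.\<close>

lemma prime_above:
  assumes a: "a \<in> carrier L" and I: "I \<subseteq> \<KK>" "I \<noteq> {}"
    and nle: "\<And>c. c \<in> I \<Longrightarrow> \<not> c \<sqsubseteq> a"
    and dir: "\<And>c d. c \<in> I \<Longrightarrow> d \<in> I \<Longrightarrow> \<exists>e\<in>I. e \<sqsubseteq> c \<and> e \<sqsubseteq> d"
  shows "\<exists>q\<in>\<PP>. a \<sqsubseteq> q \<and> (\<forall>c\<in>I. \<not> c \<sqsubseteq> q)"
proof -
  let ?A = "{x \<in> carrier L. \<forall>c\<in>I. \<not> c \<sqsubseteq> x}"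
  have Ic: "c \<in> carrier L" if "c \<in> I" for c using that I compact_closed by blast
  have "\<exists>q\<in>?A. a \<sqsubseteq> q \<and> (\<forall>x\<in>?A. q \<sqsubseteq> x \<longrightarrow> x = q)"
  proof (rule maximal_above)
    show "a \<in> ?A" using a nle by auto
    fix C assume C: "C \<subseteq> ?A" "C \<noteq> {}" and chain: "\<And>x y. x \<in> C \<Longrightarrow> y \<in> C \<Longrightarrow> x \<sqsubseteq> y \<or> y \<sqsubseteq> x"
    have Cc: "C \<subseteq> carrier L" using C by blast
    have "\<not> c \<sqsubseteq> \<Squnion>C" if c: "c \<in> I" for c
    proof
      assume "c \<sqsubseteq> \<Squnion>C"
      then obtain T where T: "finite T" "T \<subseteq> C" "c \<sqsubseteq> \<Squnion>T"
        using compact_finite_sup[of c C] c I Cc by blast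
      have "\<exists>z\<in>C. \<forall>x\<in>T. x \<sqsubseteq> z"
      proof (rule finite_directed_bound[OF T(1,2) C(2)])
        show "\<exists>z\<in>C. x \<sqsubseteq> z \<and> y \<sqsubseteq> z" if "x \<in> C" "y \<in> C" for x y
          using chain[OF that] that Cc by (metis le_refl subsetD)
        show "x \<sqsubseteq> z" if "x \<in> C" "y \<in> C" "z \<in> C" "x \<sqsubseteq> y" "y \<sqsubseteq> z" for x y z
          using le_trans[OF that(4,5)] that Cc by auto
      qed
      then obtain z where z: "z \<in> C" "\<And>x. x \<in> T \<Longrightarrow> x \<sqsubseteq> z" by blast
      have zc: "z \<in> carrier L" and Tc: "T \<subseteq> carrier L" using z T Cc by auto
      have "\<Squnion>T \<sqsubseteq> z" using sup_least[OF Tc zc] z by simp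
      then have "c \<sqsubseteq> z" using le_trans[OF T(3) _ Ic[OF c] sup_closed[OF Tc] zc] by simp
      then show False using z C c by blast
    qed
    then show "\<exists>u\<in>?A. \<forall>x\<in>C. x \<sqsubseteq> u" using sup_upper[OF Cc] Cc by (intro bexI[of _ "\<Squnion>C"]) auto
  qed auto
  then obtain q where qA: "q \<in> ?A" and aq: "a \<sqsubseteq> q" and max: "\<And>x. x \<in> ?A \<Longrightarrow> q \<sqsubseteq> x \<Longrightarrow> x = q"
    by blast
  have q: "q \<in> carrier L" and nq: "\<And>c. c \<in> I \<Longrightarrow> \<not> c \<sqsubseteq> q" using qA by auto
  have below_join: "\<exists>c\<in>I. c \<sqsubseteq> q \<squnion> x" if x: "x \<in> carrier L" "\<not> x \<sqsubseteq> q" for x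
  proof (rule ccontr)
    assume "\<not> ?thesis"
    then have "q \<squnion> x \<in> ?A" using q x by auto
    then have "q \<squnion> x = q" using max join_left[OF q x(1)] by blast
    then show False using join_right[OF q x(1)] x by simp
  qed
  have "x \<sqsubseteq> q \<or> y \<sqsubseteq> q" if xy: "x \<in> carrier L" "y \<in> carrier L" "x \<sqinter> y \<sqsubseteq> q" for x y
  proof (rule ccontr)
    assume "\<not> ?thesis"
    then obtain c d where cd: "c \<in> I" "d \<in> I" "c \<sqsubseteq> q \<squnion> x" "d \<sqsubseteq> q \<squnion> y"
      using below_join xy by blast
    obtain e where e: "e \<in> I" "e \<sqsubseteq> c" "e \<sqsubseteq> d" using dir cd by blast
    have "e \<sqsubseteq> q \<squnion> x" "e \<sqsubseteq> q \<squnion> y"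
      using le_trans[OF e(2) cd(3)] le_trans[OF e(3) cd(4)] Ic cd e q xy by auto
    then have 1: "e \<sqsubseteq> (q \<squnion> x) \<sqinter> (q \<squnion> y)" using Ic e q xy by (intro meet_le) auto
    have "(q \<squnion> x) \<sqinter> (q \<squnion> y) = ((q \<squnion> x) \<sqinter> q) \<squnion> ((q \<squnion> x) \<sqinter> y)"
      using meet_join_distrib[of "q \<squnion> x" q y] q xy by simp
    also have "(q \<squnion> x) \<sqinter> y = (y \<sqinter> q) \<squnion> (x \<sqinter> y)"
      using meet_join_distrib[of y q x] q xy by (simp add: meet_comm)
    finally have 2: "(q \<squnion> x) \<sqinter> (q \<squnion> y) = ((q \<squnion> x) \<sqinter> q) \<squnion> ((y \<sqinter> q) \<squnion> (x \<sqinter> y))" .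
    have "((q \<squnion> x) \<sqinter> q) \<squnion> ((y \<sqinter> q) \<squnion> (x \<sqinter> y)) \<sqsubseteq> q"
      using q xy by (intro join_le) (auto intro: meet_right)
    then have "e \<sqsubseteq> q" using le_trans[OF 1] 2 q xy Ic[OF e(1)] by simp
    then show False using nq e by blast
  qed
  moreover have "q \<noteq> \<top>"
  proof -
    obtain c where "c \<in> I" using I by blast
    then show ?thesis using nq[of c] Ic[of c] by auto
  qed
  ultimately have "q \<in> \<PP>" using q by (simp add: prime_elements_def)
  then show ?thesis using aq nq by blast
qed

lemma prime_separation:
  assumes a: "a \<in> carrier L" and c: "c \<in> \<KK>" "\<not> c \<sqsubseteq> a"
  obtains q where "q \<in> \<PP>" "a \<sqsubseteq> q" "\<not> c \<sqsubseteq> q"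
  using prime_above[OF a, of "{c}"] c compact_closed[OF c(1)] by auto

text \<open>The contrapositive of separation by primes: every element is the meet of the primes above it.\<close>

lemma enough_primes:
  assumes x: "x \<in> carrier L" and y: "y \<in> carrier L"
    and p: "\<And>p. p \<in> \<PP> \<Longrightarrow> y \<sqsubseteq> p \<Longrightarrow> x \<sqsubseteq> p"
  shows "x \<sqsubseteq> y"
proof (rule ccontr)
  assume "\<not> x \<sqsubseteq> y"
  then obtain k where k: "k \<in> \<KK>" "k \<sqsubseteq> x" "\<not> k \<sqsubseteq> y" using compact_witness x y by metis
  obtain q where q: "q \<in> \<PP>" "y \<sqsubseteq> q" "\<not> k \<sqsubseteq> q" using prime_separation[OF y k(1,3)] .
  have "k \<sqsubseteq> q" using le_trans[OF k(2) p[OF q(1,2)]] compact_closed[OF k(1)] x primeD(1)[OF q(1)] by simp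
  then show False using q by simp
qed

lemma top_in_pp_points: "\<top> \<in> pp_points L"
  by (simp add: pp_points_def)

lemma pp_points_closed: "pp_points L \<subseteq> carrier L"
  by (auto simp: pp_points_def pseudoprime_elements_def)

text \<open>Because the relation \<open>way_below L a p\<close> is witnessed by a compact element between the two, membership in
  \<open>pp_points L\<close> is a conjunction of conditions on the compact elements below \<open>p\<close>, each of them clopen.\<close>

lemma pp_points_iff:
  "p \<in> pp_points L \<longleftrightarrow> p \<in> carrier L \<and>
    (\<forall>A l. finite A \<and> A \<noteq> {} \<and> A \<subseteq> \<KK> \<and> l \<in> \<KK> \<and>
       \<Sqinter>A \<sqsubseteq> l \<and> l \<sqsubseteq> p \<longrightarrow> (\<exists>k\<in>A. k \<sqsubseteq> p))" (is "_ \<longleftrightarrow> _ \<and> ?R")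
proof
  assume P: "p \<in> pp_points L"
  then have pc: "p \<in> carrier L" using pp_points_closed by blast
  have "\<exists>k\<in>A. k \<sqsubseteq> p" if A: "finite A" "A \<noteq> {}" "A \<subseteq> \<KK>" "l \<in> \<KK>"
    "\<Sqinter>A \<sqsubseteq> l" "l \<sqsubseteq> p" for A l
  proof (cases "p = \<top>")
    case True
    then show ?thesis using A compact_closed by (metis all_not_in_conv subsetD top_higher)
  next
    case False
    then have pp: "p \<in> pseudoprime_elements L" using P by (simp add: pp_points_def)
    have Ac: "A \<subseteq> carrier L" using A compact_subset by blast
    have "way_below L (\<Sqinter>A) p" using way_below_iff[of "\<Sqinter>A" p] A Ac pc by auto
    then show ?thesis using pp A Ac unfolding pseudoprime_elements_def by blast
  qed
  then show "p \<in> carrier L \<and> ?R" using pc by blast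
next
  assume R: "p \<in> carrier L \<and> ?R"
  then have pc: "p \<in> carrier L" by simp
  have "\<exists>a\<in>A. a \<sqsubseteq> p" if A: "finite A" "A \<noteq> {}" "A \<subseteq> carrier L" "way_below L (\<Sqinter>A) p" for A
  proof (rule ccontr)
    assume "\<not> ?thesis"
    then have "\<exists>k\<in>\<KK>. k \<sqsubseteq> a \<and> \<not> k \<sqsubseteq> p" if "a \<in> A" for a
      using compact_witness[of a p] that A pc by blast
    then obtain f where f: "\<And>a. a \<in> A \<Longrightarrow> f a \<in> \<KK> \<and> f a \<sqsubseteq> a \<and> \<not> f a \<sqsubseteq> p" by metis
    have fc: "f ` A \<subseteq> \<KK>" using f by blast
    then have fcc: "f ` A \<subseteq> carrier L" using compact_subset by blast
    obtain l where l: "l \<in> \<KK>" "\<Sqinter>A \<sqsubseteq> l" "l \<sqsubseteq> p"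
      using A way_below_iff[of "\<Sqinter>A" p] pc by auto
    have "\<Sqinter>(f ` A) \<sqsubseteq> \<Sqinter>A"
    proof (rule inf_greatest[OF A(3) inf_closed[OF fcc]])
      show "\<Sqinter>(f ` A) \<sqsubseteq> a" if "a \<in> A" for a
        using le_trans[OF inf_lower[OF fcc, of "f a"], of a] f[OF that] fcc that A(3) by auto
    qed
    then have "\<Sqinter>(f ` A) \<sqsubseteq> l"
      using le_trans[OF _ l(2)] fcc A(3) compact_closed[OF l(1)] by auto
    moreover have "finite (f ` A)" "f ` A \<noteq> {}" using A by auto
    ultimately have "\<exists>k\<in>f ` A. k \<sqsubseteq> p" using R fc l by blast
    then show False using f by blast
  qed
  then show "p \<in> pp_points L" using pc by (auto simp: pp_points_def pseudoprime_elements_def)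
qed

lemma prime_in_pp_points: "p \<in> \<PP> \<Longrightarrow> p \<in> pp_points L"
proof -
  assume p: "p \<in> \<PP>"
  note pc = primeD(1)[OF p]
  have "\<exists>k\<in>A. k \<sqsubseteq> p" if A: "finite A" "A \<subseteq> \<KK>" "l \<in> \<KK>"
    "\<Sqinter>A \<sqsubseteq> l" "l \<sqsubseteq> p" for A l
  proof (rule prime_finite_meet[OF p A(1)])
    have Ac: "A \<subseteq> carrier L" using A compact_subset by blast
    then show "A \<subseteq> carrier L" .
    show "\<Sqinter>A \<sqsubseteq> p" using le_trans[OF A(4,5)] Ac compact_closed[OF A(3)] pc by auto
  qed
  then show ?thesis using pc unfolding pp_points_iff by blast
qed

section \<open>The dual space of an algebraic frame\<close>

lemma up_iff: "x \<in> up L k \<longleftrightarrow> x \<in> carrier L \<and> k \<sqsubseteq> x"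
  by (simp add: up_def)

lemma bottom_compact: "\<Squnion>{} \<in> \<KK>"
  by (rule finite_sup_compact) auto

lemma sup_empty_le: "x \<in> carrier L \<Longrightarrow> \<Squnion>{} \<sqsubseteq> x"
  by (rule sup_least) auto

lemma lambda_topspace: "topspace (lambda_topology L) = carrier L"
proof -
  have "up L (\<Squnion>{}) = carrier L" using sup_empty_le by (auto simp: up_def)
  then have "carrier L \<in> up L ` \<KK>" using bottom_compact by blast
  then show ?thesis by (auto simp: lambda_topology_def up_def)
qed

lemma up_open: "k \<in> \<KK> \<Longrightarrow> openin (lambda_topology L) (up L k)"
  unfolding lambda_topology_def by (rule topology_generated_by_Basis) blast

lemma up_closed: "k \<in> \<KK> \<Longrightarrow> closedin (lambda_topology L) (up L k)"
proof -
  assume "k \<in> \<KK>"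
  then have "openin (lambda_topology L) (carrier L - up L k)"
    unfolding lambda_topology_def by (intro topology_generated_by_Basis) blast
  moreover have "up L k \<subseteq> carrier L" by (auto simp: up_def)
  ultimately show ?thesis by (simp add: closedin_def lambda_topspace)
qed

text \<open>Given a cover by subbasic sets, let \<open>p\<close> be the join of the \<open>l\<close> for which the complement of
  \<open>up L l\<close> occurs. Only some \<open>up L k\<close> in the cover can contain \<open>p\<close>, and by compactness of \<open>k\<close> it
  forms a finite subcover together with finitely many of the complements.\<close>

lemma lambda_compact: "compact_space (lambda_topology L)"
proof (rule Alexander_subbase)
  let ?B = "up L ` \<KK> \<union> (\<lambda>l. carrier L - up L l) ` \<KK>"
  show "topology (arbitrary union_of (finite intersection_of (\<lambda>x. x \<in> ?B) relative_to \<Union>?B))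
      = lambda_topology L"
    unfolding lambda_topology_def topology_generated_by_eq_subbase ..
  fix C assume C: "C \<subseteq> ?B" "\<Union>C = topspace (lambda_topology L)"
  let ?S = "{l \<in> \<KK>. carrier L - up L l \<in> C}"
  have Sc: "?S \<subseteq> carrier L" using compact_closed by blast
  have "\<Squnion>?S \<in> \<Union>C" using C(2) Sc by (simp add: lambda_topspace)
  then obtain U where U: "U \<in> C" "\<Squnion>?S \<in> U" by blast
  have "U \<notin> (\<lambda>l. carrier L - up L l) ` \<KK>"
  proof
    assume "U \<in> (\<lambda>l. carrier L - up L l) ` \<KK>"
    then obtain l where l: "l \<in> \<KK>" "U = carrier L - up L l" by blast
    then have "l \<sqsubseteq> \<Squnion>?S" using sup_upper[OF Sc] U by blast
    then show False using U l Sc by (simp add: up_iff)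
  qed
  then obtain k where k: "k \<in> \<KK>" "U = up L k" using U C by blast
  then obtain T where T: "finite T" "T \<subseteq> ?S" "k \<sqsubseteq> \<Squnion>T"
    using compact_finite_sup[OF k(1) Sc] U by (auto simp: up_iff)
  have Tc: "T \<subseteq> carrier L" using T Sc by blast
  let ?C = "insert U ((\<lambda>l. carrier L - up L l) ` T)"
  have "x \<in> \<Union>?C" if x: "x \<in> carrier L" for x
  proof (cases "\<forall>l\<in>T. l \<sqsubseteq> x")
    case True
    then have "\<Squnion>T \<sqsubseteq> x" by (intro sup_least[OF Tc x]) auto
    then have "k \<sqsubseteq> x" using le_trans[OF T(3)] compact_closed[OF k(1)] Tc x by simp
    then show ?thesis using k x by (simp add: up_iff)
  qed (use x in \<open>auto simp: up_iff\<close>)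
  moreover have "finite ?C" "?C \<subseteq> C" using T U by auto
  moreover have "\<Union>?C \<subseteq> topspace (lambda_topology L)" using C \<open>?C \<subseteq> C\<close> by blast
  moreover have "topspace (lambda_topology L) \<subseteq> \<Union>?C" using calculation(1) lambda_topspace by blast
  ultimately show "\<exists>C'. finite C' \<and> C' \<subseteq> C \<and> \<Union>C' = topspace (lambda_topology L)"
    by (metis subset_antisym)
qed

lemma pp_points_closedin: "closedin (lambda_topology L) (pp_points L)"
proof -
  define \<Z> where "\<Z> = {(carrier L - up L l) \<union> \<Union>(up L ` A) | A l. finite A \<and> A \<noteq> {} \<and>
    A \<subseteq> \<KK> \<and> l \<in> \<KK> \<and> \<Sqinter>A \<sqsubseteq> l}"
  have "pp_points L = \<Inter>(insert (carrier L) \<Z>)"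
  proof
    show "pp_points L \<subseteq> \<Inter>(insert (carrier L) \<Z>)"
    proof
      fix p assume p: "p \<in> pp_points L"
      then have pc: "p \<in> carrier L" using pp_points_closed by blast
      have "p \<in> (carrier L - up L l) \<union> \<Union>(up L ` A)"
        if "finite A" "A \<noteq> {}" "A \<subseteq> \<KK>" "l \<in> \<KK>" "\<Sqinter>A \<sqsubseteq> l" for A l
      proof (cases "l \<sqsubseteq> p")
        case True
        then have "\<exists>k\<in>A. k \<sqsubseteq> p" using pp_points_iff[of p] p that by blast
        then obtain k where "k \<in> A" "k \<sqsubseteq> p" by blast
        then show ?thesis using pc up_iff by blast
      qed (use pc in \<open>simp add: up_iff\<close>)
      then have "\<forall>Z\<in>\<Z>. p \<in> Z" unfolding \<Z>_def by blast
      then show "p \<in> \<Inter>(insert (carrier L) \<Z>)" using pc by blast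
    qed
    show "\<Inter>(insert (carrier L) \<Z>) \<subseteq> pp_points L"
    proof
      fix p assume p: "p \<in> \<Inter>(insert (carrier L) \<Z>)"
      have "\<exists>k\<in>A. k \<sqsubseteq> p" if A: "finite A" "A \<noteq> {}" "A \<subseteq> \<KK>" "l \<in> \<KK>"
        "\<Sqinter>A \<sqsubseteq> l" "l \<sqsubseteq> p" for A l
      proof -
        have "(carrier L - up L l) \<union> \<Union>(up L ` A) \<in> \<Z>" unfolding \<Z>_def using A by blast
        then have "p \<in> (carrier L - up L l) \<union> \<Union>(up L ` A)" using p by blast
        then show ?thesis using A p by (auto simp: up_iff)
      qed
      then show "p \<in> pp_points L" unfolding pp_points_iff using p by blast
    qed
  qed
  moreover have "closedin (lambda_topology L) Z" if Z_in: "Z \<in> insert (carrier L) \<Z>" for Z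
  proof (cases "Z = carrier L")
    case True
    then show ?thesis using closedin_topspace[of "lambda_topology L"] by (simp add: lambda_topspace)
  next
    case False
    then obtain A l where A: "finite A" "A \<subseteq> \<KK>" "l \<in> \<KK>"
      and Z: "Z = (carrier L - up L l) \<union> \<Union>(up L ` A)"
      using Z_in unfolding \<Z>_def by blast
    have "closedin (lambda_topology L) (carrier L - up L l)"
      using closedin_diff[OF closedin_topspace up_open[OF A(3)]] by (simp add: lambda_topspace)
    moreover have "closedin (lambda_topology L) (\<Union>(up L ` A))"
      by (rule closedin_Union) (use A up_closed in auto)
    ultimately show ?thesis unfolding Z by blast
  qed
  ultimately show ?thesis by (metis closedin_Inter insert_not_empty)
qed

text \<open>A finite intersection of subbasic sets has this form, since compact elements are closed under
  finite joins.\<close>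

definition lambda_basic :: "'a \<Rightarrow> 'a set \<Rightarrow> 'a set" where
  "lambda_basic k B = {x \<in> carrier L. k \<sqsubseteq> x \<and> (\<forall>l\<in>B. \<not> l \<sqsubseteq> x)}"

lemma lambda_base:
  assumes "generate_topology_on
      (up L ` \<KK> \<union> (\<lambda>l. carrier L - up L l) ` \<KK>) U" "p \<in> U"
  shows "\<exists>k\<in>\<KK>. \<exists>B. finite B \<and> B \<subseteq> \<KK> \<and>
    p \<in> lambda_basic k B \<and> lambda_basic k B \<subseteq> U"
  using assms
proof (induction arbitrary: p)
  case (Int a b)
  from Int.IH(1)[of p] Int.prems obtain k B where 1: "k \<in> \<KK>" "finite B"
    "B \<subseteq> \<KK>" "p \<in> lambda_basic k B" "lambda_basic k B \<subseteq> a" by blast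
  from Int.IH(2)[of p] Int.prems obtain k' B' where 2: "k' \<in> \<KK>" "finite B'"
    "B' \<subseteq> \<KK>" "p \<in> lambda_basic k' B'" "lambda_basic k' B' \<subseteq> b" by blast
  have c: "k \<in> carrier L" "k' \<in> carrier L" using 1 2 compact_closed by auto
  have "k \<squnion> k' \<sqsubseteq> x \<longleftrightarrow> k \<sqsubseteq> x \<and> k' \<sqsubseteq> x" if x: "x \<in> carrier L" for x
  proof
    assume le: "k \<squnion> k' \<sqsubseteq> x"
    show "k \<sqsubseteq> x \<and> k' \<sqsubseteq> x"
      using le_trans[OF join_left[OF c] le] le_trans[OF join_right[OF c] le] c x by simp
  qed (use c x join_le in simp)
  then have "lambda_basic (k \<squnion> k') (B \<union> B') = lambda_basic k B \<inter> lambda_basic k' B'"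
    unfolding lambda_basic_def by auto
  then show ?case
    using 1 2 compact_join_closed[of k k']
    by (intro bexI[of _ "k \<squnion> k'"] exI[of _ "B \<union> B'"]) auto
next
  case (UN K)
  then obtain U where U: "U \<in> K" "p \<in> U" by blast
  from UN.IH[OF this] obtain k B where "k \<in> \<KK>" "finite B"
    "B \<subseteq> \<KK>" "p \<in> lambda_basic k B" "lambda_basic k B \<subseteq> \<Union>K"
    using U(1) by blast
  then show ?case by blast
next
  case (Basis s)
  then consider k where "k \<in> \<KK>" "s = up L k"
    | l where "l \<in> \<KK>" "s = carrier L - up L l" by blast
  then show ?case
  proof cases
    case 1
    then have "lambda_basic k {} = s" by (auto simp: lambda_basic_def up_iff)
    then show ?thesis using Basis 1 by blast
  next
    case 2
    then have "lambda_basic (\<Squnion>{}) {l} = s" using sup_empty_le by (auto simp: lambda_basic_def up_iff)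
    then show ?thesis using Basis 2 bottom_compact by blast
  qed
qed simp

lemma pp_space_simps [simp]:
  "carrier (\<YY>) = pp_points L" "le (\<YY>) = le L" "eq (\<YY>) = (=)"
  "dense_part (\<YY>) = \<PP>" "max_point (\<YY>) = \<top>"
  "topol (\<YY>) = subtopology (lambda_topology L) (pp_points L)"
  by (simp_all add: pp_space_def)

lemma pp_partial_order: "partial_order (\<YY>)"
proof unfold_locales
  show "x \<sqsubseteq>\<^bsub>\<YY>\<^esub> x" if "x \<in> carrier (\<YY>)" for x
    using that pp_points_closed by auto
  show "x .=\<^bsub>\<YY>\<^esub> y" if "x \<sqsubseteq>\<^bsub>\<YY>\<^esub> y" "y \<sqsubseteq>\<^bsub>\<YY>\<^esub> x"
    "x \<in> carrier (\<YY>)" "y \<in> carrier (\<YY>)" for x y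
    using that le_antisym[of x y] pp_points_closed by auto
  show "x \<sqsubseteq>\<^bsub>\<YY>\<^esub> z" if "x \<sqsubseteq>\<^bsub>\<YY>\<^esub> y" "y \<sqsubseteq>\<^bsub>\<YY>\<^esub> z"
    "x \<in> carrier (\<YY>)" "y \<in> carrier (\<YY>)" "z \<in> carrier (\<YY>)" for x y z
    using that le_trans[of x y z] pp_points_closed by auto
qed auto

lemma pp_topspace: "topspace (topol (\<YY>)) = pp_points L"
  using pp_points_closed by (auto simp: lambda_topspace)

definition pp_up :: "'a \<Rightarrow> 'a set" where
  "pp_up k = {x \<in> pp_points L. k \<sqsubseteq> x}"

lemma pp_up_eq: "pp_up k = pp_points L \<inter> up L k"
  using pp_points_closed by (auto simp: pp_up_def up_iff)

lemma pp_up_clopen_upset: "k \<in> \<KK> \<Longrightarrow> clopen_upset (\<YY>) (pp_up k)"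
proof -
  assume k: "k \<in> \<KK>"
  have "openin (topol (\<YY>)) (pp_up k)" "closedin (topol (\<YY>)) (pp_up k)"
    unfolding pp_up_eq
    using openin_subtopology_Int2[OF up_open[OF k]] closedin_subtopology_Int_closed[OF up_closed[OF k]]
    by simp_all
  moreover have "k \<sqsubseteq> y" if "k \<sqsubseteq> x" "x \<sqsubseteq> y" "x \<in> pp_points L" "y \<in> pp_points L" for x y
    using le_trans[OF that(1,2)] compact_closed[OF k] that pp_points_closed by blast
  then have "upset (\<YY>) (pp_up k)" by (auto simp: upset_def pp_up_def)
  ultimately show ?thesis by (simp add: clopen_upset_def)
qed

lemma pp_priestley: "priestley_poset (\<YY>)"
  unfolding priestley_poset_iff[symmetric] priestley_space_def
proof (intro conjI ballI impI pp_partial_order)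
  show "topspace (topol (\<YY>)) = carrier (\<YY>)" using pp_topspace by simp
  show "compact_space (topol (\<YY>))"
    using compact_space_subtopology[OF closedin_compact_space[OF lambda_compact pp_points_closedin]] by simp
  fix x y assume "x \<in> carrier (\<YY>)" "y \<in> carrier (\<YY>)" "\<not> x \<sqsubseteq>\<^bsub>\<YY>\<^esub> y"
  then have xy: "x \<in> pp_points L" "y \<in> pp_points L" "\<not> x \<sqsubseteq> y" by auto
  then obtain k where "k \<in> \<KK>" "k \<sqsubseteq> x" "\<not> k \<sqsubseteq> y"
    using compact_witness[of x y] pp_points_closed by auto
  then show "\<exists>U. clopen_upset (\<YY>) U \<and> x \<in> U \<and> y \<notin> U"
    using pp_up_clopen_upset xy by (intro exI[of _ "pp_up k"]) (auto simp: pp_up_def)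
qed

text \<open>The set \<open>pp_up a\<close> is the intersection of the clopen sets \<open>pp_up k\<close> with \<open>k\<close> compact below \<open>a\<close>, so
  compactness of the dual space applies.\<close>

lemma compact_below_in_open:
  assumes a: "a \<in> carrier L" and W: "openin (topol (\<YY>)) W" and sub: "pp_up a \<subseteq> W"
  shows "\<exists>k\<in>\<KK>. k \<sqsubseteq> a \<and> pp_up k \<subseteq> W"
proof -
  interpret X: priestley_poset "\<YY>" by (rule pp_priestley)
  let ?K = "{k \<in> \<KK>. k \<sqsubseteq> a}"
  have sub': "topspace (topol (\<YY>)) \<inter> \<Inter>(pp_up ` ?K) \<subseteq> W"
  proof
    fix x assume x: "x \<in> topspace (topol (\<YY>)) \<inter> \<Inter>(pp_up ` ?K)"
    then have xp: "x \<in> pp_points L" using pp_topspace by blast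
    moreover have "a \<sqsubseteq> x"
      using x xp pp_points_closed by (subst le_iff_compacts[OF a]) (auto simp: pp_up_def)
    ultimately show "x \<in> W" using sub by (auto simp: pp_up_def)
  qed
  have cl: "closedin (topol (\<YY>)) U" if "U \<in> pp_up ` ?K" for U
    using that pp_up_clopen_upset by (auto simp: clopen_upset_def)
  obtain \<F> where F: "finite \<F>" "\<F> \<subseteq> pp_up ` ?K" "topspace (topol (\<YY>)) \<inter> \<Inter>\<F> \<subseteq> W"
    using compact_space_closed_family[OF X.compact W cl sub'] by blast
  obtain T where T: "finite T" "T \<subseteq> ?K" "\<F> = pp_up ` T" using finite_subset_image[OF F(1,2)] by auto
  have Tc: "T \<subseteq> carrier L" using T compact_closed by blast
  have "pp_up (\<Squnion>T) \<subseteq> W"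
  proof
    fix x assume x: "x \<in> pp_up (\<Squnion>T)"
    then have xp: "x \<in> pp_points L" "x \<in> carrier L" "\<Squnion>T \<sqsubseteq> x" using pp_points_closed by (auto simp: pp_up_def)
    have "t \<sqsubseteq> x" if "t \<in> T" for t
      using le_trans[OF sup_upper[OF Tc that] xp(3)] Tc that xp by auto
    then show "x \<in> W" using F(3) T(3) xp(1) pp_topspace by (auto simp: pp_up_def)
  qed
  moreover have "\<Squnion>T \<in> \<KK>" using finite_sup_compact T by blast
  moreover have "\<Squnion>T \<sqsubseteq> a" using sup_least[OF Tc a] T by auto
  ultimately show ?thesis by blast
qed

lemma pp_up_admissible: "k \<in> \<KK> \<Longrightarrow> pp_up k \<in> admissible_clopens (\<YY>)"
proof -
  assume k: "k \<in> \<KK>"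
  have "x \<in> \<PP>" if x: "x \<in> maximal_points (\<YY>) (pp_points L - pp_up k)" for x
  proof -
    have xp: "x \<in> pp_points L" "\<not> k \<sqsubseteq> x" using x by (auto simp: maximal_points_def pp_up_def)
    then obtain q where q: "q \<in> \<PP>" "x \<sqsubseteq> q" "\<not> k \<sqsubseteq> q"
      using prime_separation[OF _ k, of x] pp_points_closed by blast
    then have "q = x" using x prime_in_pp_points by (auto simp: maximal_points_def pp_up_def)
    then show ?thesis using q by simp
  qed
  then show ?thesis using pp_up_clopen_upset[OF k] by (auto simp: admissible_clopens_def)
qed

text \<open>Conversely, an admissible clopen upset \<open>U\<close> is a finite union of basic upsets, and the meet \<open>a\<close>
  of their generators satisfies \<open>U = pp_up a\<close>: on primes this is primality, and the remaining points
  reduce to primes because the maximal points outside \<open>U\<close> are prime. Finally \<open>a\<close> is compact since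
  \<open>U\<close> is open.\<close>

lemma admissible_is_pp_up:
  assumes U: "U \<in> admissible_clopens (\<YY>)"
  shows "\<exists>k\<in>\<KK>. U = pp_up k"
proof -
  interpret X: priestley_poset "\<YY>" by (rule pp_priestley)
  have cl: "clopen_upset (\<YY>) U"
    and max: "maximal_points (\<YY>) (pp_points L - U) \<subseteq> \<PP>"
    using U by (auto simp: admissible_clopens_def)
  note clD = X.clopen_upsetD[OF cl, simplified]
  have o: "openin (topol (\<YY>)) U" and c: "closedin (topol (\<YY>)) U"
    using cl by (auto simp: clopen_upset_def)
  have cc: "closedin (topol (\<YY>)) (pp_points L - U)"
    using closedin_diff[OF closedin_topspace o] pp_topspace by simp
  have prime_out: "\<exists>q\<in>\<PP>. q \<notin> U \<and> y \<sqsubseteq> q" if y: "y \<in> pp_points L" "y \<notin> U" for y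
  proof -
    obtain q where "q \<in> maximal_points (\<YY>) (pp_points L - U)" "y \<sqsubseteq> q"
      using X.maximal_point_above[OF cc, of y] y by auto
    then show ?thesis using max by (auto simp: maximal_points_def)
  qed
  have topU: "\<top> \<in> U"
  proof (rule ccontr)
    assume "\<top> \<notin> U"
    then obtain q where "q \<in> \<PP>" "\<top> \<sqsubseteq> q" using prime_out top_in_pp_points by blast
    then show False using primeD not_top_le by blast
  qed
  have "\<exists>k\<in>\<KK>. k \<sqsubseteq> u \<and> pp_up k \<subseteq> U" if u: "u \<in> U" for u
  proof (rule compact_below_in_open[OF _ o])
    show "u \<in> carrier L" using u clD(3) pp_points_closed by blast
    show "pp_up u \<subseteq> U" using clD(4)[OF u] by (auto simp: pp_up_def)
  qed
  then obtain f where f: "\<And>u. u \<in> U \<Longrightarrow> f u \<in> \<KK> \<and> f u \<sqsubseteq> u \<and> pp_up (f u) \<subseteq> U" by metis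
  have "compactin (topol (\<YY>)) U" using closedin_compact_space[OF X.compact c] .
  moreover have "openin (topol (\<YY>)) V" if "V \<in> (\<lambda>u. pp_up (f u)) ` U" for V
    using that f pp_up_clopen_upset by (auto simp: clopen_upset_def)
  moreover have "U \<subseteq> \<Union>((\<lambda>u. pp_up (f u)) ` U)" using f clD(3) by (force simp: pp_up_def)
  ultimately obtain \<V> where V: "finite \<V>" "\<V> \<subseteq> (\<lambda>u. pp_up (f u)) ` U" "U \<subseteq> \<Union>\<V>"
    unfolding compactin_def by meson
  obtain D where D: "finite D" "D \<subseteq> U" "\<V> = (\<lambda>u. pp_up (f u)) ` D"
    using finite_subset_image[OF V(1,2)] by auto
  let ?F = "f ` D" and ?a = "\<Sqinter>(f ` D)"
  have Fc: "?F \<subseteq> carrier L" using f D compact_closed by blast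
  have ac: "?a \<in> carrier L" using Fc by simp
  have above: "?a \<sqsubseteq> y" if y: "y \<in> U" for y
  proof -
    obtain u where u: "u \<in> D" "y \<in> pp_up (f u)" using V(3) D(3) y by blast
    then have "f u \<sqsubseteq> y" "y \<in> carrier L" using pp_points_closed by (auto simp: pp_up_def)
    then show ?thesis using le_trans[OF inf_lower[OF Fc, of "f u"], of y] u Fc by auto
  qed
  have prime_in: "p \<in> U" if p: "p \<in> \<PP>" "?a \<sqsubseteq> p" for p
  proof -
    obtain u where "u \<in> D" "f u \<sqsubseteq> p" using prime_finite_meet[OF p(1) _ Fc p(2)] D by auto
    then show ?thesis using f[of u] D prime_in_pp_points[OF p(1)] by (auto simp: pp_up_def)
  qed
  have Ua: "U = pp_up ?a"
  proof
    show "U \<subseteq> pp_up ?a" using above clD(3) by (auto simp: pp_up_def)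
    show "pp_up ?a \<subseteq> U"
    proof (rule ccontr)
      assume "\<not> pp_up ?a \<subseteq> U"
      then obtain y where y: "y \<in> pp_points L" "?a \<sqsubseteq> y" "y \<notin> U" by (auto simp: pp_up_def)
      then obtain q where q: "q \<in> \<PP>" "q \<notin> U" "y \<sqsubseteq> q" using prime_out by blast
      have "?a \<sqsubseteq> q" using le_trans[OF y(2) q(3)] ac y pp_points_closed primeD(1)[OF q(1)] by auto
      then show False using prime_in q by blast
    qed
  qed
  obtain l where l: "l \<in> \<KK>" "l \<sqsubseteq> ?a" "pp_up l \<subseteq> U"
    using compact_below_in_open[OF ac o] Ua by auto
  have "?a \<sqsubseteq> l"
    by (rule enough_primes[OF ac compact_closed[OF l(1)]])
      (use l(3) above prime_in_pp_points in \<open>auto simp: pp_up_def\<close>)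
  then have "?a = l" using le_antisym[OF _ l(2)] ac compact_closed[OF l(1)] by simp
  then show ?thesis using Ua l by blast
qed

lemma pp_admissible_clopens: "admissible_clopens (\<YY>) = pp_up ` \<KK>"
  using pp_up_admissible admissible_is_pp_up by blast

lemma pp_up_subset_iff:
  assumes a: "a \<in> carrier L" and b: "b \<in> carrier L"
  shows "pp_up a \<subseteq> pp_up b \<longleftrightarrow> b \<sqsubseteq> a"
proof
  assume "pp_up a \<subseteq> pp_up b"
  then show "b \<sqsubseteq> a"
    by (intro enough_primes[OF b a]) (use prime_in_pp_points in \<open>auto simp: pp_up_def\<close>)
next
  assume "b \<sqsubseteq> a"
  then show "pp_up a \<subseteq> pp_up b" using le_trans[of b a] a b pp_points_closed by (auto simp: pp_up_def)
qed

text \<open>Density of the primes: a basic neighbourhood of a pseudoprime \<open>p\<close> asks for a point above a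
  compact \<open>k\<close> and above none of finitely many compact elements. Pseudoprimality says exactly that the
  meet of the latter is not below \<open>k\<close>, so a prime with this property exists.\<close>

lemma primes_dense:
  "subtopology (topol (\<YY>)) (pp_points L - {\<top>}) closure_of \<PP> =
    pp_points L - {\<top>}" (is "_ = ?Y")
proof
  let ?T = "subtopology (topol (\<YY>)) ?Y"
  show "?T closure_of \<PP>
      \<subseteq> ?Y"
    using closure_of_subset_topspace[of "?T"] by auto
  show "?Y
      \<subseteq> ?T closure_of \<PP>"
  proof
    fix p assume p: "p \<in> ?Y"
    then have pc: "p \<in> carrier L" using pp_points_closed by blast
    have "\<exists>q. q \<in> \<PP> \<and> q \<in> T"
      if T: "p \<in> T" "openin ?T T" for T
    proof -
      obtain V where V: "openin (lambda_topology L) V" "T = V \<inter> ?Y"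
        using T by (auto simp: openin_subtopology)
      then have "generate_topology_on
          (up L ` \<KK> \<union> (\<lambda>l. carrier L - up L l) ` \<KK>) V" "p \<in> V"
        using T by (simp_all add: lambda_topology_def openin_topology_generated_by_iff)
      then obtain k B where "k \<in> \<KK>" "finite B" "B \<subseteq> \<KK>"
        "p \<in> lambda_basic k B" and sub: "lambda_basic k B \<subseteq> V"
        using lambda_base by metis
      then have k: "k \<in> \<KK>" "k \<sqsubseteq> p" and B: "finite B" "B \<subseteq> \<KK>"
        "\<forall>l\<in>B. \<not> l \<sqsubseteq> p"
        by (auto simp: lambda_basic_def)
      obtain l0 where l0: "l0 \<in> \<KK>" "\<not> l0 \<sqsubseteq> p"
        using compact_witness[of \<top> p] not_top_le[OF pc] p pc by auto
      let ?B = "insert l0 B"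
      have Bc: "?B \<subseteq> carrier L" using B l0 compact_closed by auto
      have nle: "\<not> \<Sqinter>?B \<sqsubseteq> k"
      proof
        assume "\<Sqinter>?B \<sqsubseteq> k"
        moreover have "finite ?B" "?B \<noteq> {}" "?B \<subseteq> \<KK>" using B l0 by auto
        ultimately have "\<exists>l\<in>?B. l \<sqsubseteq> p" using pp_points_iff[of p] p k by blast
        then show False using B l0 by blast
      qed
      then obtain c where c: "c \<in> \<KK>" "c \<sqsubseteq> \<Sqinter>?B" "\<not> c \<sqsubseteq> k"
        using compact_witness[of "\<Sqinter>?B" k] Bc compact_closed[OF k(1)] by auto
      obtain q where q: "q \<in> \<PP>" "k \<sqsubseteq> q" "\<not> c \<sqsubseteq> q"
        using prime_separation[OF compact_closed[OF k(1)] c(1,3)] .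
      have "\<not> l \<sqsubseteq> q" if l: "l \<in> B" for l
      proof
        assume lq: "l \<sqsubseteq> q"
        have lc: "l \<in> carrier L" using l Bc by blast
        have "c \<sqsubseteq> l" using le_trans[OF c(2) inf_lower[OF Bc, of l]] l Bc compact_closed[OF c(1)] lc by simp
        then have "c \<sqsubseteq> q" using le_trans[OF _ lq] compact_closed[OF c(1)] lc primeD(1)[OF q(1)] by simp
        then show False using q by simp
      qed
      then have "q \<in> V" using sub q primeD(1)[OF q(1)] by (auto simp: lambda_basic_def)
      then show ?thesis using q V prime_in_pp_points[OF q(1)] primeD(2)[OF q(1)] by blast
    qed
    moreover have "p \<in> topspace ?T"
      using p pp_topspace by auto
    ultimately show "p \<in> ?T closure_of \<PP>"
      unfolding in_closure_of by blast
  qed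
qed

text \<open>By the description of the admissible clopen upsets, those avoiding \<open>x\<close> correspond, with the order
  reversed, to the compact elements not below \<open>x\<close>. They are directed if and only if these compact
  elements are down-directed, which is primality of \<open>x\<close> expressed on compact elements.\<close>

lemma pp_dense_iff:
  assumes x: "x \<in> pp_points L"
  shows "x \<in> \<PP> \<longleftrightarrow> avoiding (\<YY>) x \<noteq> {} \<and>
     (\<forall>U\<in>avoiding (\<YY>) x. \<forall>V\<in>avoiding (\<YY>) x. \<exists>W\<in>avoiding (\<YY>) x. U \<subseteq> W \<and> V \<subseteq> W)"
    (is "_ \<longleftrightarrow> ?ne \<and> ?dir")
proof -
  have xc: "x \<in> carrier L" using x pp_points_closed by blast
  have av: "avoiding (\<YY>) x = pp_up ` {k \<in> \<KK>. \<not> k \<sqsubseteq> x}"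
    using x unfolding avoiding_def pp_admissible_clopens by (auto simp: pp_up_def)
  have "?ne \<longleftrightarrow> x \<noteq> \<top>"
  proof
    assume ?ne
    then obtain k where "k \<in> \<KK>" "\<not> k \<sqsubseteq> x" using av by blast
    then show "x \<noteq> \<top>" using compact_closed by auto
  next
    assume "x \<noteq> \<top>"
    then obtain k where "k \<in> \<KK>" "\<not> k \<sqsubseteq> x"
      using compact_witness[of \<top> x] not_top_le[OF xc] xc by auto
    then show ?ne using av by blast
  qed
  moreover have "?dir \<longleftrightarrow> (\<forall>a\<in>carrier L. \<forall>b\<in>carrier L. a \<sqinter> b \<sqsubseteq> x \<longrightarrow> a \<sqsubseteq> x \<or> b \<sqsubseteq> x)"
  proof
    assume dir: ?dir
    have False if ab: "a \<in> carrier L" "b \<in> carrier L" "a \<sqinter> b \<sqsubseteq> x" "\<not> a \<sqsubseteq> x" "\<not> b \<sqsubseteq> x" for a b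
    proof -
      obtain k l where k: "k \<in> \<KK>" "k \<sqsubseteq> a" "\<not> k \<sqsubseteq> x"
        and l: "l \<in> \<KK>" "l \<sqsubseteq> b" "\<not> l \<sqsubseteq> x"
        using compact_witness[OF ab(1) xc ab(4)] compact_witness[OF ab(2) xc ab(5)] by blast
      have "pp_up k \<in> avoiding (\<YY>) x" "pp_up l \<in> avoiding (\<YY>) x" using av k l by auto
      then obtain W where W: "W \<in> avoiding (\<YY>) x" "pp_up k \<subseteq> W" "pp_up l \<subseteq> W"
        using dir by blast
      obtain m where m': "m \<in> \<KK>" "\<not> m \<sqsubseteq> x" "W = pp_up m"
        using W(1) unfolding av by auto
      then have m: "m \<in> \<KK>" "\<not> m \<sqsubseteq> x" "pp_up k \<subseteq> pp_up m" "pp_up l \<subseteq> pp_up m"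
        using W by auto
      note kc = compact_closed[OF k(1)] and lc = compact_closed[OF l(1)] and mc = compact_closed[OF m(1)]
      have "m \<sqsubseteq> k" "m \<sqsubseteq> l" using m pp_up_subset_iff kc lc mc by auto
      then have "m \<sqsubseteq> a" "m \<sqsubseteq> b" using le_trans[OF _ k(2)] le_trans[OF _ l(2)] kc lc mc ab by auto
      then have "m \<sqsubseteq> a \<sqinter> b" using mc ab by (intro meet_le) auto
      then have "m \<sqsubseteq> x" using le_trans[OF _ ab(3)] mc ab xc by simp
      then show False using m by simp
    qed
    then show "\<forall>a\<in>carrier L. \<forall>b\<in>carrier L. a \<sqinter> b \<sqsubseteq> x \<longrightarrow> a \<sqsubseteq> x \<or> b \<sqsubseteq> x" by blast
  next
    assume prime: "\<forall>a\<in>carrier L. \<forall>b\<in>carrier L. a \<sqinter> b \<sqsubseteq> x \<longrightarrow> a \<sqsubseteq> x \<or> b \<sqsubseteq> x"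
    have "\<exists>W\<in>avoiding (\<YY>) x. U \<subseteq> W \<and> V \<subseteq> W"
      if UV: "U \<in> avoiding (\<YY>) x" "V \<in> avoiding (\<YY>) x" for U V
    proof -
      obtain k l where k: "k \<in> \<KK>" "\<not> k \<sqsubseteq> x" "U = pp_up k"
        and l: "l \<in> \<KK>" "\<not> l \<sqsubseteq> x" "V = pp_up l"
        using UV av by auto
      note kc = compact_closed[OF k(1)] and lc = compact_closed[OF l(1)]
      have "\<not> k \<sqinter> l \<sqsubseteq> x" using prime kc lc k l by blast
      then obtain m where m: "m \<in> \<KK>" "m \<sqsubseteq> k \<sqinter> l" "\<not> m \<sqsubseteq> x"
        using compact_witness[of "k \<sqinter> l" x] kc lc xc by auto
      have "m \<sqsubseteq> k" "m \<sqsubseteq> l"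
        using le_trans[OF m(2) meet_left] le_trans[OF m(2) meet_right] kc lc compact_closed[OF m(1)] by auto
      then have "U \<subseteq> pp_up m" "V \<subseteq> pp_up m" using pp_up_subset_iff kc lc compact_closed[OF m(1)] k l by auto
      then show ?thesis using av m by blast
    qed
    then show ?dir by blast
  qed
  ultimately show ?thesis using xc by (simp add: prime_elements_def)
qed

lemma pp_space_pgps: "pointed_generalized_priestley_space (\<YY>)"
  unfolding pointed_generalized_priestley_space_def
proof (intro conjI ballI)
  show "priestley_space (\<YY>)" using pp_priestley by (simp add: priestley_poset_iff)
  show "greatest (\<YY>) (max_point (\<YY>)) (carrier (\<YY>))"
    using top_in_pp_points pp_points_closed by (auto simp: greatest_def)
  show "dense_part (\<YY>) \<subseteq> carrier (\<YY>) - {max_point (\<YY>)}"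
    using prime_in_pp_points primeD(2) by auto
  show "subtopology (topol (\<YY>)) (carrier (\<YY>) - {max_point (\<YY>)}) closure_of
      dense_part (\<YY>) = carrier (\<YY>) - {max_point (\<YY>)}"
    using primes_dense by simp
  show "\<exists>y\<in>dense_part (\<YY>). x \<sqsubseteq>\<^bsub>\<YY>\<^esub> y"
    if "x \<in> carrier (\<YY>) - {max_point (\<YY>)}" for x
  proof -
    have x: "x \<in> carrier L" "x \<noteq> \<top>" using that pp_points_closed by auto
    then obtain c where "c \<in> \<KK>" "\<not> c \<sqsubseteq> x"
      using compact_witness[of \<top> x] not_top_le by auto
    then show ?thesis using prime_separation[OF x(1), of c] by auto
  qed
  show "x \<in> dense_part (\<YY>) \<longleftrightarrow> avoiding (\<YY>) x \<noteq> {} \<and>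
     (\<forall>U\<in>avoiding (\<YY>) x. \<forall>V\<in>avoiding (\<YY>) x. \<exists>W\<in>avoiding (\<YY>) x. U \<subseteq> W \<and> V \<subseteq> W)"
    if "x \<in> carrier (\<YY>)" for x
    using pp_dense_iff[of x] that by simp
  show "x \<sqsubseteq>\<^bsub>\<YY>\<^esub> y \<longleftrightarrow> (\<forall>U\<in>admissible_clopens (\<YY>). x \<in> U \<longrightarrow> y \<in> U)"
    if "x \<in> carrier (\<YY>)" "y \<in> carrier (\<YY>)" for x y
    using that le_iff_compacts[of x y] pp_points_closed unfolding pp_admissible_clopens
    by (auto simp: pp_up_def)
qed

end

lemma right_adjoint_eqI:
  assumes L: "partial_order L" and M: "partial_order M"
    and r: "r \<in> carrier M \<rightarrow>\<^sub>E carrier L"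
    and gc: "galois_connection \<lparr>orderA = L, orderB = M, lower = \<alpha>, upper = r\<rparr>"
  shows "right_adjoint L M \<alpha> = r"
  unfolding right_adjoint_def
proof (rule the_equality)
  show "r \<in> carrier M \<rightarrow>\<^sub>E carrier L \<and>
      galois_connection \<lparr>orderA = L, orderB = M, lower = \<alpha>, upper = r\<rparr>" using r gc by simp
  fix s assume s: "s \<in> carrier M \<rightarrow>\<^sub>E carrier L \<and>
      galois_connection \<lparr>orderA = L, orderB = M, lower = \<alpha>, upper = s\<rparr>"
  interpret L: partial_order L by (rule L)
  show "s = r"
  proof (rule extensionalityI[of _ "carrier M"])
    fix y assume y: "y \<in> carrier M"
    then have c: "r y \<in> carrier L" "s y \<in> carrier L" using r s by auto
    have "x \<sqsubseteq>\<^bsub>L\<^esub> r y \<longleftrightarrow> x \<sqsubseteq>\<^bsub>L\<^esub> s y" if "x \<in> carrier L" for x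
      using galois_connection.galois_property[OF gc, of x y]
        galois_connection.galois_property[of "\<lparr>orderA = L, orderB = M, lower = \<alpha>, upper = s\<rparr>" x y]
        s that y by simp
    then have "r y \<sqsubseteq>\<^bsub>L\<^esub> s y" "s y \<sqsubseteq>\<^bsub>L\<^esub> r y" using c L.le_refl by blast+
    then show "s y = r y" using c L.le_antisym[of "s y" "r y"] by simp
  qed (use r s in \<open>auto simp: PiE_def\<close>)
qed

context frame_hom begin

lemma monotone: "x \<in> carrier L \<Longrightarrow> y \<in> carrier L \<Longrightarrow> x \<sqsubseteq>\<^bsub>L\<^esub> y \<Longrightarrow> \<alpha> x \<sqsubseteq>\<^bsub>M\<^esub> \<alpha> y"
proof -
  assume xy: "x \<in> carrier L" "y \<in> carrier L" "x \<sqsubseteq>\<^bsub>L\<^esub> y"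
  have "\<Squnion>\<^bsub>L\<^esub>{x, y} = y" by (rule L.sup_eqI, rule least_UpperI) (use xy in auto)
  then have "\<alpha> y = \<Squnion>\<^bsub>M\<^esub>{\<alpha> x, \<alpha> y}" using preserves_sup[of "{x, y}"] xy by simp
  then show ?thesis using M.sup_upper[of "{\<alpha> x, \<alpha> y}" "\<alpha> x"] closed xy by simp
qed

definition radj :: "'b \<Rightarrow> 'a" where
  "radj = restrict (\<lambda>y. \<Squnion>\<^bsub>L\<^esub>{x \<in> carrier L. \<alpha> x \<sqsubseteq>\<^bsub>M\<^esub> y}) (carrier M)"

lemma radj_closed: "y \<in> carrier M \<Longrightarrow> radj y \<in> carrier L"
  using L.sup_closed[of "{x \<in> carrier L. \<alpha> x \<sqsubseteq>\<^bsub>M\<^esub> y}"] by (auto simp: radj_def)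

lemma radj_adjoint:
  assumes x: "x \<in> carrier L" and y: "y \<in> carrier M"
  shows "\<alpha> x \<sqsubseteq>\<^bsub>M\<^esub> y \<longleftrightarrow> x \<sqsubseteq>\<^bsub>L\<^esub> radj y"
proof
  let ?S = "{x \<in> carrier L. \<alpha> x \<sqsubseteq>\<^bsub>M\<^esub> y}"
  have S: "?S \<subseteq> carrier L" by blast
  show "x \<sqsubseteq>\<^bsub>L\<^esub> radj y" if "\<alpha> x \<sqsubseteq>\<^bsub>M\<^esub> y"
    using L.sup_upper[OF S, of x] that x y by (simp add: radj_def)
  show "\<alpha> x \<sqsubseteq>\<^bsub>M\<^esub> y" if "x \<sqsubseteq>\<^bsub>L\<^esub> radj y"
  proof (rule M.le_trans)
    show "\<alpha> x \<sqsubseteq>\<^bsub>M\<^esub> \<alpha> (radj y)" using monotone[OF x radj_closed[OF y] that] .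
    have "\<Squnion>\<^bsub>M\<^esub>(\<alpha> ` ?S) \<sqsubseteq>\<^bsub>M\<^esub> y" by (rule M.sup_least) (use closed y in auto)
    then show "\<alpha> (radj y) \<sqsubseteq>\<^bsub>M\<^esub> y" using preserves_sup[OF S] y by (simp add: radj_def)
  qed (use x y closed radj_closed in auto)
qed

lemma right_adjoint_eq: "right_adjoint L M \<alpha> = radj"
proof (rule right_adjoint_eqI[OF L.partial_order_axioms M.partial_order_axioms])
  show "radj \<in> carrier M \<rightarrow>\<^sub>E carrier L" using radj_closed by (auto simp: radj_def)
  show "galois_connection \<lparr>orderA = L, orderB = M, lower = \<alpha>, upper = radj\<rparr>"
    using closed radj_closed radj_adjoint L.partial_order_axioms M.partial_order_axioms
    by (simp add: galois_connection_def connection_def galois_connection_axioms_def)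
qed

text \<open>The points related to \<open>p\<close> are those above \<open>radj p\<close>. As there are enough primes, all of them are above
  \<open>k\<close> only if \<open>radj p\<close> is, and this is transposed along the adjunction. The box operation thus
  restricts to \<open>\<alpha>\<close> on compact elements, which makes the relation a morphism and the assignment
  functorial.\<close>

lemma box_pp_up:
  assumes k: "k \<in> compact_elements L"
  shows "box (pp_space M) (pp_relation L M \<alpha>) (L.pp_up k) = M.pp_up (\<alpha> k)"
proof -
  note kc = L.compact_closed[OF k]
  have "pp_relation L M \<alpha> `` {p} \<subseteq> L.pp_up k \<longleftrightarrow> \<alpha> k \<sqsubseteq>\<^bsub>M\<^esub> p" if p: "p \<in> pp_points M" for p
  proof -
    have pc: "p \<in> carrier M" using p M.pp_points_closed by blast
    note rc = radj_closed[OF pc]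
    have "pp_relation L M \<alpha> `` {p} = L.pp_up (radj p)"
      using p by (auto simp: pp_relation_def right_adjoint_eq L.pp_up_def)
    then show ?thesis using L.pp_up_subset_iff[OF rc kc] radj_adjoint[OF kc pc] by simp
  qed
  then show ?thesis by (auto simp: box_def M.pp_up_def)
qed

lemma pp_relation_morphism: "pp_relation L M \<alpha> \<in> priestley_morphisms (pp_space M) (pp_space L)"
proof -
  have "\<exists>U\<in>admissible_clopens (pp_space L). pp_relation L M \<alpha> `` {p} \<subseteq> U \<and> q \<notin> U"
    if pq: "p \<in> pp_points M" "q \<in> pp_points L" "(p, q) \<notin> pp_relation L M \<alpha>" for p q
  proof -
    have pc: "p \<in> carrier M" and qc: "q \<in> carrier L"
      using pq L.pp_points_closed M.pp_points_closed by auto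
    note rc = radj_closed[OF pc]
    have "\<not> radj p \<sqsubseteq>\<^bsub>L\<^esub> q" using pq by (simp add: pp_relation_def right_adjoint_eq)
    then obtain k where k: "k \<in> compact_elements L" "k \<sqsubseteq>\<^bsub>L\<^esub> radj p" "\<not> k \<sqsubseteq>\<^bsub>L\<^esub> q"
      using L.compact_witness[OF rc qc] by blast
    have "p \<in> M.pp_up (\<alpha> k)"
      using radj_adjoint[OF L.compact_closed[OF k(1)] pc] k pq by (simp add: M.pp_up_def)
    then have "pp_relation L M \<alpha> `` {p} \<subseteq> L.pp_up k" using box_pp_up[OF k(1)] by (auto simp: box_def)
    moreover have "q \<notin> L.pp_up k" using k by (simp add: L.pp_up_def)
    ultimately show ?thesis using L.pp_up_admissible[OF k(1)] by blast
  qed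
  moreover have "pp_relation L M \<alpha> \<subseteq> pp_points M \<times> pp_points L" by (auto simp: pp_relation_def)
  moreover have "box (pp_space M) (pp_relation L M \<alpha>) U \<in> admissible_clopens (pp_space M)"
    if "U \<in> admissible_clopens (pp_space L)" for U
    using that box_pp_up preserves_compact M.pp_up_admissible unfolding L.pp_admissible_clopens by auto
  ultimately show ?thesis by (simp add: priestley_morphisms_def)
qed

end

lemma frame_homI:
  "alg_frame L \<Longrightarrow> alg_frame M \<Longrightarrow> f \<in> join_compact_hom L M \<Longrightarrow> frame_hom L M f"
  by (simp add: frame_hom_def frame_hom_axioms_def)

lemma pseudoprime_functor: "contravariant_functor AlgFrmSup PGPS functor_Y"
  unfolding contravariant_functor_def
proof (intro conjI ballI PGPS_is_category AlgFrmSup_is_category)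
  fix L :: "'a gorder" assume obj: "L \<in> Obj AlgFrmSup"
  then interpret alg_frame L by (simp add: AlgFrmSup_def alg_frame_iff)
  show "OMap functor_Y L \<in> Obj PGPS" by (simp add: functor_Y_def PGPS_simps pp_space_pgps)
  interpret X: pgps "pp_space L" using pp_space_pgps by (simp add: pgps_iff)
  have id: "restrict (\<lambda>x. x) (carrier L) \<in> join_compact_hom L L"
    using AlgFrmSup_is_category obj unfolding is_category_def by (force simp: AlgFrmSup_def)
  interpret h: frame_hom L L "restrict (\<lambda>x. x) (carrier L)"
    by (rule frame_homI[OF alg_frame_axioms alg_frame_axioms id])
  have "pp_relation L L (restrict (\<lambda>x. x) (carrier L)) = order_relation (pp_space L)"
  proof (rule morphism_eqI[OF h.pp_relation_morphism X.order_relation_morphism])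
    fix U assume U: "U \<in> admissible_clopens (pp_space L)"
    have "box (pp_space L) (order_relation (pp_space L)) U = U"
      using box_order_relation[OF X.partial_order_axioms admissible_clopen_upset[OF U]] .
    moreover have "box (pp_space L) (pp_relation L L (restrict (\<lambda>x. x) (carrier L))) U = U"
      using U h.box_pp_up compact_closed unfolding pp_admissible_clopens by auto
    ultimately show "box (pp_space L) (pp_relation L L (restrict (\<lambda>x. x) (carrier L))) U =
        box (pp_space L) (order_relation (pp_space L)) U" by simp
  qed
  then show "AMap functor_Y L L (Ident AlgFrmSup L) = Ident PGPS (OMap functor_Y L)"
    by (simp add: functor_Y_def AlgFrmSup_def PGPS_simps)
next
  fix L M :: "'a gorder" and f
  assume "L \<in> Obj AlgFrmSup" "M \<in> Obj AlgFrmSup" "f \<in> Hom AlgFrmSup L M"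
  then interpret frame_hom L M f by (intro frame_homI) (simp_all add: AlgFrmSup_def alg_frame_iff)
  show "AMap functor_Y L M f \<in> Hom PGPS (OMap functor_Y M) (OMap functor_Y L)"
    using pp_relation_morphism by (simp add: functor_Y_def PGPS_simps)
next
  fix L M N :: "'a gorder" and f g
  assume obj: "L \<in> Obj AlgFrmSup" "M \<in> Obj AlgFrmSup" "N \<in> Obj AlgFrmSup"
    "f \<in> Hom AlgFrmSup L M" "g \<in> Hom AlgFrmSup M N"
  then interpret f: frame_hom L M f + g: frame_hom M N g
    by (simp_all add: AlgFrmSup_def alg_frame_iff frame_homI)
  have "Comp AlgFrmSup L M N g f \<in> Hom AlgFrmSup L N"
    using AlgFrmSup_is_category obj unfolding is_category_def by blast
  then have "compose (carrier L) g f \<in> join_compact_hom L N" by (simp add: AlgFrmSup_def)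
  then interpret h: frame_hom L N "compose (carrier L) g f"
    by (rule frame_homI[OF f.L.alg_frame_axioms g.M.alg_frame_axioms])
  have "pp_relation L N (compose (carrier L) g f) =
      priestley_comp (pp_space N) (pp_space M) (pp_space L) (pp_relation L M f) (pp_relation M N g)"
  proof (rule morphism_eqI[OF h.pp_relation_morphism
        comp_morphism[OF g.pp_relation_morphism f.pp_relation_morphism]])
    fix U assume U: "U \<in> admissible_clopens (pp_space L)"
    then obtain k where k: "k \<in> compact_elements L" "U = f.L.pp_up k"
      unfolding f.L.pp_admissible_clopens by blast
    show "box (pp_space N) (pp_relation L N (compose (carrier L) g f)) U =
        box (pp_space N) (priestley_comp (pp_space N) (pp_space M) (pp_space L)
          (pp_relation L M f) (pp_relation M N g)) U"
      using box_comp[OF morphism_subset[OF g.pp_relation_morphism]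
          morphism_subset[OF f.pp_relation_morphism] U]
        h.box_pp_up[OF k(1)] f.box_pp_up[OF k(1)] g.box_pp_up[OF f.preserves_compact[OF k(1)]]
        k f.L.compact_closed[OF k(1)]
      by (simp add: compose_eq)
  qed
  then show "AMap functor_Y L N (Comp AlgFrmSup L M N g f) =
      Comp PGPS (OMap functor_Y N) (OMap functor_Y M) (OMap functor_Y L)
        (AMap functor_Y L M f) (AMap functor_Y M N g)"
    by (simp add: functor_Y_def AlgFrmSup_def PGPS_simps)
qed

section \<open>Optimal filters are pseudoprime filters\<close>

lemma envelope_simps [simp]:
  "carrier (distributive_envelope M) = envelope_sets M" "le (distributive_envelope M) = (\<subseteq>)"
  "eq (distributive_envelope M) = (=)"
  by (simp_all add: distributive_envelope_def)

lemma envelope_subset: "W \<in> envelope_sets M \<Longrightarrow> W \<subseteq> prime_filters M"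
  by (induction rule: envelope_sets.induct) (auto simp: prime_hat_def)

context dms begin

sublocale ff: alg_frame "\<FF>"
  using filter_frame_algebraic by (simp add: alg_frame_iff)

lemma prime_filters_eq: "prime_filters M = prime_elements (\<FF>)"
  using filter_meet_eq by (auto simp: prime_filters_def prime_elements_def filter_frame_top)

lemma prime_filter_filter: "P \<in> prime_filters M \<Longrightarrow> P \<in> filters M"
  by (simp add: prime_filters_def)

lemma prime_hat_top: "prime_hat M \<top> = prime_filters M"
  using filter_top prime_filter_filter by (auto simp: prime_hat_def)

lemma prime_hat_mono:
  "a \<in> carrier M \<Longrightarrow> b \<in> carrier M \<Longrightarrow> a \<sqsubseteq> b \<Longrightarrow> prime_hat M a \<subseteq> prime_hat M b"
  using filter_up prime_filter_filter by (auto simp: prime_hat_def)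

lemma prime_hat_meet:
  assumes "a \<in> carrier M" "b \<in> carrier M"
  shows "prime_hat M (a \<sqinter> b) = prime_hat M a \<inter> prime_hat M b"
proof
  show "prime_hat M (a \<sqinter> b) \<subseteq> prime_hat M a \<inter> prime_hat M b"
    using assms prime_hat_mono[of "a \<sqinter> b" a] prime_hat_mono[of "a \<sqinter> b" b] meet_left meet_right by auto
  show "prime_hat M a \<inter> prime_hat M b \<subseteq> prime_hat M (a \<sqinter> b)"
    using prime_filter_filter filter_meet by (auto simp: prime_hat_def)
qed

text \<open>This translates the hypothesis in the definition of a pseudoprime filter into a covering condition
  in the distributive envelope. Both directions test containment of filters on prime filters, of which
  there are enough.\<close>

lemma meet_principal_subset_iff:
  assumes A: "finite A" "A \<subseteq> carrier M" and b: "b \<in> carrier M"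
  shows "\<Sqinter>\<^bsub>\<FF>\<^esub>(up M ` A) \<subseteq> up M b \<longleftrightarrow> prime_hat M b \<subseteq> \<Union>(prime_hat M ` A)"
proof -
  have uc: "up M ` A \<subseteq> carrier (\<FF>)" using A principal_filter by auto
  let ?m = "\<Sqinter>\<^bsub>\<FF>\<^esub>(up M ` A)"
  have mc: "?m \<in> carrier (\<FF>)" using ff.inf_closed[OF uc] .
  show ?thesis
  proof
    assume sub: "?m \<subseteq> up M b"
    show "prime_hat M b \<subseteq> \<Union>(prime_hat M ` A)"
    proof
      fix P assume "P \<in> prime_hat M b"
      then have P: "P \<in> prime_filters M" "b \<in> P" by (auto simp: prime_hat_def)
      have "up M b \<subseteq> P" using principal_filter_subset_iff[OF prime_filter_filter[OF P(1)] b] P by simp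
      then have "?m \<sqsubseteq>\<^bsub>\<FF>\<^esub> P" using sub by simp
      then obtain a where a: "a \<in> A" "up M a \<subseteq> P"
        using ff.prime_finite_meet[of P "up M ` A"] P(1) A uc prime_filters_eq by auto
      then have "a \<in> P" using principal_filter_subset_iff[OF prime_filter_filter[OF P(1)]] A by blast
      then show "P \<in> \<Union>(prime_hat M ` A)" using a P by (auto simp: prime_hat_def)
    qed
  next
    assume sub: "prime_hat M b \<subseteq> \<Union>(prime_hat M ` A)"
    have "?m \<sqsubseteq>\<^bsub>\<FF>\<^esub> up M b"
    proof (rule ff.enough_primes[OF mc])
      show "up M b \<in> carrier (\<FF>)" using principal_filter b by simp
      fix P assume "P \<in> prime_elements (\<FF>)" "up M b \<sqsubseteq>\<^bsub>\<FF>\<^esub> P"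
      then have P: "P \<in> prime_filters M" "up M b \<subseteq> P" using prime_filters_eq by auto
      then have "P \<in> prime_hat M b"
        using principal_filter_subset_iff[OF prime_filter_filter b] by (auto simp: prime_hat_def)
      then obtain a where a: "a \<in> A" "a \<in> P" using sub by (auto simp: prime_hat_def)
      then have "up M a \<subseteq> P" using principal_filter_subset_iff[OF prime_filter_filter[OF P(1)]] A by blast
      moreover have "?m \<subseteq> up M a" using ff.inf_lower[OF uc, of "up M a"] a by simp
      ultimately show "?m \<sqsubseteq>\<^bsub>\<FF>\<^esub> P" by simp
    qed
    then show "?m \<subseteq> up M b" by simp
  qed
qed

text \<open>It follows that a filter of the envelope that contains the whole semilattice is not proper.\<close>

lemma envelope_above_hat: "W \<in> envelope_sets M \<Longrightarrow> \<exists>a\<in>carrier M. prime_hat M a \<subseteq> W"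
proof (induction rule: envelope_sets.induct)
  case (inter U V)
  then obtain a b where "a \<in> carrier M" "b \<in> carrier M" "prime_hat M a \<subseteq> U" "prime_hat M b \<subseteq> V" by blast
  then have "prime_hat M (a \<sqinter> b) \<subseteq> U \<inter> V" "a \<sqinter> b \<in> carrier M" using prime_hat_meet by auto
  then show ?case by blast
qed auto

lemma envelope_dms: "dms (\<DD>)"
proof -
  have po: "partial_order (\<DD>)"
    unfolding distributive_envelope_def by (rule partial_order_subset)
  have inf: "greatest (\<DD>) (U \<inter> V) (Lower (\<DD>) {U, V})"
    if "U \<in> envelope_sets M" "V \<in> envelope_sets M" for U V
    using that envelope_sets.inter by (auto simp: greatest_def Lower_def)
  have meet: "U \<sqinter>\<^bsub>\<DD>\<^esub> V = U \<inter> V"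
    if "U \<in> envelope_sets M" "V \<in> envelope_sets M" for U V
    unfolding meet_def using partial_order.inf_eqI[OF po inf[OF that]] .
  interpret E: partial_order "\<DD>" by (rule po)
  show ?thesis
  proof unfold_locales
    show "\<exists>s. greatest (\<DD>) s (Lower (\<DD>) {U, V})"
      if "U \<in> carrier (\<DD>)" "V \<in> carrier (\<DD>)" for U V
      using inf that by auto
    have "greatest (\<DD>) (prime_hat M \<top>) (carrier (\<DD>))"
      using envelope_sets.hat[of \<top> M] by (auto simp: greatest_def prime_hat_top dest: envelope_subset)
    then show "\<exists>x. greatest (\<DD>) x (carrier (\<DD>))" by blast
    fix a b c assume abc: "a \<in> carrier (\<DD>)" "b \<in> carrier (\<DD>)"
      "c \<in> carrier (\<DD>)"
      "a \<sqinter>\<^bsub>\<DD>\<^esub> b \<sqsubseteq>\<^bsub>\<DD>\<^esub> c"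
    then have un: "a \<union> c \<in> envelope_sets M" "b \<union> c \<in> envelope_sets M"
      by (auto intro: envelope_sets.union)
    have "(a \<union> c) \<inter> (b \<union> c) = c" using abc meet by auto
    then have "(a \<union> c) \<sqinter>\<^bsub>\<DD>\<^esub> (b \<union> c) = c" using meet un by simp
    then show "\<exists>a'\<in>carrier (\<DD>). \<exists>b'\<in>carrier (\<DD>).
        a \<sqsubseteq>\<^bsub>\<DD>\<^esub> a' \<and> b \<sqsubseteq>\<^bsub>\<DD>\<^esub> b' \<and>
        a' \<sqinter>\<^bsub>\<DD>\<^esub> b' = c"
      using un by (intro bexI[of _ "a \<union> c"] bexI[of _ "b \<union> c"]) simp_all
  qed
qed

lemma envelope_meet:
  assumes "U \<in> envelope_sets M" "V \<in> envelope_sets M"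
  shows "U \<sqinter>\<^bsub>\<DD>\<^esub> V = U \<inter> V"
proof -
  interpret E: dms "\<DD>" by (rule envelope_dms)
  have "greatest (\<DD>) (U \<inter> V) (Lower (\<DD>) {U, V})"
    using assms envelope_sets.inter by (auto simp: greatest_def Lower_def)
  then show ?thesis unfolding meet_def by (rule E.inf_eqI)
qed

text \<open>If a finite meet of principal filters of \<open>a\<^sub>1, \<dots>, a\<^sub>n\<close> is contained in that of a member \<open>b\<close> of
  the trace, then \<open>prime_hat M b\<close> is covered by the sets \<open>prime_hat M a\<^sub>i\<close>, and primality of \<open>P\<close> puts
  one of them into \<open>P\<close>.\<close>

lemma optimal_filter_is_pseudoprime:
  assumes P: "P \<in> prime_filters (\<DD>)"
  shows "{a \<in> carrier M. prime_hat M a \<in> P} \<in> pseudoprime_elements (\<FF>)"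
proof -
  interpret E: dms "\<DD>" by (rule envelope_dms)
  let ?G = "{a \<in> carrier M. prime_hat M a \<in> P}"
  note Pf = E.prime_filter_filter[OF P]
  have hatE: "prime_hat M a \<in> envelope_sets M" if "a \<in> carrier M" for a
    using envelope_sets.hat that .
  have G: "?G \<in> filters M"
  proof (rule filterI)
    have "\<top>\<^bsub>\<DD>\<^esub> \<subseteq> prime_hat M \<top>"
      using E.top_closed envelope_subset prime_hat_top by simp
    then have "prime_hat M \<top> \<in> P"
      using E.filter_up[OF Pf E.filter_top[OF Pf], of "prime_hat M \<top>"] hatE by simp
    then show "\<top> \<in> ?G" by simp
    show "y \<in> ?G" if x: "x \<in> ?G" and y: "y \<in> carrier M" "x \<sqsubseteq> y" for x y
      using E.filter_up[OF Pf, of "prime_hat M x" "prime_hat M y"] hatE prime_hat_mono[of x y] x y by simp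
    show "x \<sqinter> y \<in> ?G" if x: "x \<in> ?G" and y: "y \<in> ?G" for x y
      using E.filter_meet[OF Pf, of "prime_hat M x" "prime_hat M y"] hatE x y
        envelope_meet[of "prime_hat M x" "prime_hat M y"] prime_hat_meet by simp
  qed auto
  have "?G \<noteq> carrier M"
  proof
    assume G_eq: "?G = carrier M"
    have "W \<in> P" if W: "W \<in> envelope_sets M" for W
    proof -
      obtain a where a: "a \<in> carrier M" "prime_hat M a \<subseteq> W" using envelope_above_hat[OF W] by blast
      then have "prime_hat M a \<in> P" using G_eq by blast
      then show ?thesis using E.filter_up[OF Pf, of _ W] a W by simp
    qed
    then have "P = envelope_sets M" using E.filter_closed[OF Pf] by auto
    then show False using P by (simp add: prime_filters_def)
  qed
  moreover have "?G \<in> pp_points (\<FF>)"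
    unfolding ff.pp_points_iff
  proof (intro conjI allI impI)
    show "?G \<in> carrier (\<FF>)" using G by simp
    fix \<A> F assume *: "finite \<A> \<and> \<A> \<noteq> {} \<and> \<A> \<subseteq> compact_elements (\<FF>) \<and>
      F \<in> compact_elements (\<FF>) \<and>
      \<Sqinter>\<^bsub>\<FF>\<^esub>\<A> \<sqsubseteq>\<^bsub>\<FF>\<^esub> F \<and> F \<sqsubseteq>\<^bsub>\<FF>\<^esub> ?G"
    then obtain A where A: "finite A" "A \<subseteq> carrier M" "\<A> = up M ` A"
      unfolding compact_filters using finite_subset_image[of \<A> "up M" "carrier M"] by blast
    obtain b where b: "b \<in> carrier M" "F = up M b" using * compact_filters by blast
    have bG: "b \<in> ?G" using * b principal_filter_subset_iff[OF G b(1)] by simp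
    have cover: "prime_hat M b \<subseteq> \<Union>(prime_hat M ` A)"
      using meet_principal_subset_iff[OF A(1,2) b(1)] * A b by simp
    let ?A = "up (\<DD>) ` prime_hat M ` A"
    have Ac: "?A \<subseteq> carrier (filter_frame (\<DD>))"
      using hatE A E.principal_filter by auto
    have "\<Sqinter>\<^bsub>filter_frame (\<DD>)\<^esub>?A \<subseteq> P"
    proof
      fix V assume V: "V \<in> \<Sqinter>\<^bsub>filter_frame (\<DD>)\<^esub>?A"
      have Vc: "V \<in> envelope_sets M"
        using E.ff.inf_closed[OF Ac] V E.filter_closed by auto
      have "prime_hat M a \<subseteq> V" if "a \<in> A" for a
        using E.ff.inf_lower[OF Ac, of "up (\<DD>) (prime_hat M a)"] that V
        by (auto simp: up_def)
      then have "prime_hat M b \<subseteq> V" using cover by blast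
      then show "V \<in> P" using E.filter_up[OF Pf, of "prime_hat M b" V] bG Vc by simp
    qed
    then have "\<exists>Q\<in>?A. Q \<subseteq> P"
      using E.ff.prime_finite_meet[of P ?A] P E.prime_filters_eq A Ac by auto
    then obtain a where a: "a \<in> A" "up (\<DD>) (prime_hat M a) \<subseteq> P" by blast
    have "prime_hat M a \<in> P"
      using E.principal_filter_subset_iff[OF Pf, of "prime_hat M a"] a hatE A by auto
    then have "up M a \<subseteq> ?G" using principal_filter_subset_iff[OF G, of a] a A by auto
    then show "\<exists>k\<in>\<A>. k \<sqsubseteq>\<^bsub>\<FF>\<^esub> ?G" using a A by auto
  qed
  ultimately show ?thesis by (auto simp: pp_points_def filter_frame_top)
qed

text \<open>For the converse, \<open>G\<close> generates a filter of the envelope, and the complement of \<open>G\<close> generates an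
  ideal. Pseudoprimality of \<open>G\<close> says that they are disjoint, so they are separated by a prime filter,
  whose trace on the semilattice must be \<open>G\<close>.\<close>

lemma pseudoprime_is_optimal_filter:
  assumes G: "G \<in> pseudoprime_elements (\<FF>)"
  shows "\<exists>P\<in>prime_filters (\<DD>). G = {a \<in> carrier M. prime_hat M a \<in> P}"
proof -
  interpret E: dms "\<DD>" by (rule envelope_dms)
  have Gf: "G \<in> filters M" and Gne: "G \<noteq> carrier M"
    using G by (auto simp: pseudoprime_elements_def filter_frame_top)
  have Gpp: "G \<in> pp_points (\<FF>)" using G by (simp add: pp_points_def)
  note Gc = filter_closed[OF Gf]
  have hatE: "prime_hat M a \<in> envelope_sets M" if "a \<in> carrier M" for a
    using envelope_sets.hat that .
  define F0 where "F0 = {W \<in> envelope_sets M. \<exists>a\<in>G. prime_hat M a \<subseteq> W}"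
  define J where "J = {W \<in> envelope_sets M.
    \<exists>B. finite B \<and> B \<noteq> {} \<and> B \<subseteq> carrier M - G \<and> W \<subseteq> \<Union>(prime_hat M ` B)}"
  let ?I = "up (\<DD>) ` J"
  have F0: "F0 \<in> filters (\<DD>)"
  proof (rule E.filterI)
    have "prime_hat M \<top> \<subseteq> \<top>\<^bsub>\<DD>\<^esub>"
      using E.top_higher[of "prime_hat M \<top>"] hatE by simp
    then show "\<top>\<^bsub>\<DD>\<^esub> \<in> F0"
      using E.top_closed filter_top[OF Gf] by (auto simp: F0_def)
    show "U \<sqinter>\<^bsub>\<DD>\<^esub> V \<in> F0" if UV: "U \<in> F0" "V \<in> F0" for U V
    proof -
      obtain a b where ab: "a \<in> G" "b \<in> G" "prime_hat M a \<subseteq> U" "prime_hat M b \<subseteq> V"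
        using UV by (auto simp: F0_def)
      then have "prime_hat M (a \<sqinter> b) \<subseteq> U \<inter> V" using prime_hat_meet[of a b] Gc by blast
      moreover have "a \<sqinter> b \<in> G" using filter_meet[OF Gf] ab by blast
      ultimately show ?thesis
        using UV envelope_meet[of U V] envelope_sets.inter[of U M V] unfolding F0_def by auto
    qed
  qed (auto simp: F0_def)
  have disjoint: "W \<notin> F0" if W: "W \<in> J" for W
  proof
    assume "W \<in> F0"
    then obtain a where a: "a \<in> G" "prime_hat M a \<subseteq> W" by (auto simp: F0_def)
    obtain B where B: "finite B" "B \<noteq> {}" "B \<subseteq> carrier M - G" "W \<subseteq> \<Union>(prime_hat M ` B)"
      using W by (auto simp: J_def)
    have ac: "a \<in> carrier M" using a Gc by blast
    have Bc: "B \<subseteq> carrier M" using B by blast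
    have le: "\<Sqinter>\<^bsub>\<FF>\<^esub>(up M ` B) \<sqsubseteq>\<^bsub>\<FF>\<^esub> up M a"
      using meet_principal_subset_iff[OF B(1) Bc ac] a B by auto
    have "finite (up M ` B)" "up M ` B \<noteq> {}" "up M ` B \<subseteq> compact_elements (\<FF>)"
      "up M a \<in> compact_elements (\<FF>)" "up M a \<sqsubseteq>\<^bsub>\<FF>\<^esub> G"
      using B ac compact_filters principal_filter_subset_iff[OF Gf ac] a by auto
    then have "\<exists>k\<in>up M ` B. k \<sqsubseteq>\<^bsub>\<FF>\<^esub> G"
      using Gpp le unfolding ff.pp_points_iff by blast
    then obtain b where "b \<in> B" "up M b \<subseteq> G" by auto
    then have "b \<in> G" using principal_filter_subset_iff[OF Gf, of b] Bc by blast
    then show False using B \<open>b \<in> B\<close> by blast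
  qed
  have hatJ: "prime_hat M b \<in> J" if "b \<in> carrier M" "b \<notin> G" for b
    unfolding J_def using that hatE by (auto intro!: exI[of _ "{b}"])
  have J_le: "up (\<DD>) W \<subseteq> F \<longleftrightarrow> W \<in> F"
    if "W \<in> J" "F \<in> filters (\<DD>)" for W F
    using E.principal_filter_subset_iff[OF that(2), of W] that(1) by (simp add: J_def)
  have "\<exists>q\<in>prime_elements (filter_frame (\<DD>)).
      F0 \<sqsubseteq>\<^bsub>filter_frame (\<DD>)\<^esub> q \<and>
      (\<forall>c\<in>?I. \<not> c \<sqsubseteq>\<^bsub>filter_frame (\<DD>)\<^esub> q)"
  proof (rule E.ff.prime_above)
    show "F0 \<in> carrier (filter_frame (\<DD>))" using F0 by simp
    show "?I \<subseteq> compact_elements (filter_frame (\<DD>))"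
      unfolding E.compact_filters by (auto simp: J_def)
    obtain b where "b \<in> carrier M" "b \<notin> G" using Gne Gc by blast
    then show "?I \<noteq> {}" using hatJ by blast
    show "\<not> c \<sqsubseteq>\<^bsub>filter_frame (\<DD>)\<^esub> F0" if "c \<in> ?I" for c
      using that disjoint J_le F0 by auto
    show "\<exists>e\<in>?I. e \<sqsubseteq>\<^bsub>filter_frame (\<DD>)\<^esub> c \<and>
        e \<sqsubseteq>\<^bsub>filter_frame (\<DD>)\<^esub> d" if cd: "c \<in> ?I" "d \<in> ?I" for c d
    proof -
      obtain U V where UV: "U \<in> J" "V \<in> J" "c = up (\<DD>) U"
        "d = up (\<DD>) V" using cd by blast
      obtain B where B: "finite B" "B \<noteq> {}" "B \<subseteq> carrier M - G" "U \<subseteq> \<Union>(prime_hat M ` B)"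
        using UV by (auto simp: J_def)
      obtain C where C: "finite C" "C \<noteq> {}" "C \<subseteq> carrier M - G" "V \<subseteq> \<Union>(prime_hat M ` C)"
        using UV by (auto simp: J_def)
      have "U \<union> V \<in> envelope_sets M" using UV by (auto simp: J_def intro: envelope_sets.union)
      moreover have "U \<union> V \<subseteq> \<Union>(prime_hat M ` (B \<union> C))" using B C by blast
      moreover have "finite (B \<union> C)" "B \<union> C \<noteq> {}" "B \<union> C \<subseteq> carrier M - G" using B C by auto
      ultimately have "U \<union> V \<in> J" unfolding J_def by blast
      moreover have "up (\<DD>) (U \<union> V) \<subseteq> c" "up (\<DD>) (U \<union> V) \<subseteq> d"
        using UV by (auto simp: up_def)
      ultimately show ?thesis by (auto intro!: bexI[of _ "up (\<DD>) (U \<union> V)"])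
    qed
  qed
  then obtain P where P: "P \<in> prime_filters (\<DD>)" "F0 \<subseteq> P"
    and out: "\<And>W. W \<in> J \<Longrightarrow> \<not> up (\<DD>) W \<subseteq> P"
    using E.prime_filters_eq by auto
  have "W \<notin> P" if "W \<in> J" for W using out[OF that] J_le[OF that E.prime_filter_filter[OF P(1)]] by simp
  then have "a \<in> G \<longleftrightarrow> prime_hat M a \<in> P" if "a \<in> carrier M" for a
    using that hatJ[of a] P(2) hatE[of a] unfolding F0_def by blast
  then have "G = {a \<in> carrier M. prime_hat M a \<in> P}" using Gc by auto
  then show ?thesis using P by blast
qed

lemma optimal_filters_eq: "optimal_filters M = pseudoprime_elements (\<FF>)"
  unfolding optimal_filters_def
  using optimal_filter_is_pseudoprime pseudoprime_is_optimal_filter by blast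

lemma dual_points_eq: "dual_points M = pp_points (\<FF>)"
  by (simp add: dual_points_def pp_points_def optimal_filters_eq filter_frame_top)

text \<open>The compact elements of the filter frame are the principal filters, and a point contains the
  principal filter of \<open>a\<close> if and only if \<open>a\<close> belongs to it. Hence the two subbases have the same
  traces on the points.\<close>

lemma dual_space_eq: "dual_space M = pp_space (\<FF>)"
proof -
  let ?F = "\<FF>"
  have hat: "up ?F (up M a) \<inter> pp_points ?F = dual_basic M a" if a: "a \<in> carrier M" for a
    using principal_filter_subset_iff[OF _ a] ff.pp_points_closed
    by (auto simp: up_def[of ?F] dual_basic_def dual_points_eq)
  have co: "(carrier ?F - up ?F (up M a)) \<inter> pp_points ?F = dual_points M - dual_basic M a"
    if a: "a \<in> carrier M" for a
    using hat[OF a] ff.pp_points_closed dual_points_eq by blast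
  have "(\<lambda>S. S \<inter> pp_points ?F) ` (up ?F ` compact_elements ?F \<union>
      (\<lambda>l. carrier ?F - up ?F l) ` compact_elements ?F) =
      (\<lambda>a. up ?F (up M a) \<inter> pp_points ?F) ` carrier M \<union>
      (\<lambda>a. (carrier ?F - up ?F (up M a)) \<inter> pp_points ?F) ` carrier M"
    by (simp only: compact_filters image_Un image_image)
  also have "\<dots> = dual_basic M ` carrier M \<union> (\<lambda>a. dual_points M - dual_basic M a) ` carrier M"
    using hat co by (intro arg_cong2[of _ _ _ _ "(\<union>)"] image_cong) auto
  finally have "subtopology (lambda_topology ?F) (pp_points ?F) = topology_generated_by
      (dual_basic M ` carrier M \<union> (\<lambda>a. dual_points M - dual_basic M a) ` carrier M)"
    by (simp only: lambda_topology_def subtopology_generated_by)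
  then show ?thesis
    by (simp add: dual_space_def pp_space_def dual_points_eq prime_filters_eq filter_frame_top)
qed

end

lemma (in dms_hom) dual_relation_eq:
  "dual_relation M N \<alpha> = pp_relation (filter_frame M) (filter_frame N) (filter_map M N \<alpha>)"
proof -
  have "right_adjoint (filter_frame M) (filter_frame N) (filter_map M N \<alpha>) =
      restrict (\<lambda>H. {a \<in> carrier M. \<alpha> a \<in> H}) (filters N)"
    by (rule right_adjoint_eqI[OF M.filter_frame_partial_order N.filter_frame_partial_order _ filter_map_galois])
      (use preimage_filter in auto)
  then have "right_adjoint (filter_frame M) (filter_frame N) (filter_map M N \<alpha>) x =
      {a \<in> carrier M. \<alpha> a \<in> x}" if "x \<in> pp_points (filter_frame N)" for x
    using N.ff.pp_points_closed that by auto
  then show ?thesis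
    by (auto simp: dual_relation_def pp_relation_def M.dual_points_eq N.dual_points_eq)
qed

lemma dual_space_functor_eq: "functors_equal DMS functor_X (after_covariant functor_Y functor_F)"
  unfolding functors_equal_def
proof (intro conjI ballI)
  fix M :: "'a gorder" assume "M \<in> Obj DMS"
  then interpret dms M by (simp add: DMS_def dms_iff)
  show "OMap functor_X M = OMap (after_covariant functor_Y functor_F) M"
    by (simp add: functor_X_def after_covariant_def functor_Y_def functor_F_def dual_space_eq)
next
  fix M N :: "'a gorder" and f
  assume "M \<in> Obj DMS" "N \<in> Obj DMS" "f \<in> Hom DMS M N"
  then interpret dms_hom M N f by (simp add: DMS_def dms_iff dms_hom_def dms_hom_axioms_def)
  show "AMap functor_X M N f = AMap (after_covariant functor_Y functor_F) M N f"
    by (simp add: functor_X_def after_covariant_def functor_Y_def functor_F_def dual_relation_eq)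
qed

section \<open>Factorization of the duality functors\<close>

theorem theorem4p30:
  shows
    "covariant_functor (DMS :: ('m gorder, 'm \<Rightarrow> 'm) category) AlgFrmSup functor_F \<and>
     covariant_functor (AlgFrmSup :: ('l gorder, 'l \<Rightarrow> 'l) category) DMS functor_K \<and>
     contravariant_functor (PGPS :: ('x priestley, ('x \<times> 'x) set) category) AlgFrmSup functor_Va \<and>
     contravariant_functor (AlgFrmSup :: ('l gorder, 'l \<Rightarrow> 'l) category) PGPS functor_Y \<and>
     contravariant_functor (DMS :: ('m gorder, 'm \<Rightarrow> 'm) category) PGPS functor_X \<and>
     contravariant_functor (PGPS :: ('x priestley, ('x \<times> 'x) set) category) DMS functor_A \<and>
     functors_equal (DMS :: ('m gorder, 'm \<Rightarrow> 'm) category)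
       functor_X (after_covariant functor_Y functor_F) \<and>
     functors_equal (PGPS :: ('x priestley, ('x \<times> 'x) set) category)
       functor_A (after_contravariant functor_K functor_Va)"
  by (intro conjI filter_functor compact_functor closed_upset_functor pseudoprime_functor
      dual_space_functor_eq admissible_clopen_functor_eq
      contravariant_functor_cong[OF dual_space_functor_eq
        covariant_then_contravariant[OF filter_functor pseudoprime_functor]]
      contravariant_functor_cong[OF admissible_clopen_functor_eq
        contravariant_then_covariant[OF closed_upset_functor compact_functor]])

end
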